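(* There is a RAM algorithm which, given as input a finite $C(4)$ presentation $\langle \mathscr{A} \mid \mathscr{R} \rangle$ and two words $u, v \in \mathscr{A}^*$, decides whether $u$ and $v$ represent the same element of the monoid presented in time $$O\left( |\mathscr{R}|^2 \min(|u|,|v|) \right).$$
   Context: Words are elements of the free monoid $\mathscr{A}^*$, with empty word $\epsilon$; $|w|$ denotes the length of a word $w$. A relation word is a word occurring as one side of a relation of the presentation. A piece is a word which occurs as a factor in sides of two different relations, or as a factor of both sides of a relation, or in two different (possibly overlapping) places within one side of a relation; by convention $\epsilon$ is always a piece. The presentation satisfies $C(n)$, for $n$ a positive integer, if no relation word can be written as a product of strictly fewer than $n$ pieces ($\epsilon$ being the product of zero pieces). $|\mathscr{R}|$ denotes the sum of the lengths of the relation words in $\mathscr{R}$. In the RAM model used, elementary operations involving generators (such as comparing two generators) are single steps performable in constant time. For $C(4)$ presentations no non-empty word represents the identity, so the monoid presented is isomorphic to the semigroup presented with an identity element adjoined. *)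

theory Defs
  imports "HOL-Library.Sublist"
begin

section \<open>Monoid presentations\<close>

(* Words are lists; the free monoid on A is lists A. *)

type_synonym 'a relations = "('a list \<times> 'a list) set"

definition finite_presentation :: "'a set \<Rightarrow> 'a relations \<Rightarrow> bool" where
  "finite_presentation A R \<longleftrightarrow> finite A \<and> finite R \<and> R \<subseteq> lists A \<times> lists A"

inductive_set presentation_cong :: "'a set \<Rightarrow> 'a relations \<Rightarrow> ('a list \<times> 'a list) set"
  for A :: "'a set" and R :: "'a relations" where
  refl: "w \<in> lists A \<Longrightarrow> (w, w) \<in> presentation_cong A R"
| sym: "(v, w) \<in> presentation_cong A R \<Longrightarrow> (w, v) \<in> presentation_cong A R"
| trans: "(u, v) \<in> presentation_cong A R \<Longrightarrow> (v, w) \<in> presentation_cong A R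
    \<Longrightarrow> (u, w) \<in> presentation_cong A R"
| rel: "(l, r) \<in> R \<Longrightarrow> x \<in> lists A \<Longrightarrow> y \<in> lists A
    \<Longrightarrow> (x @ l @ y, x @ r @ y) \<in> presentation_cong A R"

(* The image of the word w in the quotient monoid lists A // presentation_cong A R. *)
definition element_of :: "'a set \<Rightarrow> 'a relations \<Rightarrow> 'a list \<Rightarrow> 'a list set" where
  "element_of A R w = presentation_cong A R `` {w}"

lemma equiv_presentation_cong:
  assumes "finite_presentation A R"
  shows "equiv (lists A) (presentation_cong A R)"
proof (rule equivI)
  have "u \<in> lists A \<and> v \<in> lists A" if "(u, v) \<in> presentation_cong A R" for u v
    using that by induction (use assms in \<open>auto simp: finite_presentation_def\<close>)
  then show "presentation_cong A R \<subseteq> lists A \<times> lists A" by auto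
  show "refl_on (lists A) (presentation_cong A R)"
    by (simp add: refl_on_def presentation_cong.refl)
  show "sym (presentation_cong A R)" by (blast intro: symI presentation_cong.sym)
  show "trans (presentation_cong A R)" by (blast intro: transI presentation_cong.trans)
qed

lemma presentation_cong_context:
  assumes "(u, v) \<in> presentation_cong A R" and "x \<in> lists A" and "y \<in> lists A"
  shows "(x @ u @ y, x @ v @ y) \<in> presentation_cong A R"
  using assms(1)
proof induction
  case (refl w)
  then show ?case using assms(2,3) by (simp add: presentation_cong.refl)
next
  case (rel l r s t)
  then show ?case
    using presentation_cong.rel[of l r R "x @ s" A "t @ y"] assms(2,3) by simp
qed (use assms(2,3) in \<open>auto intro: presentation_cong.intros\<close>)

definition relation_words :: "'a relations \<Rightarrow> 'a list set" where
  "relation_words R = fst ` R \<union> snd ` R"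

definition relations_size :: "'a relations \<Rightarrow> nat" where
  "relations_size R = (\<Sum>(l, r)\<in>R. length l + length r)"


section \<open>Small overlap conditions\<close>

definition factor_of_side :: "'a list \<Rightarrow> 'a list \<times> 'a list \<Rightarrow> bool" where
  "factor_of_side p e \<longleftrightarrow> sublist p (fst e) \<or> sublist p (snd e)"

(* Occurrences of p in w are identified by the part of w preceding them. *)
definition occurs_twice :: "'a list \<Rightarrow> 'a list \<Rightarrow> bool" where
  "occurs_twice p w \<longleftrightarrow> (\<exists>x y x' y'. w = x @ p @ y \<and> w = x' @ p @ y' \<and> x \<noteq> x')"

definition piece :: "'a relations \<Rightarrow> 'a list \<Rightarrow> bool" where
  "piece R p \<longleftrightarrow>
     p = [] \<or>
     (\<exists>e\<in>R. \<exists>f\<in>R. e \<noteq> f \<and> factor_of_side p e \<and> factor_of_side p f) \<or>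
     (\<exists>(l, r)\<in>R. sublist p l \<and> sublist p r) \<or>
     (\<exists>w\<in>relation_words R. occurs_twice p w)"

definition small_overlap :: "nat \<Rightarrow> 'a relations \<Rightarrow> bool" where
  "small_overlap n R \<longleftrightarrow>
     (\<forall>w\<in>relation_words R. \<not> (\<exists>ps. length ps < n \<and> (\<forall>p\<in>set ps. piece R p) \<and> concat ps = w))"


section \<open>Random access machines\<close>

(* A cell holds a natural number or a generator. Generators are opaque: a program, which cannot
   mention any particular generator, can only move them and test them for equality. *)
datatype 'a cell = Num nat | Gen 'a

fun num :: "'a cell \<Rightarrow> nat" where
  "num (Num n) = n"
| "num (Gen a) = 0"

(* Operands are register numbers, except for the constant n in Const, the jump target l in JumpEq
   and the verdict in Halt. There is no multiplication, so that charging one time unit per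
   instruction is reasonable. *)
datatype instr =
    Const nat nat
  | Copy nat nat
  | Add nat nat nat
  | Sub nat nat nat
  | Load nat nat
  | Store nat nat
  | JumpEq nat nat nat
  | Halt bool

type_synonym program = "instr list"

(* Program counter, registers, memory. *)
type_synonym 'a config = "nat \<times> (nat \<Rightarrow> 'a cell) \<times> (nat \<Rightarrow> 'a cell)"

fun exec :: "instr \<Rightarrow> 'a config \<Rightarrow> 'a config" where
  "exec (Const d n) (pc, reg, mem) = (Suc pc, reg(d := Num n), mem)"
| "exec (Copy d a) (pc, reg, mem) = (Suc pc, reg(d := reg a), mem)"
| "exec (Add d a b) (pc, reg, mem) = (Suc pc, reg(d := Num (num (reg a) + num (reg b))), mem)"
| "exec (Sub d a b) (pc, reg, mem) = (Suc pc, reg(d := Num (num (reg a) - num (reg b))), mem)"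
| "exec (Load d a) (pc, reg, mem) = (Suc pc, reg(d := mem (num (reg a))), mem)"
| "exec (Store a b) (pc, reg, mem) = (Suc pc, reg, mem(num (reg a) := reg b))"
| "exec (JumpEq a b l) (pc, reg, mem) = (if reg a = reg b then l else Suc pc, reg, mem)"
| "exec (Halt v) c = c"

(* A machine whose program counter leaves the program is stuck without a verdict. *)
definition step :: "program \<Rightarrow> 'a config \<Rightarrow> 'a config" where
  "step P c = (if fst c < length P then exec (P ! fst c) c else c)"

definition initial_config :: "'a cell list \<Rightarrow> 'a config" where
  "initial_config xs = (0, \<lambda>_. Num 0, \<lambda>i. if i < length xs then xs ! i else Num 0)"

definition halted_with :: "program \<Rightarrow> bool \<Rightarrow> 'a config \<Rightarrow> bool" where
  "halted_with P v c \<longleftrightarrow> fst c < length P \<and> P ! fst c = Halt v"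

definition answers_within :: "program \<Rightarrow> 'a cell list \<Rightarrow> bool \<Rightarrow> nat \<Rightarrow> bool" where
  "answers_within P xs v t \<longleftrightarrow> (\<exists>n\<le>t. halted_with P v ((step P ^^ n) (initial_config xs)))"


section \<open>Problem instances as machine input\<close>

definition encode_word :: "'a list \<Rightarrow> 'a cell list" where
  "encode_word w = Num (length w) # map Gen w"

definition encode_relations :: "('a list \<times> 'a list) list \<Rightarrow> 'a cell list" where
  "encode_relations rs =
     Num (length rs) # concat (map (\<lambda>(l, r). encode_word l @ encode_word r) rs)"

definition encode_instance ::
  "'a list \<Rightarrow> ('a list \<times> 'a list) list \<Rightarrow> 'a list \<Rightarrow> 'a list \<Rightarrow> 'a cell list" where
  "encode_instance as rs u v =
     encode_word as @ encode_relations rs @ encode_word u @ encode_word v"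

(* The lists as and rs enumerate the generators and the relations without repetition. *)
definition word_problem_instance ::
  "'a list \<Rightarrow> ('a list \<times> 'a list) list \<Rightarrow> 'a list \<Rightarrow> 'a list \<Rightarrow> bool" where
  "word_problem_instance as rs u v \<longleftrightarrow>
     distinct as \<and> distinct rs \<and> finite_presentation (set as) (set rs) \<and>
     u \<in> lists (set as) \<and> v \<in> lists (set as)"

(* Running time |R|^2 min(|u|, |v|) up to a constant factor. A factor that vanishes (no relations,
   or an empty word) is read as 1: deciding these inputs also takes time. *)
definition time_scale :: "'a relations \<Rightarrow> 'a list \<Rightarrow> 'a list \<Rightarrow> nat" where
  "time_scale R u v = (max 1 (relations_size R))\<^sup>2 * max 1 (min (length u) (length v))"

end

theory Submission
  imports Defs
begin

text \<open>
  Split every relation word as \<open>r = H r @ Z r\<close>, where \<open>Z r\<close> is its longest suffix that is a piece,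
  and call a word active if it is equivalent to a word beginning with a relation word.
  A word equivalent to one that begins with \<open>r\<close> must itself begin with \<open>H r\<close> or with
  \<open>H r'\<close>, where \<open>r'\<close> is the other side of the relation; hence a word is active iff it is
  \<open>H r @ x\<close> with \<open>x\<close> equivalent to some word beginning with \<open>Z r\<close>, and this can be
  tabulated for all suffixes of a word from right to left. If a word is not active, its first letter
  is never touched by a derivation and can be stripped. If \<open>u = H r @ x\<close> is active,
  then \<open>v\<close> must begin with \<open>H r\<close> or \<open>H r'\<close>, and the comparison of \<open>u\<close> with
  \<open>v\<close> reduces to a comparison of what remains, in front of which \<open>Z r\<close> or \<open>Z r'\<close>
  may have to be put. Such a step uses up at least one letter of each input word
  and costs time quadratic in the presentation, while at most linearly many letters are put in front
  and stripped again; so the shorter input word bounds the number of steps.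
\<close>

section \<open>Derivations and pieces\<close>

text \<open>Only the shorter length enters the bound, so the machine cannot even scan the longer
  word. Hence only the shorter word gets a table; the longer one is merely matched from the left and
  overwritten in place. Table entries depend on suffixes alone, so they survive when a tail is put
  in front. Each such letter needs a new entry, found by one pass over all relation words, and a
  tail is at most as long as a relation word: this is the quadratic cost of a step.

  The obstacle is that a common head cannot simply be cancelled. Behind \<open>H r\<close> the
  remainders may be identified through \<open>Z r\<close> or through \<open>Z r'\<close>, so they
  are compared by a disjunction, and a chain of derivations could alternate between its halves. C(4)
  makes this harmless: among the non-empty pieces at most one can be active in front of a given
  word.

  C(4) also rules out empty relation words, so the number of relations is bounded by their total
  length and the table of relation words has linear size.\<close>

definition partner :: "'a relations \<Rightarrow> 'a list \<Rightarrow> 'a list \<Rightarrow> bool" where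
  "partner R l r \<longleftrightarrow> (l, r) \<in> R \<or> (r, l) \<in> R"

definition rewr :: "'a relations \<Rightarrow> 'a list \<Rightarrow> 'a list \<Rightarrow> bool" where
  "rewr R u v \<longleftrightarrow> (\<exists>a b l r. u = a @ l @ b \<and> v = a @ r @ b \<and> partner R l r)"

lemma partner_sym: "partner R l r \<Longrightarrow> partner R r l"
  by (auto simp: partner_def)

lemma partner_relation_word: "partner R l r \<Longrightarrow> l \<in> relation_words R"
  by (force simp: partner_def relation_words_def)

lemma relation_word_partner: "l \<in> relation_words R \<Longrightarrow> \<exists>r. partner R l r"
  by (force simp: partner_def relation_words_def)

lemma rewrI: "partner R l r \<Longrightarrow> rewr R (a @ l @ b) (a @ r @ b)"
  unfolding rewr_def by blast

lemma rewr_sym: "rewr R u v \<Longrightarrow> rewr R v u"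
  unfolding rewr_def using partner_sym by metis

lemma rewr_context: "rewr R u v \<Longrightarrow> rewr R (x @ u @ y) (x @ v @ y)"
proof -
  assume "rewr R u v"
  then obtain a b l r where "u = a @ l @ b" "v = a @ r @ b" "partner R l r"
    unfolding rewr_def by blast
  then show ?thesis using rewrI[of R l r "x @ a" "b @ y"] by simp
qed

lemma rewrs_sym: "(rewr R)\<^sup>*\<^sup>* u v \<Longrightarrow> (rewr R)\<^sup>*\<^sup>* v u"
  by (induction rule: rtranclp_induct) (auto intro: converse_rtranclp_into_rtranclp rewr_sym)

lemma rewrs_context: "(rewr R)\<^sup>*\<^sup>* u v \<Longrightarrow> (rewr R)\<^sup>*\<^sup>* (x @ u @ y) (x @ v @ y)"
  by (induction rule: rtranclp_induct) (auto intro: rtranclp.rtrancl_into_rtrancl rewr_context)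

lemma presentation_cong_rewrs:
  assumes "finite_presentation A R" "u \<in> lists A" "v \<in> lists A"
  shows "(u, v) \<in> presentation_cong A R \<longleftrightarrow> (rewr R)\<^sup>*\<^sup>* u v"
proof
  assume "(u, v) \<in> presentation_cong A R"
  then show "(rewr R)\<^sup>*\<^sup>* u v"
  proof induction
    case (rel l r x y)
    then have "rewr R (x @ l @ y) (x @ r @ y)" unfolding rewr_def partner_def by blast
    then show ?case by blast
  qed (auto intro: rewrs_sym)
next
  have R: "R \<subseteq> lists A \<times> lists A" using assms(1) by (simp add: finite_presentation_def)
  assume "(rewr R)\<^sup>*\<^sup>* u v"
  then have "v \<in> lists A \<and> (u, v) \<in> presentation_cong A R"
  proof induction
    case base
    then show ?case using assms(2) by (simp add: presentation_cong.refl)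
  next
    case (step y z)
    obtain a b l r where y: "y = a @ l @ b" "z = a @ r @ b" and p: "partner R l r"
      using step(2) unfolding rewr_def by blast
    have lr: "l \<in> lists A" "r \<in> lists A" using p R by (auto simp: partner_def)
    have ab: "a \<in> lists A" "b \<in> lists A" using step y by auto
    have "(y, z) \<in> presentation_cong A R"
      using p ab unfolding partner_def y
      by (blast intro: presentation_cong.rel presentation_cong.sym)
    then show ?case using step lr ab y by (auto intro: presentation_cong.trans)
  qed
  then show "(u, v) \<in> presentation_cong A R" by blast
qed

lemma element_of_eq_iff:
  assumes "finite_presentation A R" "u \<in> lists A" "v \<in> lists A"
  shows "element_of A R u = element_of A R v \<longleftrightarrow> (rewr R)\<^sup>*\<^sup>* u v"
  using eq_equiv_class_iff[OF equiv_presentation_cong[OF assms(1)] assms(2,3)]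
    presentation_cong_rewrs[OF assms] by (simp add: element_of_def)

section \<open>Pieces as factors with two occurrences\<close>

lemma piece_Nil [simp]: "piece R []"
  by (simp add: piece_def)

lemma piece_sublist:
  assumes "piece R q" "sublist p q"
  shows "piece R p"
proof -
  have f: "factor_of_side p e" if "factor_of_side q e" for e
    using that assms(2) unfolding factor_of_side_def
    by (meson sublist_order.order.trans)
  have o: "occurs_twice p w" if q: "occurs_twice q w" for w
  proof -
    obtain a b where ab: "q = a @ p @ b" using assms(2) unfolding sublist_def by blast
    obtain x y x' y' where "w = x @ q @ y" "w = x' @ q @ y'" "x \<noteq> x'"
      using q unfolding occurs_twice_def by blast
    then have "w = (x @ a) @ p @ b @ y" "w = (x' @ a) @ p @ b @ y'" "x @ a \<noteq> x' @ a"
      using ab by auto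
    then show ?thesis unfolding occurs_twice_def by blast
  qed
  consider "q = []" | "\<exists>e\<in>R. \<exists>f\<in>R. e \<noteq> f \<and> factor_of_side q e \<and> factor_of_side q f"
    | "\<exists>(l, r)\<in>R. sublist q l \<and> sublist q r" | "\<exists>w\<in>relation_words R. occurs_twice q w"
    using assms(1) unfolding piece_def by blast
  then show ?thesis
  proof cases
    case 1
    then show ?thesis using assms(2) by simp
  next
    case 2
    then show ?thesis unfolding piece_def using f by blast
  next
    case 3
    then have "\<exists>(l, r)\<in>R. sublist p l \<and> sublist p r"
      using assms(2) by (blast intro: sublist_order.order.trans)
    then show ?thesis unfolding piece_def by blast
  next
    case 4
    then show ?thesis unfolding piece_def using o by blast
  qed
qed

lemma factor_two_relations_piece:
  "e \<in> R \<Longrightarrow> f \<in> R \<Longrightarrow> e \<noteq> f \<Longrightarrow> factor_of_side p e \<Longrightarrow> factor_of_side p f \<Longrightarrow> piece R p"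
  unfolding piece_def by blast

text \<open>All overlap arguments use this form: an occurrence is a relation word together with a
  position, and two different occurrences fall under one of the clauses of \<open>piece\<close> (one
  word, two sides of one relation, two relations).\<close>

lemma two_occurrences_piece:
  assumes "r \<in> relation_words R" "s \<in> relation_words R"
    and r: "r = a @ p @ b" and s: "s = c @ p @ d" and ne: "r \<noteq> s \<or> a \<noteq> c"
  shows "piece R p"
proof (cases "r = s")
  case True
  then have "occurs_twice p r" using assms unfolding occurs_twice_def by blast
  then show ?thesis using assms(1) unfolding piece_def by blast
next
  case False
  obtain e f where e: "e \<in> R" "r = fst e \<or> r = snd e" and f: "f \<in> R" "s = fst f \<or> s = snd f"
    using assms(1,2) by (auto simp: relation_words_def)
  have ps: "sublist p r" "sublist p s" unfolding r s by auto
  show ?thesis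
  proof (cases "e = f")
    case True
    then have "sublist p (fst e) \<and> sublist p (snd e)" using e f False ps by auto
    then show ?thesis unfolding piece_def using e by (auto split: prod.splits)
  next
    case False
    moreover have "factor_of_side p e" "factor_of_side p f"
      using e f ps by (auto simp: factor_of_side_def)
    ultimately show ?thesis using factor_two_relations_piece e(1) f(1) by blast
  qed
qed

lemma append_eq_longer:
  assumes "x @ y = a @ b" "length x \<le> length a"
  obtains c where "a = x @ c" "y = c @ b"
  using assms by (auto simp: append_eq_append_conv2)

lemma append_eq_shorter:
  assumes "x @ y = a @ b" "length a < length x"
  obtains c where "x = a @ c" "c \<noteq> []" "c @ y = b"
proof -
  obtain c where "x = a @ c" "b = c @ y"
    using append_eq_longer[of a b x y] assms by auto
  then show thesis using that assms(2) by auto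
qed

section \<open>Heads and maximal piece suffixes of relation words\<close>

definition tail_length :: "'a relations \<Rightarrow> 'a list \<Rightarrow> nat" where
  "tail_length R r = Max {n. n \<le> length r \<and> piece R (drop (length r - n) r)}"

text \<open>Every relation word \<open>r\<close> splits as \<open>H r @ Z r\<close>; in the usual notation for small overlap
  presentations \<open>Z r\<close> is the maximal piece suffix, and \<open>H r\<close> is the product of the maximal
  piece prefix and the middle word.\<close>

locale c4_relations =
  fixes R :: "'a relations"
  assumes c4: "small_overlap 4 R"
begin

abbreviation E :: "'a list \<Rightarrow> 'a list \<Rightarrow> bool" where "E \<equiv> (rewr R)\<^sup>*\<^sup>*"
abbreviation W :: "'a list set" where "W \<equiv> relation_words R"

definition H :: "'a list \<Rightarrow> 'a list" where "H r = take (length r - tail_length R r) r"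
definition Z :: "'a list \<Rightarrow> 'a list" where "Z r = drop (length r - tail_length R r) r"

lemma not_three_pieces:
  assumes "p @ q @ t \<in> W" "piece R p" "piece R q" "piece R t"
  shows False
proof -
  have "concat [p, q, t] = p @ q @ t" "length [p, q, t] < 4" "\<forall>x\<in>set [p, q, t]. piece R x"
    using assms by auto
  then show False using c4 assms(1) unfolding small_overlap_def by blast
qed

lemma not_two_pieces: "p @ q \<in> W \<Longrightarrow> piece R p \<Longrightarrow> piece R q \<Longrightarrow> False"
  using not_three_pieces[of p q "[]"] by simp

lemma not_piece: "p \<in> W \<Longrightarrow> \<not> piece R p"
  using not_two_pieces[of p "[]"] by auto

lemma H_Z: "H r @ Z r = r"
  by (simp add: H_def Z_def)

lemma tail_length_properties:
  "tail_length R r \<le> length r" "piece R (drop (length r - tail_length R r) r)"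
  "n \<le> length r \<Longrightarrow> piece R (drop (length r - n) r) \<Longrightarrow> n \<le> tail_length R r"
proof -
  let ?S = "{n. n \<le> length r \<and> piece R (drop (length r - n) r)}"
  have fin: "finite ?S" by simp
  have "0 \<in> ?S" by simp
  then have "tail_length R r \<in> ?S" unfolding tail_length_def using Max_in[OF fin] by blast
  then show "tail_length R r \<le> length r" "piece R (drop (length r - tail_length R r) r)" by auto
  show "n \<le> tail_length R r" if "n \<le> length r" "piece R (drop (length r - n) r)"
    unfolding tail_length_def using Max_ge[OF fin] that by blast
qed

lemma piece_Z: "piece R (Z r)"
  by (simp add: Z_def tail_length_properties)

lemma length_Z: "length (Z r) = tail_length R r"
  using tail_length_properties(1)[of r] by (simp add: Z_def)

lemma Z_maximal: "r = a @ p \<Longrightarrow> piece R p \<Longrightarrow> length p \<le> length (Z r)"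
  using tail_length_properties(3)[of "length p" r] by (simp add: length_Z)

lemma not_piece_H: "r \<in> W \<Longrightarrow> \<not> piece R (H r)"
  using not_two_pieces[of "H r" "Z r"] piece_Z by (auto simp: H_Z)

lemma H_not_Nil: "r \<in> W \<Longrightarrow> H r \<noteq> []"
  using not_piece_H[of r] by auto

lemma H_not_inside_piece: "r \<in> W \<Longrightarrow> piece R (a @ H r @ b) \<Longrightarrow> False"
  using piece_sublist[of R "a @ H r @ b" "H r"] not_piece_H by auto

text \<open>As \<open>H r\<close> is no piece, it has a single occurrence among all relation words,
  the one that begins \<open>r\<close>.\<close>

lemma H_inside_relation_word:
  assumes "r \<in> W" "s \<in> W" "s = a @ H r @ b"
  shows "a = [] \<and> s = r"
proof -
  have "r = [] @ H r @ Z r" by (simp add: H_Z)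
  then show ?thesis
    using two_occurrences_piece[OF assms(1,2) _ assms(3)] not_piece_H[OF assms(1)] by blast
qed

text \<open>Of two heads that begin the same word, the shorter begins the longer and hence occurs in
  the other relation word.\<close>

lemma H_prefix_unique:
  assumes "r \<in> W" "s \<in> W" "H r @ x = H s @ y"
  shows "r = s"
proof -
  have *: "q = p" if "p \<in> W" "q \<in> W" "H q = H p @ z" for p q z
  proof -
    have "q = [] @ H p @ z @ Z q" using H_Z[of q] that(3) by simp
    then show ?thesis using H_inside_relation_word[OF that(1,2)] by blast
  qed
  have "(\<exists>z. H r = H s @ z) \<or> (\<exists>z. H s = H r @ z)"
  proof (cases "length (H r) \<le> length (H s)")
    case True
    then show ?thesis using append_eq_longer[OF assms(3)] by blast
  next
    case False
    then show ?thesis using append_eq_longer[OF assms(3)[symmetric]] by (meson nat_le_linear)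
  qed
  then show ?thesis using * assms(1,2) by blast
qed

lemma partner_ne: "partner R l r \<Longrightarrow> l \<noteq> r"
proof
  assume p: "partner R l r" "l = r"
  then have "piece R l" unfolding partner_def piece_def by auto
  then show False using not_piece[of l] p partner_relation_word by blast
qed

text \<open>A side shared by two relations would be a factor of both and thus a piece. This is what
  makes \<open>r'\<close>, the other side of the relation, well defined.\<close>

lemma partner_unique:
  assumes "partner R l r" "partner R l s"
  shows "r = s"
proof (rule ccontr)
  assume ne: "r \<noteq> s"
  have "l \<in> W" using assms(1) by (rule partner_relation_word)
  then have np: "\<not> piece R l" by (rule not_piece)
  have sides: "factor_of_side l (l, q)" "factor_of_side l (q, l)" for q
    by (simp_all add: factor_of_side_def)
  have lr: "l \<noteq> r" using assms(1) by (rule partner_ne)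
  consider "(l, r) \<in> R" "(l, s) \<in> R" | "(l, r) \<in> R" "(s, l) \<in> R"
    | "(r, l) \<in> R" "(l, s) \<in> R" | "(r, l) \<in> R" "(s, l) \<in> R"
    using assms unfolding partner_def by blast
  \<comment> \<open>The two pairs differ because of \<open>r \<noteq> s\<close> if \<open>l\<close>
    stands on the same side of both, and because of \<open>l \<noteq> r\<close> if it stands on
    opposite sides.\<close>
  then have "piece R l"
    using sides ne lr by cases (rule factor_two_relations_piece, assumption+, simp, simp, simp)+
  then show False using np by contradiction
qed

text \<open>In a derivation from \<open>z @ w\<close>, either the prefix \<open>z\<close> is never touched, or at some
  point a relation word \<open>s\<close> occurs at the leftmost position \<open>length z1\<close> that is ever
  touched. The number \<open>j\<close> counts the steps after that point.\<close>

definition touched :: "nat \<Rightarrow> 'a list \<Rightarrow> 'a list \<Rightarrow> 'a list \<Rightarrow> bool" where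
  "touched n z w x \<longleftrightarrow>
    (\<exists>z1 z2 s t t' j. z = z1 @ z2 \<and> z2 \<noteq> [] \<and> s \<in> W \<and> E (z2 @ w) (s @ t) \<and> j \<le> n \<and>
       (rewr R ^^ j) (s @ t) t' \<and> x = z1 @ t')"

lemma touchedI:
  assumes "z = z1 @ z2" "z2 \<noteq> []" "s \<in> W" "E (z2 @ w) (s @ t)" "j \<le> n"
    "(rewr R ^^ j) (s @ t) t'" "x = z1 @ t'"
  shows "touched n z w x"
  unfolding touched_def using assms by blast

lemma touchedE:
  assumes "touched n z w x"
  obtains z1 z2 s t t' j where "z = z1 @ z2" "z2 \<noteq> []" "s \<in> W" "E (z2 @ w) (s @ t)" "j \<le> n"
    "(rewr R ^^ j) (s @ t) t'" "x = z1 @ t'"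
  using assms unfolding touched_def by blast

text \<open>Induction on the last step. A step that starts further left than the recorded position
  becomes the new record and resets \<open>j\<close> to 0; any other step extends the derivation
  behind it.\<close>

lemma relpow_first_touched:
  assumes "(rewr R ^^ n) (z @ w) x"
  shows "(\<exists>w'. x = z @ w' \<and> E w w') \<or>
    touched n z w x"
  using assms
proof (induction n arbitrary: x)
  case 0
  then show ?case by auto
next
  case (Suc n)
  obtain y where y: "(rewr R ^^ n) (z @ w) y" "rewr R y x" using Suc.prems by auto
  obtain a b l r where yx: "y = a @ l @ b" "x = a @ r @ b" and lr: "partner R l r"
    using y(2) unfolding rewr_def by blast
  have rW: "r \<in> W" using lr partner_sym partner_relation_word by blast
  from Suc.IH[OF y(1)] consider w' where "y = z @ w'" "E w w'" | "touched n z w y" by blast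
  then show ?case
  proof cases
    case w': 1
    show ?thesis
    proof (cases "length z \<le> length a")
      case True
      then obtain a' where a': "a = z @ a'"
        using append_eq_longer[of z w' a "l @ b"] w'(1) yx(1) by auto
      have "w' = a' @ l @ b" using w'(1) yx(1) a' by simp
      then have "rewr R w' (a' @ r @ b)" using lr unfolding rewr_def by blast
      then have "E w (a' @ r @ b)" using w'(2) by simp
      then show ?thesis using yx(2) a' by auto
    next
      case False
      then obtain z2 where z2: "z = a @ z2" "z2 \<noteq> []" "z2 @ w' = l @ b"
        using append_eq_shorter[of z w' a "l @ b"] w'(1) yx(1) by auto
      \<comment> \<open>The recorded word is the one that the step has written, so the count
        restarts with \<open>s = r\<close> and \<open>t = b\<close>.\<close>
      have "rewr R (z2 @ w') (r @ b)" using rewrI[OF lr, of "[]" b] z2 by simp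
      then have "E (z2 @ w) (r @ b)"
        using rewrs_context[OF w'(2), of z2 "[]"] by simp
      then show ?thesis
        using touchedI[OF z2(1,2) rW, of w b 0 "Suc n" "r @ b" x] yx(2) by simp
    qed
  next
    case 2
    then obtain z1 z2 s t t' j where A: "z = z1 @ z2" "z2 \<noteq> []" "s \<in> W" "E (z2 @ w) (s @ t)"
      "j \<le> n" "(rewr R ^^ j) (s @ t) t'" "y = z1 @ t'" by (rule touchedE)
    show ?thesis
    proof (cases "length z1 \<le> length a")
      case True
      then obtain a' where a': "a = z1 @ a'" "t' = a' @ l @ b"
        using append_eq_longer[of z1 t' a "l @ b"] A(7) yx(1) by auto
      then have "rewr R t' (a' @ r @ b)" using lr unfolding rewr_def by blast
      then have "(rewr R ^^ Suc j) (s @ t) (a' @ r @ b)" using A(6) by auto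
      moreover have "x = z1 @ a' @ r @ b" using a' yx(2) by simp
      ultimately show ?thesis
        using touchedI[OF A(1-4), of "Suc j" "Suc n"] A(5) by blast
    next
      case False
      then obtain c where c: "z1 = a @ c" "c \<noteq> []" "c @ t' = l @ b"
        using append_eq_shorter[of z1 t' a "l @ b"] A(7) yx(1) by auto
      \<comment> \<open>The steps counted by \<open>j\<close> stay right of the old position;
        reading them backwards keeps \<open>c @ t'\<close> in the class of
        \<open>c @ z2 @ w\<close>.\<close>
      have "E t' (s @ t)" using A(6) by (meson rewrs_sym relpowp_imp_rtranclp)
      then have "E (c @ z2 @ w) (c @ s @ t)" "E (c @ s @ t) (c @ t')"
        using rewrs_context[OF A(4), of c "[]"] rewrs_context[of R "s @ t" t' c "[]"]
          rewrs_sym by auto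
      moreover have "rewr R (c @ t') (r @ b)" using rewrI[OF lr, of "[]" b] c by simp
      ultimately have "E ((c @ z2) @ w) (r @ b)" by simp
      moreover have "z = a @ c @ z2" "c @ z2 \<noteq> []" using A(1) c by auto
      ultimately show ?thesis
        using touchedI[of z a "c @ z2" r w b 0 "Suc n" "r @ b" x] rW yx(2) by simp
    qed
  qed
qed

text \<open>The two statements need each other for derivations that are not longer, whence the
  simultaneous induction.\<close>

lemma relpow_relation_word_prefix:
  "(\<forall>r r' w u. partner R r r' \<longrightarrow> (rewr R ^^ n) (r @ w) u \<longrightarrow>
      (\<exists>x w' m s. (s = r \<or> s = r') \<and> u = H s @ x \<and> m \<le> n \<and> (rewr R ^^ m) (Z s @ w') x)) \<and>
   (\<forall>r w x a l b. r \<in> W \<longrightarrow> (rewr R ^^ n) (Z r @ w) x \<longrightarrow> H r @ x = a @ l @ b \<longrightarrow> l \<in> W \<longrightarrow>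
      (a = [] \<and> l = r) \<or> length (H r) \<le> length a)"
proof (induction n rule: less_induct)
  case (less n)
  have Q: "\<exists>x w' m s. (s = r \<or> s = r') \<and> u = H s @ x \<and> m \<le> n \<and> (rewr R ^^ m) (Z s @ w') x"
    if pr: "partner R r r'" and d: "(rewr R ^^ n) (r @ w) u" for r r' w u
  proof (cases n)
    case 0
    then have "u = H r @ Z r @ w" using d H_Z[of r] append_assoc[of "H r" "Z r" w] by simp
    then show ?thesis
      by (intro exI[of _ "Z r @ w"] exI[of _ w] exI[of _ 0] exI[of _ r]) auto
  next
    case (Suc k)
    then obtain y where y: "(rewr R ^^ k) (r @ w) y" "rewr R y u" using d by auto
    have kn: "k < n" using Suc by simp
    have "\<exists>x w' m s. (s = r \<or> s = r') \<and> y = H s @ x \<and> m \<le> k \<and> (rewr R ^^ m) (Z s @ w') x"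
      using less[OF kn, THEN conjunct1, rule_format, OF pr y(1)] .
    then obtain x w' m s where s: "s = r \<or> s = r'" and x: "y = H s @ x" "m \<le> k"
        "(rewr R ^^ m) (Z s @ w') x"
by blast
    obtain a b l l' where yu: "y = a @ l @ b" "u = a @ l' @ b" and ll: "partner R l l'"
      using y(2) unfolding rewr_def by blast
    have W: "s \<in> W" "l \<in> W" using s pr ll partner_relation_word partner_sym by blast+
    have "(a = [] \<and> l = s) \<or> length (H s) \<le> length a"
    proof -
      have "m < n" using x(2) Suc by simp
      then show ?thesis
        using less[of m, THEN conjunct2, rule_format, OF _ W(1) x(3) _ W(2)] x(1) yu(1)
        by metis
    qed
    then show ?thesis
    proof
      assume a: "a = [] \<and> l = s"
      \<comment> \<open>Since partners are unique, replacing the leading word never leaves the pair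
        \<open>r\<close>, \<open>r'\<close>.\<close>
      from s have "l' = r \<or> l' = r'"
      proof
        assume "s = r"
        then have "partner R r l'" using ll a by simp
        then show ?thesis using partner_unique[OF _ pr] by blast
      next
        assume "s = r'"
        then have "partner R r' l'" using ll a by simp
        then show ?thesis using partner_unique[OF _ partner_sym[OF pr]] by blast
      qed
      moreover have "u = H l' @ Z l' @ b"
        using a yu H_Z[of l'] append_assoc[of "H l'" "Z l'" b] by simp
      ultimately show ?thesis
        by (intro exI[of _ "Z l' @ b"] exI[of _ b] exI[of _ 0] exI[of _ l']) auto
    next
      assume "length (H s) \<le> length a"
      then obtain a' where a': "a = H s @ a'" "x = a' @ l @ b"
        using append_eq_longer[of "H s" x a "l @ b"] x(1) yu(1) by auto
      then have "rewr R x (a' @ l' @ b)" using ll unfolding rewr_def by blast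
      then have "(rewr R ^^ Suc m) (Z s @ w') (a' @ l' @ b)" using x(3) by auto
      then show ?thesis using x s a' yu Suc
        by (intro exI[of _ "a' @ l' @ b"] exI[of _ w'] exI[of _ "Suc m"] exI[of _ s]) auto
    qed
  qed
  have P: "(a = [] \<and> l = r) \<or> length (H r) \<le> length a"
    if r: "r \<in> W" and d: "(rewr R ^^ n) (Z r @ w) x" and e: "H r @ x = a @ l @ b" and l: "l \<in> W"
    for r w x a l b
  proof (rule ccontr)
    assume ne: "\<not> ((a = [] \<and> l = r) \<or> length (H r) \<le> length a)"
    then obtain p where p: "H r = a @ p" "p \<noteq> []" "p @ x = l @ b"
      using append_eq_shorter[of "H r" x a "l @ b"] e by auto
    have ra: "r = a @ p @ Z r" using p(1) H_Z[of r] by simp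
    have dif: "r \<noteq> l \<or> a \<noteq> []" using ne by auto
    from relpow_first_touched[OF d] consider w' where "x = Z r @ w'" | "touched n (Z r) w x"
      by blast
    then show False
    proof cases
      case (1 w')
      then have "(p @ Z r) @ w' = l @ b" using p by simp
      then consider c where "l = (p @ Z r) @ c" | c where "p @ Z r = l @ c"
        by (auto simp: append_eq_append_conv2)
      then show False
      proof cases
        case 1
        \<comment> \<open>A second occurrence, inside \<open>l\<close>, of a suffix of
          \<open>r\<close> that is longer than \<open>Z r\<close>; this contradicts the maximality
          of the tail.\<close>
        then have "piece R (p @ Z r)"
          using two_occurrences_piece[OF r l, of a "p @ Z r" "[]" "[]" c] ra dif by auto
        then have "length (p @ Z r) \<le> length (Z r)" using Z_maximal[OF ra] by blast
        then show False using p(2) by simp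
      next
        case 2
        then have "piece R l"
          using two_occurrences_piece[OF r l, of a l c "[]" "[]"] ra dif by auto
        then show False using not_piece l by blast
      qed
    next
      case 2
      then obtain z1 z2 s t t' j where A: "Z r = z1 @ z2" "s \<in> W" "j \<le> n"
        "(rewr R ^^ j) (s @ t) t'" "x = z1 @ t'" by (elim touchedE) blast
      obtain s' where s': "partner R s s'" using A(2) relation_word_partner by blast
      have "\<exists>x w' m q. (q = s \<or> q = s') \<and> t' = H q @ x \<and> m \<le> j \<and> (rewr R ^^ m) (Z q @ w') x"
      proof (cases "j = n")
        case True
        \<comment> \<open>\<open>Q\<close> is available for \<open>n\<close> itself, because its
          proof appeals to strictly shorter derivations only.\<close>
        show ?thesis using Q[OF s', of t t'] A(4) unfolding True .
      next
        case False
        then have "j < n" using A(3) by simp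
        from less[OF this, THEN conjunct1, rule_format, OF s' A(4)] show ?thesis .
      qed
      then obtain q y where q': "q = s \<or> q = s'" "t' = H q @ y" by blast
      then have q: "q \<in> W" "t' = H q @ y"
        using A(2) partner_relation_word[OF partner_sym[OF s']] by auto
      have eq: "((p @ z1) @ H q) @ y = l @ b" using p A(5) q by simp
      have ra': "r = a @ (p @ z1) @ z2" using ra A(1) by simp
      from eq consider c where "l = ((p @ z1) @ H q) @ c" | c where "(p @ z1) @ H q = l @ c"
        by (auto simp: append_eq_append_conv2)
      then show False
      proof cases
        case 1
        then show False using H_inside_relation_word[of q l "p @ z1" c] q(1) l p(2) by auto
      next
        case 2
        then consider e where "l = (p @ z1) @ e" "H q = e @ c" | e where "p @ z1 = l @ e"
          by (auto simp: append_eq_append_conv2)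
        then show False
        proof cases
          case 1
          \<comment> \<open>Here \<open>l\<close> ends inside the head \<open>H q\<close>. Its part
            before \<open>H q\<close> also occurs in \<open>r\<close> and its part inside
            \<open>H q\<close> also occurs in \<open>q\<close>, so \<open>l\<close> would be a
            product of two pieces.\<close>
          have "piece R (p @ z1)"
            using two_occurrences_piece[OF r l, of a "p @ z1" z2 "[]" e] ra' 1 dif by auto
          moreover have "piece R e"
            using two_occurrences_piece[OF l q(1), of "p @ z1" e "[]" "[]" "c @ Z q"] 1 p(2)
              H_Z[of q] by auto
          ultimately show False using not_two_pieces 1(1) l by blast
        next
          case 2
          then have "piece R l"
            using two_occurrences_piece[OF r l, of a l "e @ z2" "[]" "[]"] ra' dif by auto
          then show False using not_piece l by blast
        qed
      qed
    qed
  qed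
  show ?case using P Q by blast
qed

section \<open>Active words\<close>

definition act :: "'a list \<Rightarrow> bool" where
  "act u \<longleftrightarrow> (\<exists>r w. r \<in> W \<and> E u (r @ w))"

definition poss :: "'a list \<Rightarrow> 'a list \<Rightarrow> bool" where
  "poss p x \<longleftrightarrow> (\<exists>w. E x (p @ w))"

text \<open>\<open>z @ w\<close> has an active suffix that begins inside \<open>z\<close>.\<close>

definition active :: "'a list \<Rightarrow> 'a list \<Rightarrow> bool" where
  "active z w \<longleftrightarrow> (\<exists>k<length z. act (drop k z @ w))"

text \<open>For the two sides \<open>r\<close> and \<open>r'\<close> of a relation this turns out to describe when
  \<open>r @ w\<close> and \<open>r @ w'\<close> are equivalent; transitivity is the nontrivial point.\<close>

definition tail_equiv :: "'a list \<Rightarrow> 'a list \<Rightarrow> 'a list \<Rightarrow> 'a list \<Rightarrow> bool" where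
  "tail_equiv r r' w w' \<longleftrightarrow> E (Z r @ w) (Z r @ w') \<or> E (Z r' @ w) (Z r' @ w')"

lemma E_sym: "E u v \<Longrightarrow> E v u"
  by (rule rewrs_sym)

lemma E_trans: "E u v \<Longrightarrow> E v w \<Longrightarrow> E u w"
  by simp

lemma E_append: "E u v \<Longrightarrow> E (x @ u) (x @ v)"
  using rewrs_context[of R u v x "[]"] by simp

lemma E_partner: "partner R r r' \<Longrightarrow> E (r @ w) (r' @ w)"
  using rewrI[of R r r' "[]" w] by auto

lemma append_H_Z: "H r @ Z r @ w = r @ w"
  using H_Z[of r] append_assoc[of "H r" "Z r" w] by simp

lemma act_cong: "E u v \<Longrightarrow> act u \<longleftrightarrow> act v"
  unfolding act_def by (meson E_sym E_trans)

lemma relation_word_not_Nil: "r \<in> W \<Longrightarrow> r \<noteq> []"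
  using not_piece by fastforce

lemma E_Nil: "E [] v \<Longrightarrow> v = []"
proof (induction rule: rtranclp_induct)
  case (step y z)
  then obtain l b a r where "[] = a @ l @ b" "partner R l r" unfolding rewr_def by auto
  then show ?case using relation_word_not_Nil partner_relation_word by blast
qed simp

lemma not_act_Nil: "\<not> act []"
  unfolding act_def using E_Nil relation_word_not_Nil by blast

lemma first_touched:
  assumes "E (z @ w) x"
  obtains w' where "x = z @ w'" "E w w'"
  | z1 z2 t where "z = z1 @ z2" "z2 \<noteq> []" "act (z2 @ w)" "E (z2 @ w) t" "x = z1 @ t"
proof -
  obtain n where "(rewr R ^^ n) (z @ w) x" using assms by (meson rtranclp_imp_relpowp)
  then consider w' where "x = z @ w'" "E w w'" | "touched n z w x"
    using relpow_first_touched by blast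
  then show thesis
  proof cases
    case 2
    then obtain z1 z2 s t t' j where A: "z = z1 @ z2" "z2 \<noteq> []" "s \<in> W" "E (z2 @ w) (s @ t)"
      "(rewr R ^^ j) (s @ t) t'" "x = z1 @ t'" by (elim touchedE) blast
    have "E (z2 @ w) t'" using A(4) relpowp_imp_rtranclp[OF A(5)] by (rule E_trans)
    moreover have "act (z2 @ w)" using A(3,4) unfolding act_def by blast
    ultimately show thesis using that(2) A by blast
  qed (use that in blast)
qed

lemma not_active_prefix:
  assumes "E (z @ w) x" "\<not> active z w"
  obtains w' where "x = z @ w'" "E w w'"
  using assms(1)
proof (cases rule: first_touched)
  case (2 z1 z2 t)
  then have "drop (length z1) z = z2" "length z1 < length z" by auto
  then have "active z w" using 2(3) unfolding active_def by metis
  then show thesis using assms(2) by simp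
qed (use that in blast)

lemma not_act_Cons:
  assumes "\<not> act (a # u)"
  shows "E (a # u) v \<longleftrightarrow> (\<exists>v'. v = a # v' \<and> E u v')"
proof
  assume e: "E (a # u) v"
  have "\<not> active [a] u" using assms unfolding active_def by simp
  then show "\<exists>v'. v = a # v' \<and> E u v'" using not_active_prefix[of "[a]" u v] e by auto
next
  assume "\<exists>v'. v = a # v' \<and> E u v'"
  then show "E (a # u) v" using E_append[of u _ "[a]"] by auto
qed

text \<open>This lemma and \<open>occurrence_in_headed\<close> are the two halves of the
  simultaneous induction, freed of step counts.\<close>

lemma relation_word_prefix:
  assumes "partner R r r'" "E (r @ w) u"
  obtains x s where "s = r \<or> s = r'" "u = H s @ x" "poss (Z s) x"
proof -
  obtain n where n: "(rewr R ^^ n) (r @ w) u" using assms by (meson rtranclp_imp_relpowp)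
  obtain x w' m s where "s = r \<or> s = r'" "u = H s @ x" "(rewr R ^^ m) (Z s @ w') x"
    using relpow_relation_word_prefix[of n, THEN conjunct1, rule_format, OF assms(1) n] by blast
  then show thesis using that E_sym relpowp_imp_rtranclp unfolding poss_def by metis
qed

lemma occurrence_in_headed:
  assumes "r \<in> W" "E (Z r @ w) x" "H r @ x = a @ l @ b" "l \<in> W"
  shows "(a = [] \<and> l = r) \<or> length (H r) \<le> length a"
proof -
  obtain n where n: "(rewr R ^^ n) (Z r @ w) x" using assms(2) by (meson rtranclp_imp_relpowp)
  show ?thesis
    using relpow_relation_word_prefix[of n, THEN conjunct2, rule_format, OF assms(1) n assms(3,4)] .
qed

text \<open>Heads are non-empty, so activity is reduced to a prefix test and a question about the
  strictly shorter word \<open>x\<close>. This is the recursion by which activity is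
  computed.\<close>

lemma act_iff: "act u \<longleftrightarrow> (\<exists>r x. r \<in> W \<and> u = H r @ x \<and> poss (Z r) x)"
proof
  assume "act u"
  then obtain r w r' where r: "E u (r @ w)" "partner R r r'"
    unfolding act_def using relation_word_partner by blast
  then obtain x s where "s = r \<or> s = r'" "u = H s @ x" "poss (Z s) x"
    using relation_word_prefix E_sym by metis
  then show "\<exists>r x. r \<in> W \<and> u = H r @ x \<and> poss (Z r) x"
    using r(2) partner_relation_word partner_sym by blast
next
  assume "\<exists>r x. r \<in> W \<and> u = H r @ x \<and> poss (Z r) x"
  then obtain r x w where "r \<in> W" "u = H r @ x" "E x (Z r @ w)" unfolding poss_def by blast
  then have "r \<in> W" "E u (r @ w)" using E_append[of x "Z r @ w" "H r"] append_H_Z by auto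
  then show "act u" unfolding act_def by blast
qed

text \<open>A piece in front of a word that begins with a head ends strictly inside it, since
  otherwise the head would be a factor of a piece.\<close>

lemma piece_before_head:
  assumes "piece R p" "r \<in> W" "p @ w = H r @ x"
  obtains h where "H r = p @ h" "h \<noteq> []" "w = h @ x"
proof -
  have "length p < length (H r)"
  proof (rule ccontr)
    assume "\<not> length p < length (H r)"
    then obtain c where "p = [] @ H r @ c"
      using append_eq_longer[of "H r" x p w] assms(3) by auto
    then show False using H_not_inside_piece assms(1,2) by metis
  qed
  then show thesis using append_eq_shorter[of "H r" x p w] assms(3) that by metis
qed

text \<open>The only place where \<open>C(4)\<close> is needed rather than \<open>C(3)\<close>.\<close>

lemma act_piece_unique:
  assumes "piece R p" "piece R q" "p \<noteq> []" "q \<noteq> []" "act (p @ w)" "act (q @ w)"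
  shows "p = q"
proof -
  have *: "p = q"
    if p: "piece R p" "r \<in> W" "H r = p @ h" and s: "s \<in> W" "H s = q @ h'" and h: "h' = h @ c"
    for p q r s h h' c
  proof (rule ccontr)
    assume ne: "p \<noteq> q"
    have rs: "r = p @ h @ Z r" "s = q @ h @ c @ Z s"
      using p(3) s(2) h H_Z[of r] H_Z[of s] by auto
    \<comment> \<open>The common part \<open>h\<close> occurs behind \<open>p\<close> in
      \<open>r\<close> and behind \<open>q\<close> in \<open>s\<close>. As
      \<open>p \<noteq> q\<close>, these are two occurrences, and \<open>r\<close> becomes the
      product of the three pieces \<open>p\<close>, \<open>h\<close> and \<open>Z r\<close>.\<close>
    have "piece R h" using two_occurrences_piece[OF p(2) s(1) rs] ne by blast
    then show False using not_three_pieces[of p h "Z r"] rs p piece_Z by auto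
  qed
  obtain r x where r: "r \<in> W" "p @ w = H r @ x" using assms(5) act_iff by auto
  obtain s y where s: "s \<in> W" "q @ w = H s @ y" using assms(6) act_iff by auto
  obtain h where h: "H r = p @ h" "w = h @ x" using piece_before_head[OF assms(1) r] by blast
  obtain h' where h': "H s = q @ h'" "w = h' @ y" using piece_before_head[OF assms(2) s] by blast
  have eq: "h @ x = h' @ y" using h h' by simp
  show ?thesis
  proof (cases "length h \<le> length h'")
    case True
    then obtain c where "h' = h @ c" using append_eq_longer[OF eq] by blast
    then show ?thesis using * assms(1) r(1) h(1) s(1) h'(1) by blast
  next
    case False
    then have "length h' \<le> length h" by simp
    then obtain c where "h = h' @ c" using append_eq_longer[OF eq[symmetric]] by blast
    then have "q = p" using * assms(2) r(1) h(1) s(1) h'(1) by blast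
    then show ?thesis by simp
  qed
qed

text \<open>By \<open>act_piece_unique\<close> a piece has only one active position in front of a
  given word. Everything before it is out of reach of derivations, so all words of the class share
  the literal prefix \<open>z1\<close> and the same first active position.\<close>

lemma active_split:
  assumes "piece R z" "active z w"
  obtains z1 z2 where "z = z1 @ z2" "z2 \<noteq> []" "act (z2 @ w)"
    "\<And>x. E (z @ w) x \<Longrightarrow>
      \<exists>y. x = z1 @ y \<and> E (z2 @ w) y \<and> act y \<and> (\<forall>j<length z1. \<not> act (drop j x))"
proof -
  obtain k where k: "k < length z" "act (drop k z @ w)" using assms(2) unfolding active_def by blast
  have pieces: "piece R (drop j z)" for j
    by (rule piece_sublist[OF assms(1)]) simp
  have nact: "\<not> act (drop j z @ w)" if "j < k" for j
  proof
    assume "act (drop j z @ w)"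
    then have "drop j z = drop k z"
      using act_piece_unique[OF pieces pieces, of j k w] k that by auto
    then have "length (drop j z) = length (drop k z)" by simp
    then show False using k that by simp
  qed
  have split: "drop j (take k z) @ drop k z @ w = drop j z @ w" if "j < k" for j
  proof -
    have "z = take k z @ drop k z" by simp
    then have "drop j z = drop j (take k z) @ drop k z"
      using that k drop_append[of j "take k z" "drop k z"] by simp
    then show ?thesis by simp
  qed
  have na: "\<not> active (take k z) (drop k z @ w)"
  proof
    assume "active (take k z) (drop k z @ w)"
    then obtain j where j: "j < k" "act (drop j (take k z) @ drop k z @ w)"
      unfolding active_def by auto
    then show False using nact[OF j(1)] unfolding split[OF j(1)] by simp
  qed
  have "\<exists>y. x = take k z @ y \<and> E (drop k z @ w) y \<and> act y \<and>
      (\<forall>j<length (take k z). \<not> act (drop j x))" if e: "E (z @ w) x" for x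
  proof -
    have "E (take k z @ drop k z @ w) x" using e by (simp flip: append_assoc)
    then obtain y where y: "x = take k z @ y" "E (drop k z @ w) y"
      using not_active_prefix na by blast
    have "\<not> act (drop j x)" if "j < length (take k z)" for j
    proof -
      have "j < k" using that by simp
      have "drop j x = drop j (take k z) @ y" using y(1) that by simp
      then have "E (drop j z @ w) (drop j x)"
        using E_append[OF y(2), of "drop j (take k z)"] unfolding split[OF \<open>j < k\<close>] by simp
      then show ?thesis using nact \<open>j < k\<close> act_cong by blast
    qed
    then show ?thesis using y k(2) act_cong by blast
  qed
  then show thesis using that[of "take k z" "drop k z"] k by simp
qed

lemma active_transfer:
  assumes "piece R z" "active z w" "E (z @ w) (z @ w')"
  shows "active z w'"
proof -
  obtain z1 z2 where z: "z = z1 @ z2" "z2 \<noteq> []"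
    "\<And>x. E (z @ w) x \<Longrightarrow> \<exists>y. x = z1 @ y \<and> E (z2 @ w) y \<and> act y"
    using active_split[OF assms(1,2)] by metis
  then have "act (z2 @ w')" using z(3)[OF assms(3)] by auto
  moreover have "length z1 < length z" "drop (length z1) z = z2" using z by auto
  ultimately show ?thesis unfolding active_def by metis
qed

text \<open>By uniqueness of active pieces both tails end in the same active suffix, and the
  equivalence already holds behind that suffix; so it can be moved from one tail to the
  other.\<close>

lemma both_active:
  assumes "active (Z r) w" "active (Z r') w" "E (Z r @ w) (Z r @ w')"
  shows "E (Z r' @ w) (Z r' @ w')"
proof -
  obtain z1 z2 where z: "Z r = z1 @ z2" "z2 \<noteq> []" "act (z2 @ w)"
    "\<And>x. E (Z r @ w) x \<Longrightarrow> \<exists>y. x = z1 @ y \<and> E (z2 @ w) y"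
    using active_split[OF piece_Z assms(1)] by metis
  obtain z1' z2' where z': "Z r' = z1' @ z2'" "z2' \<noteq> []" "act (z2' @ w)"
    using active_split[OF piece_Z assms(2)] by metis
  have "piece R z2" using piece_sublist[OF piece_Z[of r]] z(1) by simp
  moreover have "piece R z2'" using piece_sublist[OF piece_Z[of r']] z'(1) by simp
  ultimately have eq: "z2' = z2" using act_piece_unique z z' by blast
  have "E (z2 @ w) (z2 @ w')" using z(4)[OF assms(3)] z(1) by auto
  then show ?thesis using E_append[of "z2 @ w" "z2 @ w'" z1'] z'(1) eq by simp
qed

lemma not_active_E:
  assumes "\<not> active z w" "E (z @ w) (z @ w')"
  shows "E w w'"
  using not_active_prefix[OF assms(2,1)] by auto

section \<open>Transitivity of the comparison behind a relation word\<close>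

lemma tail_equiv_sym: "tail_equiv r r' w w' \<Longrightarrow> tail_equiv r r' w' w"
  unfolding tail_equiv_def using E_sym by blast

lemma E_tail_equiv: "E w w' \<Longrightarrow> tail_equiv r r' w w'"
  by (simp add: tail_equiv_def E_append)

text \<open>If the second disjunct is given, either \<open>Z r'\<close> is active too and
  \<open>both_active\<close> applies, or it is inactive and the remainders themselves are
  equivalent.\<close>

lemma tail_equiv_active:
  assumes "active (Z r) w" "tail_equiv r r' w w'"
  shows "E (Z r @ w) (Z r @ w')"
proof (cases "E (Z r @ w) (Z r @ w')")
  case False
  then have e: "E (Z r' @ w) (Z r' @ w')" using assms(2) by (simp add: tail_equiv_def)
  show ?thesis
  proof (cases "active (Z r') w")
    case True
    then show ?thesis using both_active e assms(1) by blast
  next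
    case False
    then show ?thesis using not_active_E e E_append by blast
  qed
qed

lemma tail_equiv_not_active:
  assumes "\<not> active (Z r) w" "tail_equiv r r' w w'"
  shows "E (Z r' @ w) (Z r' @ w')"
  using assms not_active_E E_append unfolding tail_equiv_def by blast

text \<open>Which disjunct can be had depends only on whether \<open>Z r\<close> is active in front
  of the middle word \<open>v\<close>; hence both links can be brought into the same form.\<close>

lemma tail_equiv_trans:
  assumes "tail_equiv r r' u v" "tail_equiv r r' v w"
  shows "tail_equiv r r' u w"
proof (cases "active (Z r) v")
  case True
  then have "E (Z r @ v) (Z r @ u)" "E (Z r @ v) (Z r @ w)"
    using assms tail_equiv_active tail_equiv_sym by blast+
  then show ?thesis unfolding tail_equiv_def using E_sym E_trans by blast
next
  case False
  then have "E (Z r' @ v) (Z r' @ u)" "E (Z r' @ v) (Z r' @ w)"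
    using assms tail_equiv_not_active tail_equiv_sym by blast+
  then show ?thesis unfolding tail_equiv_def using E_sym E_trans by blast
qed

section \<open>The class of a word that begins with a relation word\<close>

lemma tail_equiv_E:
  assumes "partner R r r'" "tail_equiv r r' w w'"
  shows "E (r @ w) (r @ w')"
proof -
  consider "E (Z r @ w) (Z r @ w')" | "E (Z r' @ w) (Z r' @ w')"
    using assms(2) unfolding tail_equiv_def by blast
  then show ?thesis
  proof cases
    case 1
    then show ?thesis using E_append[of "Z r @ w" "Z r @ w'" "H r"] by (simp add: append_H_Z)
  next
    case 2
    then have "E (r' @ w) (r' @ w')"
      using E_append[of "Z r' @ w" "Z r' @ w'" "H r'"] by (simp add: append_H_Z)
    then show ?thesis using E_partner[OF assms(1)] E_sym E_trans by meson
  qed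
qed

text \<open>By \<open>occurrence_in_headed\<close> a step either replaces the complete leading
  relation word, which replaces \<open>w'\<close> by a new remainder, or takes place behind the
  head. Successive remainders are linked by transitivity of \<open>tail_equiv\<close>.\<close>

lemma headed_class:
  assumes pr: "partner R r r'" and e: "E (r @ w) u"
  shows "\<exists>x w' s. (s = r \<or> s = r') \<and> tail_equiv r r' w w' \<and> u = H s @ x \<and> E (Z s @ w') x"
  using e
proof (induction rule: rtranclp_induct)
  case base
  have "tail_equiv r r' w w" by (simp add: tail_equiv_def)
  moreover have "r @ w = H r @ Z r @ w" by (simp add: append_H_Z)
  ultimately show ?case by blast
next
  case (step u v)
  obtain x w' s where s: "s = r \<or> s = r'" and t: "tail_equiv r r' w w'"
    and u: "u = H s @ x" and x: "E (Z s @ w') x"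
    using step.IH by blast
  obtain a b l l' where uv: "u = a @ l @ b" "v = a @ l' @ b" and ll: "partner R l l'"
    using step.hyps(2) unfolding rewr_def by blast
  have W: "s \<in> W" "l \<in> W" using s pr ll partner_relation_word partner_sym by blast+
  have "H s @ x = a @ l @ b" using u uv by simp
  from occurrence_in_headed[OF W(1) x this W(2)] show ?case
  proof
    assume al: "a = [] \<and> l = s"
    have l': "l' = r \<or> l' = r'"
      using s
    proof
      assume "s = r"
      then have "partner R r l'" using ll al by simp
      then show ?thesis using partner_unique[OF _ pr] by blast
    next
      assume "s = r'"
      then have "partner R r' l'" using ll al by simp
      then show ?thesis using partner_unique[OF _ partner_sym[OF pr]] by blast
    qed
    have "H s @ x = H s @ Z s @ b" using u uv al append_H_Z[of s b] by simp
    then have "E (Z s @ w') (Z s @ b)" using x by simp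
    then have "tail_equiv r r' w' b" using s unfolding tail_equiv_def by blast
    then have "tail_equiv r r' w b" using t tail_equiv_trans by blast
    moreover have "v = H l' @ Z l' @ b" using al uv append_H_Z[of l' b] by simp
    ultimately show ?thesis using l' by blast
  next
    assume len: "length (H s) \<le> length a"
    have "H s @ x = a @ l @ b" using u uv by simp
    then obtain a' where a': "a = H s @ a'" "x = a' @ l @ b" using append_eq_longer len by metis
    then have "rewr R x (a' @ l' @ b)" using rewrI[OF ll] by simp
    then have "E (Z s @ w') (a' @ l' @ b)" using x by simp
    moreover have "v = H s @ a' @ l' @ b" using uv a' by simp
    ultimately show ?thesis using s t by blast
  qed
qed

lemma headed_equiv_cases:
  assumes pr: "partner R r r'" and u: "E u (Z r @ w)" and e: "E (H r @ u) v"
  obtains x w' where "tail_equiv r r' w w'" "v = H r @ x" "E (Z r @ w') x"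
  | x w' where "tail_equiv r r' w w'" "v = H r' @ x" "E (Z r' @ w') x"
proof -
  have "E (H r @ u) (r @ w)" using E_append[OF u, of "H r"] by (simp add: append_H_Z)
  then have "E (r @ w) v" using e E_sym E_trans by blast
  then show thesis using headed_class[OF pr] that by blast
qed

lemma headed_equiv_same:
  assumes pr: "partner R r r'" and u: "E u (Z r @ w)" and e: "E (H r @ u) (H r @ v)"
  obtains w' where "tail_equiv r r' w w'" "E (Z r @ w') v"
  using headed_equiv_cases[OF assms]
proof cases
  case (2 x w')
  have "r = r'" using H_prefix_unique[OF _ _ 2(2)] pr partner_relation_word partner_sym by blast
  then show thesis using partner_ne pr by blast
qed (use that in auto)

lemma headed_equiv_other:
  assumes pr: "partner R r r'" and u: "E u (Z r @ w)" and e: "E (H r @ u) (H r' @ v)"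
  obtains w' where "tail_equiv r r' w w'" "E (Z r' @ w') v"
  using headed_equiv_cases[OF assms]
proof cases
  case (1 x w')
  have "r = r'" using H_prefix_unique[OF _ _ 1(2)] pr partner_relation_word partner_sym by blast
  then show thesis using partner_ne pr by blast
qed (use that in auto)

section \<open>Reducing a comparison behind heads to a comparison of shorter words\<close>

definition act_before :: "nat \<Rightarrow> 'a list \<Rightarrow> bool" where
  "act_before m u \<longleftrightarrow> (\<exists>k<m. act (drop k u))"

text \<open>Whether \<open>Z r\<close> is active in front of the unknown remainder \<open>w\<close>
  can be read off from \<open>u\<close> itself, whose suffixes are tabulated.\<close>

lemma act_before_iff_active:
  assumes "E (Z r @ w) u"
  shows "act_before (length (Z r)) u \<longleftrightarrow> active (Z r) w"
proof (cases "active (Z r) w")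
  case True
  then obtain z1 z2 y where "Z r = z1 @ z2" "z2 \<noteq> []" "u = z1 @ y" "act y"
    using active_split[OF piece_Z] assms by metis
  then have "length z1 < length (Z r)" "act (drop (length z1) u)" by auto
  then show ?thesis using True unfolding act_before_def by blast
next
  case False
  then obtain w' where w': "u = Z r @ w'" "E w w'" using not_active_prefix assms by metis
  have "\<not> act (drop k u)" if "k < length (Z r)" for k
  proof -
    have "\<not> act (drop k (Z r) @ w)" using False that unfolding active_def by blast
    then show ?thesis using act_cong[OF E_append[OF w'(2), of "drop k (Z r)"]] w'(1) that by simp
  qed
  then show ?thesis using False unfolding act_before_def by blast
qed

text \<open>With \<open>Z r\<close> active, \<open>tail_equiv\<close> amounts to equivalence behind
  \<open>Z r\<close>, so the common head can be cancelled.\<close>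

lemma equiv_active_same:
  assumes pr: "partner R r r'" and p: "poss (Z r) u" and a: "act_before (length (Z r)) u"
  shows "E (H r @ u) (H r @ v) \<longleftrightarrow> E u v"
proof
  assume e: "E (H r @ u) (H r @ v)"
  obtain w where w: "E u (Z r @ w)" using p unfolding poss_def by blast
  obtain w' where w': "tail_equiv r r' w w'" "E (Z r @ w') v"
    using headed_equiv_same[OF pr w e] .
  have "active (Z r) w" using a act_before_iff_active[OF E_sym[OF w]] by simp
  then have "E (Z r @ w) (Z r @ w')" using tail_equiv_active w' by blast
  then show "E u v" using w w' E_trans by blast
qed (rule E_append)

text \<open>A literal \<open>r'\<close> at the front of the second word can be exchanged for
  \<open>r\<close>; then both words have the head \<open>H r\<close>, which the active tail allows
  to cancel.\<close>

lemma equiv_active_other_literal: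
  assumes pr: "partner R r r'" and p: "poss (Z r) u" and a: "act_before (length (Z r)) u"
  shows "E (H r @ u) (H r' @ Z r' @ v) \<longleftrightarrow> E u (Z r @ v)"
proof
  assume e: "E (H r @ u) (H r' @ Z r' @ v)"
  obtain w where w: "E u (Z r @ w)" using p unfolding poss_def by blast
  obtain w' where w': "tail_equiv r r' w w'" "E (Z r' @ w') (Z r' @ v)"
    using headed_equiv_other[OF pr w e] .
  have "tail_equiv r r' w' v" using w'(2) by (simp add: tail_equiv_def)
  then have t: "tail_equiv r r' w v" using w'(1) tail_equiv_trans by blast
  have "active (Z r) w" using a act_before_iff_active[OF E_sym[OF w]] by simp
  then have "E (Z r @ w) (Z r @ v)" using tail_equiv_active t by blast
  then show "E u (Z r @ v)" using w E_trans by blast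
next
  assume "E u (Z r @ v)"
  then have "E (H r @ u) (r @ v)" using E_append[of u "Z r @ v" "H r"] by (simp add: append_H_Z)
  then show "E (H r @ u) (H r' @ Z r' @ v)" using E_partner[OF pr] E_trans by (metis append_H_Z)
qed

text \<open>As \<open>v\<close> does not show \<open>Z r'\<close> literally, \<open>Z r'\<close>
  must be active in front of the remainder, and by uniqueness of active pieces it ends in the same
  active suffix as \<open>Z r\<close>, namely \<open>drop k (Z r)\<close>. What precedes that suffix
  is literal in both words and is dropped.\<close>

lemma equiv_active_other:
  assumes pr: "partner R r r'" and p: "poss (Z r) u"
    and k: "k < length (Z r)" "act (drop k u)" "\<forall>j<k. \<not> act (drop j u)"
    and nl: "\<not> prefix (Z r') v"
  shows "E (H r @ u) (H r' @ v) \<longleftrightarrow>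
    (\<exists>z y. Z r' = z @ drop k (Z r) \<and> v = z @ y \<and> E (drop k u) y)"
proof -
  obtain w where w: "E u (Z r @ w)" using p unfolding poss_def by blast
  have "act_before (length (Z r)) u" using k unfolding act_before_def by blast
  then have act: "active (Z r) w" using act_before_iff_active[OF E_sym[OF w]] by simp
  obtain z1 z2 where z: "Z r = z1 @ z2" "z2 \<noteq> []" "act (z2 @ w)"
    and split: "\<And>x. E (Z r @ w) x \<Longrightarrow>
      \<exists>y. x = z1 @ y \<and> E (z2 @ w) y \<and> act y \<and> (\<forall>j<length z1. \<not> act (drop j x))"
    using active_split[OF piece_Z act] by metis
  obtain y where y: "u = z1 @ y" "E (z2 @ w) y" "act y" "\<forall>j<length z1. \<not> act (drop j u)"
    using split[OF E_sym[OF w]] by blast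
  have p2: "piece R z2" using piece_sublist[OF piece_Z[of r]] z(1) by simp
  have "act (drop (length z1) u)" using y by simp
  \<comment> \<open>Both are the least position of \<open>u\<close> at which an active suffix
    begins.\<close>
  then have kz: "k = length z1" using y(4) k by (metis linorder_neqE_nat)
  have dk: "drop k (Z r) = z2" "drop k u = y" using kz z(1) y(1) by auto
  show ?thesis
  proof
    assume e: "E (H r @ u) (H r' @ v)"
    obtain w' where w': "tail_equiv r r' w w'" "E (Z r' @ w') v"
      using headed_equiv_other[OF pr w e] .
    have "E (Z r @ w) (Z r @ w')" using tail_equiv_active[OF act w'(1)] .
    then have e2: "E (z2 @ w) (z2 @ w')" using split z(1) by fastforce
    then have a2: "act (z2 @ w')" using act_cong z(3) by blast
    \<comment> \<open>An inactive \<open>Z r'\<close> would be a literal prefix of \<open>v\<close>,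
      against \<open>nl\<close>.\<close>
    have act': "active (Z r') w'"
      using not_active_prefix[OF w'(2)] nl by (metis prefixI)
    obtain z1' z2' where z': "Z r' = z1' @ z2'" "z2' \<noteq> []" "act (z2' @ w')"
      and split': "\<And>x. E (Z r' @ w') x \<Longrightarrow> \<exists>y. x = z1' @ y \<and> E (z2' @ w') y"
      using active_split[OF piece_Z act'] by metis
    have "piece R z2'" using piece_sublist[OF piece_Z[of r']] z'(1) by simp
    then have eq: "z2' = z2" using act_piece_unique[OF _ p2 z'(2) z(2) z'(3) a2] by blast
    obtain y' where y': "v = z1' @ y'" "E (z2 @ w') y'" using split'[OF w'(2)] eq by blast
    have "E y y'" using E_trans[OF E_trans[OF E_sym[OF y(2)] e2] y'(2)] .
    then show "\<exists>z y. Z r' = z @ drop k (Z r) \<and> v = z @ y \<and> E (drop k u) y"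
      using z'(1) eq y'(1) dk by auto
  next
    assume "\<exists>z y. Z r' = z @ drop k (Z r) \<and> v = z @ y \<and> E (drop k u) y"
    then obtain q y0 where q: "Z r' = q @ z2" "v = q @ y0" "E y y0" using dk by auto
    have "E (z2 @ w) y0" using y(2) q(3) by (rule E_trans)
    then have "E (H r' @ q @ z2 @ w) (H r' @ v)"
      using E_append[of "z2 @ w" y0 "H r' @ q"] q(2) by simp
    moreover have "H r' @ q @ z2 @ w = r' @ w" using q(1) append_H_Z[of r' w] by simp
    moreover have "E (H r @ u) (r @ w)" using E_append[OF w, of "H r"] by (simp add: append_H_Z)
    ultimately show "E (H r @ u) (H r' @ v)" using E_partner[OF pr, of w] by (metis E_trans)
  qed
qed

lemma poss_inactive:
  assumes "poss (Z r) u" "\<not> act_before (length (Z r)) u"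
  obtains u' where "u = Z r @ u'"
proof -
  obtain w where w: "E u (Z r @ w)" using assms(1) unfolding poss_def by blast
  have "\<not> active (Z r) w" using assms(2) act_before_iff_active[OF E_sym[OF w]] by simp
  then show thesis using not_active_prefix[OF E_sym[OF w]] that by blast
qed

text \<open>Inactivity leaves \<open>Z r\<close> untouched, so both words show it literally. The
  remainders still have to be compared behind \<open>Z r'\<close>, which may be active although
  \<open>Z r\<close> is not.\<close>

lemma equiv_inactive_same:
  assumes pr: "partner R r r'" and a: "\<not> act_before (length (Z r)) (Z r @ u)"
  shows "E (H r @ Z r @ u) (H r @ v) \<longleftrightarrow> (\<exists>v'. v = Z r @ v' \<and> E (Z r' @ u) (Z r' @ v'))"
proof
  have na: "\<not> active (Z r) u" using a act_before_iff_active by blast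
  assume e: "E (H r @ Z r @ u) (H r @ v)"
  obtain w' where w': "tail_equiv r r' u w'" "E (Z r @ w') v"
    using headed_equiv_same[OF pr _ e] by blast
  \<comment> \<open>If \<open>Z r\<close> were active in front of \<open>w'\<close>, then
    \<open>tail_equiv\<close> would give equivalence behind \<open>Z r\<close>, and activity would
    transfer to \<open>u\<close>.\<close>
  have "\<not> active (Z r) w'"
    using na tail_equiv_active[OF _ tail_equiv_sym[OF w'(1)]] active_transfer[OF piece_Z] by blast
  then obtain v' where v': "v = Z r @ v'" "E w' v'" using not_active_prefix w'(2) by blast
  have "tail_equiv r r' u v'" using w'(1) E_tail_equiv[OF v'(2)] by (rule tail_equiv_trans)
  then show "\<exists>v'. v = Z r @ v' \<and> E (Z r' @ u) (Z r' @ v')"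
    using tail_equiv_not_active[OF na] v'(1) by blast
next
  assume "\<exists>v'. v = Z r @ v' \<and> E (Z r' @ u) (Z r' @ v')"
  then obtain v' where v': "v = Z r @ v'" "E (Z r' @ u) (Z r' @ v')" by blast
  have "tail_equiv r r' u v'" using v'(2) by (simp add: tail_equiv_def)
  then show "E (H r @ Z r @ u) (H r @ v)"
    using tail_equiv_E[OF pr] v'(1) by (simp add: append_H_Z)
qed

text \<open>The first word shows \<open>r\<close> literally; exchanging it for \<open>r'\<close>
  gives both words the head \<open>H r'\<close>, and inactivity of \<open>Z r\<close> selects the
  comparison behind \<open>Z r'\<close>.\<close>

lemma equiv_inactive_other:
  assumes pr: "partner R r r'" and a: "\<not> act_before (length (Z r)) (Z r @ u)"
  shows "E (H r @ Z r @ u) (H r' @ v) \<longleftrightarrow> E (Z r' @ u) v"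
proof
  have na: "\<not> active (Z r) u" using a act_before_iff_active by blast
  assume e: "E (H r @ Z r @ u) (H r' @ v)"
  obtain w' where w': "tail_equiv r r' u w'" "E (Z r' @ w') v"
    using headed_equiv_other[OF pr _ e] by blast
  show "E (Z r' @ u) v" using tail_equiv_not_active[OF na w'(1)] w'(2) by (rule E_trans)
next
  assume "E (Z r' @ u) v"
  then have "E (r' @ u) (H r' @ v)"
    using E_append[of "Z r' @ u" v "H r'"] by (simp add: append_H_Z)
  then show "E (H r @ Z r @ u) (H r' @ v)"
    using E_partner[OF pr, of u] E_trans by (simp add: append_H_Z)
qed

lemma headed_equiv_prefix:
  assumes "partner R r r'" "poss (Z r) u" "E (H r @ u) v"
  shows "prefix (H r) v \<or> prefix (H r') v"
proof -
  obtain w where "E u (Z r @ w)" using assms(2) unfolding poss_def by blast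
  then show ?thesis using headed_equiv_cases[OF assms(1) _ assms(3)] by (metis prefixI)
qed

section \<open>Possible prefixes\<close>

lemma poss_empty: "poss [] x"
  unfolding poss_def by auto

lemma poss_Nil: "poss p [] \<longleftrightarrow> p = []"
  unfolding poss_def using E_Nil by fastforce

text \<open>Every word of the class begins with \<open>H r\<close> or \<open>H r'\<close>, and a
  piece at the front ends strictly inside that head. So at an active position the answer does not
  depend on \<open>x\<close>, and the recursion for \<open>poss\<close> stops there.\<close>

lemma poss_headed:
  assumes pr: "partner R r r'" and p: "piece R p" and x: "poss (Z r) x"
  shows "poss p (H r @ x) \<longleftrightarrow> prefix p (H r) \<or> prefix p (H r')"
proof -
  obtain w where w: "E x (Z r @ w)" using x unfolding poss_def by blast
  have rw: "E (H r @ x) (r @ w)" using E_append[OF w, of "H r"] by (simp add: append_H_Z)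
  have W: "r \<in> W" "r' \<in> W" using pr partner_sym partner_relation_word by blast+
  show ?thesis
  proof
    assume "poss p (H r @ x)"
    then obtain w' where "E (H r @ x) (p @ w')" unfolding poss_def by blast
    then consider y where "p @ w' = H r @ y" | y where "p @ w' = H r' @ y"
      using headed_equiv_cases[OF pr w] by metis
    then show "prefix p (H r) \<or> prefix p (H r')"
      using piece_before_head[OF p W(1)] piece_before_head[OF p W(2)] by (metis prefixI)
  next
    assume "prefix p (H r) \<or> prefix p (H r')"
    then consider c where "H r = p @ c" | c where "H r' = p @ c" unfolding prefix_def by blast
    then show "poss p (H r @ x)"
    proof cases
      case 1
      then show ?thesis unfolding poss_def by auto
    next
      case 2
      have "E (H r @ x) (r' @ w)" using rw E_partner[OF pr] by (rule E_trans)
      moreover have "r' @ w = p @ c @ Z r' @ w" using 2 append_H_Z[of r' w] by simp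
      ultimately show ?thesis unfolding poss_def by metis
    qed
  qed
qed

lemma poss_Cons:
  assumes "\<not> act (a # u)"
  shows "poss (b # p) (a # u) \<longleftrightarrow> a = b \<and> poss p u"
  unfolding poss_def using not_act_Cons[OF assms] by auto

text \<open>Allows a piece to be matched against a complete relation word in the table, whose end is
  marked, instead of its head, whose end is not.\<close>

lemma piece_prefix_head_iff:
  assumes "r \<in> W" "piece R p"
  shows "prefix p (H r) \<longleftrightarrow> prefix p r"
proof
  assume "prefix p r"
  then obtain c where "p @ c = H r @ Z r" by (auto simp: prefix_def H_Z)
  then show "prefix p (H r)" using piece_before_head[OF assms(2,1)] by (metis prefixI)
next
  assume "prefix p (H r)"
  then show "prefix p r" using H_Z[of r] by (metis prefix_prefix)
qed

end

section \<open>Structured programs\<close>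

type_synonym 'a regs = "nat \<Rightarrow> 'a cell"

datatype com =
    Ins instr
  | Seq com com (infixr ";;" 60)
  | Cond nat nat com com
  | While nat nat com

fun basic :: "instr \<Rightarrow> bool" where
  "basic (JumpEq _ _ _) = False"
| "basic (Halt _) = False"
| "basic _ = True"

text \<open>The charges mirror the compiled code: 1 for a test, and 1 more where a closing
  unconditional jump is executed, that is, after the second branch of \<open>Cond\<close> and after
  each round of \<open>While\<close>.\<close>

inductive big :: "com \<Rightarrow> 'a regs \<Rightarrow> 'a regs \<Rightarrow> nat \<Rightarrow> 'a regs \<Rightarrow> 'a regs \<Rightarrow> bool" where
  Ins: "basic i \<Longrightarrow> exec i (0, g, m) = (pc, g', m') \<Longrightarrow> big (Ins i) g m 1 g' m'"
| Seq: "big c1 g m t1 g1 m1 \<Longrightarrow> big c2 g1 m1 t2 g2 m2 \<Longrightarrow> big (c1 ;; c2) g m (t1 + t2) g2 m2"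
| CondEq: "g a = g b \<Longrightarrow> big c1 g m t g' m' \<Longrightarrow> big (Cond a b c1 c2) g m (t + 1) g' m'"
| CondNeq: "g a \<noteq> g b \<Longrightarrow> big c2 g m t g' m' \<Longrightarrow> big (Cond a b c1 c2) g m (t + 2) g' m'"
| WhileEq: "g a = g b \<Longrightarrow> big (While a b c) g m 1 g m"
| WhileNeq: "g a \<noteq> g b \<Longrightarrow> big c g m t1 g1 m1 \<Longrightarrow> big (While a b c) g1 m1 t2 g2 m2
    \<Longrightarrow> big (While a b c) g m (t1 + 2 + t2) g2 m2"

fun csize :: "com \<Rightarrow> nat" where
  "csize (Ins i) = 1"
| "csize (c1 ;; c2) = csize c1 + csize c2"
| "csize (Cond a b c1 c2) = csize c1 + csize c2 + 2"
| "csize (While a b c) = csize c + 2"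

text \<open>The first argument is the address of the code, as jump targets are absolute;
  \<open>JumpEq 0 0\<close> is an unconditional jump.\<close>

fun compile :: "nat \<Rightarrow> com \<Rightarrow> program" where
  "compile n (Ins i) = [i]"
| "compile n (c1 ;; c2) = compile n c1 @ compile (n + csize c1) c2"
| "compile n (Cond a b c1 c2) =
     JumpEq a b (n + csize c2 + 2) # compile (n + 1) c2 @
     JumpEq 0 0 (n + csize c1 + csize c2 + 2) # compile (n + csize c2 + 2) c1"
| "compile n (While a b c) =
     JumpEq a b (n + csize c + 2) # compile (n + 1) c @ [JumpEq 0 0 n]"

lemma length_compile [simp]: "length (compile n c) = csize c"
  by (induction c arbitrary: n) auto

definition code_at :: "program \<Rightarrow> nat \<Rightarrow> program \<Rightarrow> bool" where
  "code_at P n xs \<longleftrightarrow> (\<exists>a b. P = a @ xs @ b \<and> length a = n)"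

lemma code_at_append:
  "code_at P n (xs @ ys) \<longleftrightarrow> code_at P n xs \<and> code_at P (n + length xs) ys"
proof
  assume "code_at P n (xs @ ys)"
  then obtain a b where "P = a @ xs @ ys @ b" "length a = n" unfolding code_at_def by auto
  then have "P = a @ xs @ (ys @ b) \<and> length a = n" "P = (a @ xs) @ ys @ b \<and> length (a @ xs) = n + length xs"
    by auto
  then show "code_at P n xs \<and> code_at P (n + length xs) ys" unfolding code_at_def by blast
next
  assume "code_at P n xs \<and> code_at P (n + length xs) ys"
  then obtain a b a' b' where *: "P = a @ xs @ b" "length a = n" "P = a' @ ys @ b'"
    "length a' = n + length xs" unfolding code_at_def by blast
  then have "(a @ xs) @ b = a' @ ys @ b'" "length (a @ xs) = length a'" by auto
  then have "b = ys @ b'" by (metis append_eq_append_conv)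
  then show "code_at P n (xs @ ys)" unfolding code_at_def using * by auto
qed

lemma code_at_Cons:
  "code_at P n (x # xs) \<longleftrightarrow> n < length P \<and> P ! n = x \<and> code_at P (n + 1) xs"
proof -
  have "code_at P n [x] \<longleftrightarrow> n < length P \<and> P ! n = x"
  proof
    assume "n < length P \<and> P ! n = x"
    then have "P = take n P @ [x] @ drop (Suc n) P \<and> length (take n P) = n"
      using id_take_nth_drop[of n P] by auto
    then show "code_at P n [x]" unfolding code_at_def by blast
  qed (auto simp: code_at_def)
  then show ?thesis using code_at_append[of P n "[x]" xs] by auto
qed

lemma step_JumpEq:
  "n < length P \<Longrightarrow> P ! n = JumpEq a b l \<Longrightarrow>
    step P (n, g, m) = (if g a = g b then l else Suc n, g, m)"
  by (simp add: step_def)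

lemma step_jump: "n < length P \<and> P ! n = JumpEq 0 0 l \<Longrightarrow> step P (n, g, m) = (l, g, m)"
  by (simp add: step_def)

lemma funpow_add_apply: "(f ^^ (a + b)) x = (f ^^ b) ((f ^^ a) x)"
  by (metis add.commute funpow_add o_apply)

lemma compile_correct:
  assumes "big c g m t g' m'" "code_at P n (compile n c)"
  shows "(step P ^^ t) (n, g, m) = (n + csize c, g', m')"
  using assms
proof (induction arbitrary: n)
  case (Ins i g m pc g' m')
  then show ?case by (cases i) (auto simp: code_at_Cons step_def)
next
  case (Seq c1 g m t1 g1 m1 c2 t2 g2 m2)
  then show ?case by (simp add: code_at_append funpow_add_apply add.assoc)
next
  case (CondEq g a b c1 m t g' m' c2)
  then have "(step P ^^ t) (n + csize c2 + 2, g, m) = (n + csize c2 + 2 + csize c1, g', m')"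
    by (simp add: code_at_Cons code_at_append add.assoc)
  moreover have "step P (n, g, m) = (n + csize c2 + 2, g, m)"
  proof -
    have "n < length P \<and> P ! n = JumpEq a b (n + csize c2 + 2)"
      using CondEq.prems by (simp add: code_at_Cons)
    then show ?thesis using step_JumpEq[of n P a b "n + csize c2 + 2" g m] CondEq.hyps(1) by simp
  qed
  ultimately show ?case by (simp add: funpow_swap1 add.commute add.left_commute)
next
  case (CondNeq g a b c2 m t g' m' c1)
  then have 1: "(step P ^^ t) (n + 1, g, m) = (n + 1 + csize c2, g', m')"
    by (simp add: code_at_Cons code_at_append)
  have 2: "step P (n, g, m) = (n + 1, g, m)"
    using CondNeq step_JumpEq[of n P a b "n + csize c2 + 2" g m] by (simp add: code_at_Cons)
  have "n + 1 + csize c2 < length P \<and>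
      P ! (n + 1 + csize c2) = JumpEq 0 0 (n + csize c1 + csize c2 + 2)"
    using CondNeq.prems by (simp add: code_at_Cons code_at_append)
  then have 3: "step P (n + 1 + csize c2, g', m') = (n + csize c1 + csize c2 + 2, g', m')"
    by (rule step_jump)
  have "(step P ^^ (1 + t + 1)) (n, g, m) = (n + csize c1 + csize c2 + 2, g', m')"
    unfolding funpow_add_apply using 1 2 3 by simp
  moreover have "t + 2 = 1 + t + 1" "n + csize (Cond a b c1 c2) = n + csize c1 + csize c2 + 2"
    by simp_all
  ultimately show ?case by (simp only:)
next
  case (WhileEq g a b c m)
  then show ?case using step_JumpEq[of n P a b "n + csize c + 2" g m] by (simp add: code_at_Cons)
next
  case (WhileNeq g a b c m t1 g1 m1 t2 g2 m2)
  then have 1: "(step P ^^ t1) (n + 1, g, m) = (n + 1 + csize c, g1, m1)"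
    by (simp add: code_at_Cons code_at_append)
  have 2: "step P (n, g, m) = (n + 1, g, m)"
    using WhileNeq step_JumpEq[of n P a b "n + csize c + 2" g m] by (simp add: code_at_Cons)
  have "n + 1 + csize c < length P \<and> P ! (n + 1 + csize c) = JumpEq 0 0 n"
    using WhileNeq.prems by (simp add: code_at_Cons code_at_append)
  then have 3: "step P (n + 1 + csize c, g1, m1) = (n, g1, m1)"
    by (rule step_jump)
  have "(step P ^^ (1 + t1 + 1 + t2)) (n, g, m) = (n + csize (While a b c), g2, m2)"
    unfolding funpow_add_apply using 1 2 3 WhileNeq.IH(2)[OF WhileNeq.prems] by simp
  moreover have "t1 + 2 + t2 = 1 + t1 + 1 + t2" by simp
  ultimately show ?case by (simp only:)
qed

section \<open>Total correctness with exact running times\<close>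

definition runs ::
  "com \<Rightarrow> 'a regs \<Rightarrow> 'a regs \<Rightarrow> (nat \<Rightarrow> 'a regs \<Rightarrow> 'a regs \<Rightarrow> bool) \<Rightarrow> bool" where
  "runs c g m Q \<longleftrightarrow> (\<exists>t g' m'. big c g m t g' m' \<and> Q t g' m')"

lemma runs_mono:
  "runs c g m Q \<Longrightarrow> (\<And>t g' m'. Q t g' m' \<Longrightarrow> Q' t g' m') \<Longrightarrow> runs c g m Q'"
  unfolding runs_def by blast

lemma runs_Ins:
  assumes "basic i"
  shows "runs (Ins i) g m Q \<longleftrightarrow> Q 1 (fst (snd (exec i (0, g, m)))) (snd (snd (exec i (0, g, m))))"
proof
  assume "runs (Ins i) g m Q"
  then obtain t g' m' where "big (Ins i) g m t g' m'" "Q t g' m'" unfolding runs_def by blast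
  then show "Q 1 (fst (snd (exec i (0, g, m)))) (snd (snd (exec i (0, g, m))))"
    by (auto elim: big.cases)
next
  assume "Q 1 (fst (snd (exec i (0, g, m)))) (snd (snd (exec i (0, g, m))))"
  moreover obtain pc g' m' where e: "exec i (0, g, m) = (pc, g', m')" by (rule prod_cases3)
  ultimately have "Q 1 g' m'" by simp
  then show "runs (Ins i) g m Q" unfolding runs_def using big.Ins[OF assms e] by blast
qed

lemma runs_basic [simp]:
  "runs (Ins (Const d n)) g m Q \<longleftrightarrow> Q 1 (g(d := Num n)) m"
  "runs (Ins (Copy d a)) g m Q \<longleftrightarrow> Q 1 (g(d := g a)) m"
  "runs (Ins (Add d a b)) g m Q \<longleftrightarrow> Q 1 (g(d := Num (num (g a) + num (g b)))) m"
  "runs (Ins (Sub d a b)) g m Q \<longleftrightarrow> Q 1 (g(d := Num (num (g a) - num (g b)))) m"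
  "runs (Ins (Load d a)) g m Q \<longleftrightarrow> Q 1 (g(d := m (num (g a)))) m"
  "runs (Ins (Store a b)) g m Q \<longleftrightarrow> Q 1 g (m(num (g a) := g b))"
  by (simp_all add: runs_Ins)

text \<open>Stated, like the other rules for loop-free code, as an equivalence, so that
  simplification executes such code symbolically and sums up its time.\<close>

lemma runs_Seq [simp]:
  "runs (c1 ;; c2) g m Q \<longleftrightarrow>
    runs c1 g m (\<lambda>t1 g1 m1. runs c2 g1 m1 (\<lambda>t2 g2 m2. Q (t1 + t2) g2 m2))"
proof
  assume "runs (c1 ;; c2) g m Q"
  then obtain t g2 m2 where b: "big (c1 ;; c2) g m t g2 m2" "Q t g2 m2" unfolding runs_def by blast
  from b(1) show "runs c1 g m (\<lambda>t1 g1 m1. runs c2 g1 m1 (\<lambda>t2 g2 m2. Q (t1 + t2) g2 m2))"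
    unfolding runs_def by cases (use b(2) in blast)
qed (auto simp: runs_def intro: big.Seq)

lemma runs_Cond [simp]:
  "runs (Cond a b c1 c2) g m Q \<longleftrightarrow>
    (if g a = g b then runs c1 g m (\<lambda>t. Q (t + 1)) else runs c2 g m (\<lambda>t. Q (t + 2)))"
proof
  assume "runs (Cond a b c1 c2) g m Q"
  then obtain t g2 m2 where b: "big (Cond a b c1 c2) g m t g2 m2" "Q t g2 m2"
    unfolding runs_def by blast
  from b(1) show "if g a = g b then runs c1 g m (\<lambda>t. Q (t + 1)) else runs c2 g m (\<lambda>t. Q (t + 2))"
    by cases (use b(2) in \<open>auto simp: runs_def\<close>)
next
  assume *: "if g a = g b then runs c1 g m (\<lambda>t. Q (t + 1)) else runs c2 g m (\<lambda>t. Q (t + 2))"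
  show "runs (Cond a b c1 c2) g m Q"
  proof (cases "g a = g b")
    case True
    then obtain t g' m' where "big c1 g m t g' m'" "Q (t + 1) g' m'"
      using * unfolding runs_def by auto
    then show ?thesis unfolding runs_def using big.CondEq[OF True] by blast
  next
    case False
    then obtain t g' m' where "big c2 g m t g' m'" "Q (t + 2) g' m'"
      using * unfolding runs_def by auto
    then show ?thesis unfolding runs_def using big.CondNeq[OF False] by blast
  qed
qed

text \<open>The number \<open>n\<close> in the invariant is a potential that pays for the remaining iterations.\<close>

lemma runs_While:
  assumes "I n g m"
    and body: "\<And>n g m. I n g m \<Longrightarrow> g a \<noteq> g b \<Longrightarrow>
      runs c g m (\<lambda>t g' m'. \<exists>n'. I n' g' m' \<and> t + 2 + n' \<le> n)"
  shows "runs (While a b c) g m (\<lambda>t g' m'. g' a = g' b \<and> (\<exists>n'. I n' g' m' \<and> t + n' \<le> n + 1))"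
  using assms(1)
proof (induction n arbitrary: g m rule: less_induct)
  case (less n)
  show ?case
  proof (cases "g a = g b")
    case True
    show ?thesis unfolding runs_def
      by (intro exI conjI, rule big.WhileEq, rule True, rule True, rule less.prems) simp
  next
    case False
    then obtain t g1 m1 n' where 1: "big c g m t g1 m1" "I n' g1 m1" "t + 2 + n' \<le> n"
      using body[OF less.prems] unfolding runs_def by blast
    then obtain t2 g2 m2 n2 where 2: "big (While a b c) g1 m1 t2 g2 m2" "g2 a = g2 b" "I n2 g2 m2"
      "t2 + n2 \<le> n' + 1"
    proof -
      have "n' < n" using 1(3) by simp
      from less.IH[OF this 1(2)] show ?thesis using that unfolding runs_def by blast
    qed
    have "big (While a b c) g m (t + 2 + t2) g2 m2" using big.WhileNeq[OF False 1(1) 2(1)] .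
    moreover have "t + 2 + t2 + n2 \<le> n + 1" using 1(3) 2(4) by simp
    ultimately show ?thesis unfolding runs_def using 2(2,3) by blast
  qed
qed

text \<open>Structured code cannot halt. It leaves its verdict in register 2, and the code appended
  here compares that register with the constant 1 in register 1.\<close>

definition decision_program :: "com \<Rightarrow> program" where
  "decision_program c = compile 0 c @ [JumpEq 2 1 (csize c + 2), Halt False, Halt True]"

text \<open>The additional time unit is the final comparison; a machine that stands at a
  \<open>Halt\<close> has already answered.\<close>

lemma decision_program_answers:
  assumes "runs c (\<lambda>_. Num 0) (\<lambda>i. if i < length xs then xs ! i else Num 0)
    (\<lambda>t g m. t \<le> T \<and> (g 2 = g 1 \<longleftrightarrow> v))"
  shows "answers_within (decision_program c) xs v (T + 1)"
proof -
  let ?P = "decision_program c"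
  obtain t g m where b: "big c (\<lambda>_. Num 0) (\<lambda>i. if i < length xs then xs ! i else Num 0) t g m"
    "t \<le> T" "g 2 = g 1 \<longleftrightarrow> v" using assms unfolding runs_def by blast
  have "code_at ?P 0 (compile 0 c)" unfolding code_at_def decision_program_def by auto
  from compile_correct[OF b(1) this] have 1: "(step ?P ^^ t) (initial_config xs) = (csize c, g, m)"
    by (simp add: initial_config_def)
  have at: "?P ! csize c = JumpEq 2 1 (csize c + 2)" "?P ! (csize c + 1) = Halt False"
    "?P ! (csize c + 2) = Halt True" "length ?P = csize c + 3"
    by (simp_all add: decision_program_def nth_append)
  have "step ?P (csize c, g, m) = (if v then csize c + 2 else csize c + 1, g, m)"
    using step_JumpEq[OF _ at(1), of g m] at(4) b(3) by simp
  then have "(step ?P ^^ (t + 1)) (initial_config xs) = (if v then csize c + 2 else csize c + 1, g, m)"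
    unfolding funpow_add_apply 1 by simp
  moreover have "halted_with ?P v (if v then csize c + 2 else csize c + 1, g, m)"
    unfolding halted_with_def using at by auto
  moreover have "t + 1 \<le> T + 1" using b(2) by simp
  ultimately have "halted_with ?P v ((step ?P ^^ (t + 1)) (initial_config xs))" "t + 1 \<le> T + 1"
    by (simp_all only:)
  then show ?thesis unfolding answers_within_def by blast
qed

section \<open>Matching and copying blocks of memory\<close>

text \<open>Registers 0, 1 and 3 hold constants, register 2 the result. Subprograms work with higher
  registers than their callers, so that \<open>same_below\<close> describes their side effects.\<close>

definition consts_ok :: "'a regs \<Rightarrow> bool" where
  "consts_ok g \<longleftrightarrow> g 0 = Num 0 \<and> g 1 = Num 1 \<and> g 3 = Num 3"

definition same_below :: "nat \<Rightarrow> 'a regs \<Rightarrow> 'a regs \<Rightarrow> bool" where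
  "same_below k g g' \<longleftrightarrow> (\<forall>r<k. g' r = g r)"

lemma same_belowD: "same_below k g g' \<Longrightarrow> r < k \<Longrightarrow> g' r = g r"
  by (simp add: same_below_def)

lemma same_below_refl [simp]: "same_below k g g"
  by (simp add: same_below_def)

lemma same_below_upd [simp]: "k \<le> r \<Longrightarrow> same_below k g (g'(r := x)) \<longleftrightarrow> same_below k g g'"
  by (simp add: same_below_def)

lemma consts_ok_upd [simp]: "3 < r \<Longrightarrow> consts_ok (g(r := x)) \<longleftrightarrow> consts_ok g"
  by (simp add: consts_ok_def)

lemma consts_okD: "consts_ok g \<Longrightarrow> g 0 = Num 0" "consts_ok g \<Longrightarrow> g 1 = Num 1"
  "consts_ok g \<Longrightarrow> g (Suc 0) = Num 1" "consts_ok g \<Longrightarrow> g 3 = Num 3"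
  by (simp_all add: consts_ok_def)

lemma same_below_consts: "same_below k g g' \<Longrightarrow> 4 \<le> k \<Longrightarrow> consts_ok g \<Longrightarrow> consts_ok g'"
  by (simp add: same_below_def consts_ok_def)

definition match_body :: com where
  "match_body =
    Ins (Load 63 60) ;; Ins (Load 64 61) ;;
    Cond 63 64
     (Ins (Add 60 60 1) ;; Ins (Add 61 61 1) ;; Ins (Sub 62 62 1))
     (Ins (Copy 65 0) ;; Ins (Copy 62 0))"

definition match_prog :: com where
  "match_prog =
    Ins (Copy 65 1) ;;
    While 62 0 match_body"

lemma match_prog:
  fixes g m :: "'a regs"
  assumes c: "consts_ok g" and g: "g 60 = Num a" "g 61 = Num b" "g 62 = Num n"
  shows "runs match_prog g m (\<lambda>t g' m'. m' = m \<and> same_below 60 g g' \<and> t \<le> 10 * n + 10 \<and>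
    g' 65 = Num (if \<forall>i<n. m (a + i) = m (b + i) then 1 else 0))"
proof -
  let ?goal = "\<forall>i<n. m (a + i) = m (b + i)"
  \<comment> \<open>After a mismatch the counter in register 62 is cleared and the loop ends at
    once, so the second disjunct does not constrain the potential.\<close>
  define I :: "nat \<Rightarrow> 'a regs \<Rightarrow> 'a regs \<Rightarrow> bool" where
    "I = (\<lambda>k g' m'. m' = m \<and> same_below 60 g g' \<and>
      ((\<exists>j\<le>n. g' 60 = Num (a + j) \<and> g' 61 = Num (b + j) \<and> g' 62 = Num (n - j) \<and> g' 65 = Num 1 \<and>
        (\<forall>i<j. m (a + i) = m (b + i)) \<and> k = 10 * (n - j)) \<or>
       (g' 62 = Num 0 \<and> g' 65 = Num 0 \<and> \<not> ?goal)))"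
  have body: "runs match_body g' m' (\<lambda>t g2 m2. \<exists>n'. I n' g2 m2 \<and> t + 2 + n' \<le> k)"
    if inv: "I k g' m'" and ne: "g' 62 \<noteq> g' 0" for k g' m'
  proof -
    note [simp] = match_body_def
    have sb: "same_below 60 g g'" and m': "m' = m" using inv by (auto simp: I_def)
    have c': "consts_ok g'" using same_below_consts[OF sb] c by simp
    obtain j where j: "j \<le> n" "g' 60 = Num (a + j)" "g' 61 = Num (b + j)" "g' 62 = Num (n - j)"
      "g' 65 = Num 1" "\<forall>i<j. m (a + i) = m (b + i)" "k = 10 * (n - j)"
      using inv ne consts_okD(1)[OF c'] by (auto simp: I_def)
    have jn: "j < n" using j(1,4) ne consts_okD(1)[OF c'] by auto
    show ?thesis
    proof (cases "m (a + j) = m (b + j)")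
      case True
      have "I (10 * (n - Suc j)) (g'(63 := m (a + j), 64 := m (b + j), 60 := Num (Suc (a + j)),
          61 := Num (Suc (b + j)), 62 := Num (n - Suc j))) m"
        unfolding I_def using sb jn j True by (auto simp: less_Suc_eq intro!: exI[of _ "Suc j"])
      moreover have "8 + 10 * (n - Suc j) \<le> k" using jn j(7) by simp
      ultimately show ?thesis using j True m' consts_okD[OF c'] by (auto simp: diff_Suc)
    next
      case False
      have "I 0 (g'(63 := m (a + j), 64 := m (b + j), 65 := Num 0, 62 := Num 0)) m"
        unfolding I_def using sb jn False by auto
      moreover have "10 \<le> k" using jn j(7) by simp
      ultimately show ?thesis using j False m' consts_okD[OF c'] by (auto intro!: exI[of _ 0])
    qed
  qed
  have init: "I (10 * n) (g(65 := Num 1)) m"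
    unfolding I_def using g by (auto intro!: exI[of _ 0])
  have "runs (While 62 0 match_body) (g(65 := Num 1)) m
      (\<lambda>t g' m'. g' 62 = g' 0 \<and> (\<exists>n'. I n' g' m' \<and> t + n' \<le> 10 * n + 1))"
    by (rule runs_While[where I = I, OF init body])
  then show ?thesis
    unfolding match_prog_def runs_Seq runs_basic consts_okD(2)[OF c]
  proof (rule runs_mono)
    fix t g' m'
    assume *: "g' 62 = g' 0 \<and> (\<exists>n'. I n' g' m' \<and> t + n' \<le> 10 * n + 1)"
    then obtain n' where i: "I n' g' m'" and t: "t + n' \<le> 10 * n + 1" by blast
    have sb: "same_below 60 g g'" and m': "m' = m" using i by (auto simp: I_def)
    have "g' 0 = Num 0" using same_belowD[OF sb, of 0] consts_okD(1)[OF c] by simp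
    then have "g' 65 = Num (if ?goal then 1 else 0)"
      using i * by (auto simp: I_def)
    then show "m' = m \<and> same_below 60 g g' \<and> 1 + t \<le> 10 * n + 10 \<and>
        g' 65 = Num (if ?goal then 1 else 0)" using sb m' t by simp
  qed
qed

definition copy_body :: com where
  "copy_body =
    Ins (Load 63 60) ;; Ins (Store 61 63) ;;
    Ins (Add 60 60 1) ;; Ins (Add 61 61 1) ;; Ins (Sub 62 62 1)"

definition copy_prog :: com where
  "copy_prog =
    While 62 0 copy_body"

lemma copy_prog:
  fixes g m :: "'a regs"
  assumes c: "consts_ok g" and g: "g 60 = Num a" "g 61 = Num b" "g 62 = Num n"
    and dis: "a + n \<le> b \<or> b + n \<le> a"
  shows "runs copy_prog g m (\<lambda>t g' m'. same_below 60 g g' \<and> t \<le> 10 * n + 10 \<and>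
    m' = (\<lambda>x. if b \<le> x \<and> x < b + n then m (a + (x - b)) else m x))"
proof -
  define M where "M = (\<lambda>j x. if b \<le> x \<and> x < b + j then m (a + (x - b)) else m x)"
  define I :: "nat \<Rightarrow> 'a regs \<Rightarrow> 'a regs \<Rightarrow> bool" where
    "I = (\<lambda>k g' m'. same_below 60 g g' \<and>
      (\<exists>j\<le>n. g' 60 = Num (a + j) \<and> g' 61 = Num (b + j) \<and> g' 62 = Num (n - j) \<and> m' = M j \<and>
        k = 10 * (n - j)))"
  have body: "runs copy_body g' m'
      (\<lambda>t g2 m2. \<exists>n'. I n' g2 m2 \<and> t + 2 + n' \<le> k)"
    if inv: "I k g' m'" and ne: "g' 62 \<noteq> g' 0" for k g' m'
  proof -
    note [simp] = copy_body_def
    have sb: "same_below 60 g g'" using inv by (auto simp: I_def)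
    have c': "consts_ok g'" using same_below_consts[OF sb] c by simp
    obtain j where j: "j \<le> n" "g' 60 = Num (a + j)" "g' 61 = Num (b + j)" "g' 62 = Num (n - j)"
      "m' = M j" "k = 10 * (n - j)" using inv by (auto simp: I_def)
    have jn: "j < n" using j(1,4) ne consts_okD(1)[OF c'] by auto
    \<comment> \<open>Source and target are disjoint, so the cell about to be read still has its
      original content.\<close>
    have "M j (a + j) = m (a + j)" using dis jn by (auto simp: M_def)
    then have M: "(M j)(b + j := M j (a + j)) = M (Suc j)" by (auto simp: M_def fun_eq_iff)
    have "I (10 * (n - Suc j)) (g'(63 := M j (a + j), 60 := Num (Suc (a + j)),
        61 := Num (Suc (b + j)), 62 := Num (n - Suc j))) (M (Suc j))"
      unfolding I_def using sb jn j by (auto intro!: exI[of _ "Suc j"])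
    moreover have "7 + 10 * (n - Suc j) \<le> k" using jn j by simp
    ultimately show ?thesis using j M consts_okD[OF c'] by (auto simp: diff_Suc)
  qed
  have init: "I (10 * n) g m"
    unfolding I_def using g by (auto simp: M_def fun_eq_iff intro!: exI[of _ 0])
  have "runs copy_prog g m
      (\<lambda>t g' m'. g' 62 = g' 0 \<and> (\<exists>n'. I n' g' m' \<and> t + n' \<le> 10 * n + 1))"
    unfolding copy_prog_def by (rule runs_While[where I = I, OF init body])
  then show ?thesis
  proof (rule runs_mono)
    fix t g' m'
    assume *: "g' 62 = g' 0 \<and> (\<exists>n'. I n' g' m' \<and> t + n' \<le> 10 * n + 1)"
    then obtain n' j where i: "same_below 60 g g'" "j \<le> n" "g' 62 = Num (n - j)" "m' = M j"
      and t: "t + n' \<le> 10 * n + 1" by (auto simp: I_def)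
    have "g' 0 = Num 0" using same_belowD[OF i(1), of 0] consts_okD(1)[OF c] by simp
    then have "j = n" using i * by simp
    then show "same_below 60 g g' \<and> t \<le> 10 * n + 10 \<and>
        m' = (\<lambda>x. if b \<le> x \<and> x < b + n then m (a + (x - b)) else m x)"
      using i t by (simp add: M_def)
  qed
qed

definition common_suffix_body :: com where
  "common_suffix_body =
    Ins (Sub 60 60 1) ;; Ins (Sub 61 61 1) ;; Ins (Load 63 60) ;; Ins (Load 64 61) ;;
    Cond 63 64 (Ins (Add 62 62 1)) (Ins (Copy 65 0))"

definition common_suffix_prog :: com where
  "common_suffix_prog =
    Ins (Copy 62 0) ;; Ins (Copy 65 1) ;;
    While 65 0 common_suffix_body"

text \<open>The program checks no bound. It stops because of the mismatch at distance
  \<open>K\<close>, whose existence the caller has to supply; \<open>first_mismatch\<close> does so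
  for the table of relation words.\<close>

lemma common_suffix_prog:
  fixes g m :: "'a regs"
  assumes c: "consts_ok g" and g: "g 60 = Num a" "g 61 = Num b"
    and K: "\<forall>i<K. m (a - 1 - i) = m (b - 1 - i)" "m (a - 1 - K) \<noteq> m (b - 1 - K)"
  shows "runs common_suffix_prog g m (\<lambda>t g' m'. m' = m \<and> same_below 60 g g' \<and>
    t \<le> 10 * K + 20 \<and> g' 62 = Num K)"
proof -
  define I :: "nat \<Rightarrow> 'a regs \<Rightarrow> 'a regs \<Rightarrow> bool" where
    "I = (\<lambda>k g' m'. m' = m \<and> same_below 60 g g' \<and>
      ((\<exists>j\<le>K. g' 60 = Num (a - j) \<and> g' 61 = Num (b - j) \<and> g' 62 = Num j \<and> g' 65 = Num 1 \<and>
         k = 10 * (K - j) + 10) \<or>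
       (g' 62 = Num K \<and> g' 65 = Num 0)))"
  have body: "runs common_suffix_body g' m'
      (\<lambda>t g2 m2. \<exists>n'. I n' g2 m2 \<and> t + 2 + n' \<le> k)"
    if inv: "I k g' m'" and ne: "g' 65 \<noteq> g' 0" for k g' m'
  proof -
    note [simp] = common_suffix_body_def
    have sb: "same_below 60 g g'" and m': "m' = m" using inv by (auto simp: I_def)
    have c': "consts_ok g'" using same_below_consts[OF sb] c by simp
    obtain j where j: "j \<le> K" "g' 60 = Num (a - j)" "g' 61 = Num (b - j)" "g' 62 = Num j"
      "g' 65 = Num 1" "k = 10 * (K - j) + 10"
      using inv ne consts_okD(1)[OF c'] by (auto simp: I_def)
    have e: "a - j - 1 = a - 1 - j" "b - j - 1 = b - 1 - j" by auto
    show ?thesis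
    proof (cases "m (a - 1 - j) = m (b - 1 - j)")
      case True
      then have jK: "j < K" using j(1) K(2) by (metis le_neq_implies_less)
      have "I (10 * (K - Suc j) + 10) (g'(60 := Num (a - j - 1), 61 := Num (b - j - 1),
          63 := m (a - j - 1), 64 := m (b - j - 1), 62 := Num (Suc j))) m"
        unfolding I_def using sb jK j by (auto intro!: exI[of _ "Suc j"])
      moreover have "8 + (10 * (K - Suc j) + 10) \<le> k" using jK j by simp
      ultimately show ?thesis using j True m' e consts_okD[OF c'] by auto
    next
      case False
      then have "j = K" using j(1) K(1) by (metis le_neq_implies_less)
      then have "I 0 (g'(60 := Num (a - j - 1), 61 := Num (b - j - 1),
          63 := m (a - j - 1), 64 := m (b - j - 1), 65 := Num 0)) m"
        unfolding I_def using sb j by auto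
      moreover have "10 \<le> k" using j by simp
      ultimately show ?thesis using j False m' e consts_okD[OF c'] by (auto intro!: exI[of _ 0])
    qed
  qed
  have init: "I (10 * K + 10) (g(62 := Num 0, 65 := Num 1)) m"
    unfolding I_def using g by (auto intro!: exI[of _ 0])
  have "runs (While 65 0 common_suffix_body)
      (g(62 := Num 0, 65 := Num 1)) m
      (\<lambda>t g' m'. g' 65 = g' 0 \<and> (\<exists>n'. I n' g' m' \<and> t + n' \<le> 10 * K + 10 + 1))"
    by (rule runs_While[where I = I, OF init body])
  then have "runs common_suffix_prog g m
      (\<lambda>t g' m'. g' 65 = g' 0 \<and> (\<exists>n'. I n' g' m' \<and> t + n' \<le> 10 * K + 10 + 3))"
    unfolding common_suffix_prog_def
    using consts_okD[OF c] by (auto elim!: runs_mono)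
  then show ?thesis
  proof (rule runs_mono)
    fix t g' m'
    assume *: "g' 65 = g' 0 \<and> (\<exists>n'. I n' g' m' \<and> t + n' \<le> 10 * K + 10 + 3)"
    then obtain n' where i: "I n' g' m'" and t: "t + n' \<le> 10 * K + 13" by auto
    have sb: "same_below 60 g g'" and m': "m' = m" using i by (auto simp: I_def)
    have "g' 0 = Num 0" using same_belowD[OF sb, of 0] consts_okD(1)[OF c] by simp
    then have "g' 62 = Num K" using i * by (auto simp: I_def)
    then show "m' = m \<and> same_below 60 g g' \<and> t \<le> 10 * K + 20 \<and> g' 62 = Num K"
      using sb m' t by simp
  qed
qed

section \<open>Tabulating the active suffixes\<close>

definition word_at :: "'a regs \<Rightarrow> nat \<Rightarrow> 'a list \<Rightarrow> bool" where
  "word_at m a w \<longleftrightarrow> (\<forall>i<length w. m (a + i) = Gen (w ! i))"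

definition is_num :: "'a cell \<Rightarrow> bool" where
  "is_num x \<longleftrightarrow> (\<exists>n. x = Num n)"

lemma is_num_Num [simp]: "is_num (Num n)"
  by (simp add: is_num_def)

lemma not_is_num_Gen [simp]: "\<not> is_num (Gen a)"
  by (simp add: is_num_def)

lemma word_at_Nil [simp]: "word_at m a []"
  by (simp add: word_at_def)

lemma word_at_append:
  "word_at m a (v @ w) \<longleftrightarrow> word_at m a v \<and> word_at m (a + length v) w"
proof
  assume l: "word_at m a (v @ w)"
  have "m (a + length v + i) = Gen (w ! i)" if "i < length w" for i
    using l[unfolded word_at_def, rule_format, of "length v + i"] that
    by (simp add: add.assoc)
  moreover have "m (a + i) = Gen (v ! i)" if "i < length v" for i
    using l[unfolded word_at_def, rule_format, of i] that by (simp add: nth_append)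
  ultimately show "word_at m a v \<and> word_at m (a + length v) w" unfolding word_at_def by blast
next
  assume r: "word_at m a v \<and> word_at m (a + length v) w"
  show "word_at m a (v @ w)"
    unfolding word_at_def
  proof (intro allI impI)
    fix i assume i: "i < length (v @ w)"
    show "m (a + i) = Gen ((v @ w) ! i)"
    proof (cases "i < length v")
      case True
      then show ?thesis using r by (simp add: word_at_def nth_append)
    next
      case False
      have "i - length v < length w" using False i by simp
      then have "m (a + length v + (i - length v)) = Gen (w ! (i - length v))"
        using r unfolding word_at_def by blast
      moreover have "a + length v + (i - length v) = a + i" using False by simp
      ultimately show ?thesis using False by (simp add: nth_append)
    qed
  qed
qed

lemma word_at_Cons: "word_at m a (b # w) \<longleftrightarrow> m a = Gen b \<and> word_at m (Suc a) w"
  using word_at_append[of m a "[b]" w] by (simp add: word_at_def)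

lemma word_at_cong:
  "(\<And>i. i < length w \<Longrightarrow> m' (a + i) = m (a + i)) \<Longrightarrow> word_at m' a w \<longleftrightarrow> word_at m a w"
  by (simp add: word_at_def)

text \<open>The number behind \<open>s\<close> is a sentinel: a pattern of generators that is longer
  than \<open>s\<close> fails there, so the length of \<open>s\<close> need not be known.\<close>

lemma match_iff_prefix:
  assumes "word_at m a p" "word_at m b s" "is_num (m (b + length s))"
  shows "(\<forall>i<length p. m (a + i) = m (b + i)) \<longleftrightarrow> prefix p s"
proof
  assume l: "\<forall>i<length p. m (a + i) = m (b + i)"
  have len: "length p \<le> length s"
  proof (rule ccontr)
    assume "\<not> length p \<le> length s"
    then have "m (b + length s) = Gen (p ! length s)"
      using l assms(1) by (auto simp: word_at_def)
    then show False using assms(3) by simp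
  qed
  have "p = take (length p) s"
  proof (rule nth_equalityI)
    fix i assume i: "i < length p"
    have "Gen (p ! i) = Gen (s ! i)"
      using l assms(1,2) i len unfolding word_at_def by (metis le_trans not_less order_less_le_trans)
    then show "p ! i = take (length p) s ! i" using i by simp
  qed (use len in simp)
  then show "prefix p s" by (metis take_is_prefix)
next
  assume "prefix p s"
  then obtain t where "s = p @ t" by (auto simp: prefix_def)
  then show "\<forall>i<length p. m (a + i) = m (b + i)"
    using assms(1,2) by (auto simp: word_at_def nth_append)
qed

text \<open>Inactive suffixes are passed letter by letter, according to \<open>poss_Cons\<close>; at
  the first active one two matches decide, according to \<open>poss_headed\<close>. The instruction
  \<open>Copy 63 63\<close> does nothing and stands for an empty branch.\<close>

definition poss_body :: com where
  "poss_body =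
    Cond 47 0
    (Ins (Copy 49 1) ;; Ins (Copy 50 0))
    (Ins (Add 51 48 6) ;; Ins (Load 52 51) ;;
     Cond 52 0
      (Ins (Load 53 48) ;; Ins (Load 54 46) ;;
       Cond 53 54
        (Ins (Add 46 46 1) ;; Ins (Add 48 48 1) ;; Ins (Sub 47 47 1))
        (Ins (Copy 49 0) ;; Ins (Copy 50 0)))
      (Ins (Copy 60 46) ;; Ins (Add 61 52 3) ;; Ins (Copy 62 47) ;; match_prog ;;
       Ins (Copy 49 65) ;;
       Cond 65 0
        (Ins (Load 53 52) ;; Ins (Copy 60 46) ;; Ins (Add 61 53 3) ;; Ins (Copy 62 47) ;;
         match_prog ;; Ins (Copy 49 65))
        (Ins (Copy 63 63)) ;;
       Ins (Copy 50 0)))"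

definition poss_prog :: com where
  "poss_prog =
    Ins (Copy 50 1) ;;
    While 50 0 poss_body"

definition flag_body :: com where
  "flag_body =
    Ins (Add 42 41 1) ;; Ins (Load 42 42) ;; Ins (Add 43 41 1) ;; Ins (Add 43 43 1) ;;
    Ins (Load 43 43) ;; Ins (Add 44 41 3) ;; Ins (Sub 45 43 42) ;;
    Ins (Copy 60 44) ;; Ins (Copy 61 7) ;; Ins (Copy 62 45) ;; match_prog ;;
    Cond 65 1
     (Ins (Add 46 44 45) ;; Ins (Copy 47 42) ;; Ins (Add 48 7 45) ;; poss_prog ;;
      Cond 49 1 (Ins (Copy 40 41)) (Ins (Copy 63 63)))
     (Ins (Copy 63 63)) ;;
    Ins (Add 41 44 43)"

definition flag_prog :: com where
  "flag_prog =
    Ins (Copy 40 0) ;; Ins (Copy 41 4) ;;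
    While 41 5 flag_body"

definition prepend_body :: com where
  "prepend_body =
    Ins (Sub 30 30 1) ;; Ins (Sub 7 7 1) ;; Ins (Load 32 30) ;; Ins (Store 7 32) ;;
    flag_prog ;;
    Ins (Add 33 7 6) ;; Ins (Store 33 40) ;; Ins (Sub 31 31 1)"

definition prepend_prog :: com where
  "prepend_prog =
    While 31 0 prepend_body"

text \<open>The table of relation words starts at \<open>T\<close>, the shorter word lies between
  \<open>S\<close> and \<open>ue\<close>, and its flags follow. By \<open>S + F = ue + 1\<close> the
  flag of the lowest address \<open>S\<close> is the first cell behind the end marker at
  \<open>ue\<close>, so word and flags never meet.\<close>

locale word_machine = c4_relations R for R :: "'a relations" +
  fixes ws :: "'a list list" and pidx :: "nat \<Rightarrow> nat" and T S ue F :: nat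
  assumes set_ws: "set ws = relation_words R"
    and distinct_ws: "distinct ws"
    and pidx: "i < length ws \<Longrightarrow> pidx i < length ws \<and> partner R (ws ! i) (ws ! pidx i)"
    and T_pos: "0 < T"
    and S: "T + sum_list (map (\<lambda>w. length w + 3) ws) < S"
    and F: "S + F = ue + 1"
begin

definition addr :: "nat \<Rightarrow> nat" where
  "addr i = T + sum_list (map (\<lambda>w. length w + 3) (take i ws))"

abbreviation TE :: nat where "TE \<equiv> addr (length ws)"

text \<open>The record of a relation word consists of the address of the record of its partner, the length
  of its tail, its own length, and its letters. As every word is followed by a cell with a number,
  words can be matched without checking for their end.\<close>

definition records :: "(nat \<Rightarrow> nat) \<Rightarrow> 'a regs \<Rightarrow> bool" where
  "records zl m \<longleftrightarrow>
    (\<forall>i<length ws. m (addr i) = Num (addr (pidx i)) \<and> m (addr i + 1) = Num (zl i) \<and>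
       m (addr i + 2) = Num (length (ws ! i)) \<and> word_at m (addr i + 3) (ws ! i)) \<and>
    is_num (m TE)"

definition zlen :: "nat \<Rightarrow> nat" where "zlen i = length (Z (ws ! i))"

lemma addr_0: "addr 0 = T"
  by (simp add: addr_def)

lemma addr_Suc: "i < length ws \<Longrightarrow> addr (Suc i) = addr i + 3 + length (ws ! i)"
  by (simp add: addr_def take_Suc_conv_app_nth)

lemma addr_mono: "i \<le> j \<Longrightarrow> addr i \<le> addr j"
proof -
  assume "i \<le> j"
  then have "take j ws = take i ws @ take (j - i) (drop i ws)"
    using take_add[of i "j - i" ws] by simp
  then show ?thesis by (simp add: addr_def)
qed

lemma T_le_addr: "T \<le> addr i"
  by (simp add: addr_def)

lemma TE_less_S: "TE < S"
  using S by (simp add: addr_def)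

lemma record_end: "i < length ws \<Longrightarrow> addr i + 3 + length (ws ! i) \<le> TE"
  using addr_mono[of "Suc i" "length ws"] addr_Suc[of i] by simp

lemma ws_in_W: "i < length ws \<Longrightarrow> ws ! i \<in> W"
  using set_ws nth_mem by blast

lemma records_cong:
  assumes "records zl m" "\<And>x. T \<le> x \<Longrightarrow> x \<le> TE \<Longrightarrow> m' x = m x"
  shows "records zl m'"
proof -
  have "m' (addr i + k) = m (addr i + k)" if "i < length ws" "k < 3 + length (ws ! i)" for i k
    using assms(2)[of "addr i + k"] T_le_addr[of i] record_end[OF that(1)] that(2) by simp
  from this[of _ 0] this[of _ 1] this[of _ 2] this[of _ "3 + _"]
  have 0: "\<And>i. i < length ws \<Longrightarrow> m' (addr i) = m (addr i)"
    and 1: "\<And>i. i < length ws \<Longrightarrow> m' (addr i + 1) = m (addr i + 1)"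
    and 2: "\<And>i. i < length ws \<Longrightarrow> m' (addr i + 2) = m (addr i + 2)"
    and 3: "\<And>i j. i < length ws \<Longrightarrow> j < length (ws ! i) \<Longrightarrow> m' (addr i + 3 + j) = m (addr i + 3 + j)"
    by (simp_all add: add.assoc)
  have "m' TE = m TE" using assms(2) T_le_addr by simp
  moreover have "word_at m' (addr i + 3) (ws ! i) = word_at m (addr i + 3) (ws ! i)"
    if "i < length ws" for i
    using 3[OF that] by (intro word_at_cong) auto
  ultimately show ?thesis using assms(1) 0 1 2 unfolding records_def by auto
qed

lemma records_word:
  assumes "records zl m" "i < length ws"
  shows "word_at m (addr i + 3) (ws ! i)" "is_num (m (addr i + 3 + length (ws ! i)))"
proof -
  show "word_at m (addr i + 3) (ws ! i)" using assms unfolding records_def by blast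
  show "is_num (m (addr i + 3 + length (ws ! i)))"
  proof (cases "Suc i < length ws")
    case True
    then show ?thesis using assms addr_Suc[of i] unfolding records_def by auto
  next
    case False
    then have "Suc i = length ws" using assms(2) by simp
    then show ?thesis using assms addr_Suc[of i] unfolding records_def by auto
  qed
qed

lemma records_head_tail:
  assumes "records zl m" "i < length ws"
  shows "word_at m (addr i + 3) (H (ws ! i))"
    "word_at m (addr i + 3 + length (H (ws ! i))) (Z (ws ! i))"
  using records_word(1)[OF assms] word_at_append[of m "addr i + 3" "H (ws ! i)" "Z (ws ! i)"]
  by (simp_all add: H_Z)

lemma zlen_le: "zlen i \<le> length (ws ! i)"
  unfolding zlen_def length_Z by (rule tail_length_properties)

lemma length_H: "length (H (ws ! i)) = length (ws ! i) - zlen i"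
  unfolding zlen_def length_Z by (simp add: H_def)

definition good :: "'a list \<Rightarrow> nat \<Rightarrow> bool" where
  "good u i \<longleftrightarrow> (\<exists>y. u = H (ws ! i) @ y \<and> poss (Z (ws ! i)) y)"

text \<open>What the table stores for the suffix \<open>u\<close>: the record of the relation word that makes
  it active. As \<open>T > 0\<close>, no record has the address 0.\<close>

definition flag :: "'a list \<Rightarrow> 'a cell \<Rightarrow> bool" where
  "flag u x \<longleftrightarrow> (if act u then \<exists>i<length ws. good u i \<and> x = Num (addr i) else x = Num 0)"

definition text_at :: "'a regs \<Rightarrow> nat \<Rightarrow> 'a list \<Rightarrow> bool" where
  "text_at m x u \<longleftrightarrow> word_at m x u \<and> is_num (m (x + length u))"

text \<open>All \<open>k\<close> are meant: behind the end of \<open>u\<close> the suffix is empty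
  and not active, so the cells there must hold 0, and a scan may run past the end of the
  word.\<close>

definition flags :: "'a regs \<Rightarrow> nat \<Rightarrow> 'a list \<Rightarrow> bool" where
  "flags m x u \<longleftrightarrow> (\<forall>k. flag (drop k u) (m (x + F + k)))"

lemma act_iff_good: "act u \<longleftrightarrow> (\<exists>i<length ws. good u i)"
  unfolding act_iff good_def using set_ws by (metis in_set_conv_nth)

lemma text_at_drop: "text_at m x u \<Longrightarrow> k \<le> length u \<Longrightarrow> text_at m (x + k) (drop k u)"
  unfolding text_at_def using word_at_append[of m x "take k u" "drop k u"] by (simp add: add.assoc)

lemma flags_drop: "flags m x u \<Longrightarrow> flags m (x + k) (drop k u)"
  unfolding flags_def
proof
  fix j assume "\<forall>k. flag (drop k u) (m (x + F + k))"
  then have "flag (drop (k + j) u) (m (x + F + (k + j)))" by blast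
  then show "flag (drop j (drop k u)) (m (x + k + F + j))"
    by (simp add: add.commute add.left_commute)
qed

section \<open>Deciding possible prefixes and activity from the table\<close>

lemma piece_drop: "piece R p \<Longrightarrow> piece R (drop k p)"
  by (erule piece_sublist) simp

lemma poss_prog:
  fixes g m :: "'a regs"
  assumes c: "consts_ok g" and g: "g 46 = Num a" "g 47 = Num (length p)" "g 48 = Num x" "g 6 = Num F"
    and rec: "records zlen m" and p: "word_at m a p" "piece R p"
    and u: "text_at m x u" "flags m x u"
  shows "runs poss_prog g m (\<lambda>t g' m'. m' = m \<and> same_below 46 g g' \<and> t \<le> 40 * length p + 100 \<and>
    g' 49 = Num (if poss p u then 1 else 0))"
proof -
  \<comment> \<open>The rate 40 covers, besides one round per letter, the two matches at the end,
    which take 10 per remaining letter each; the summand 80 covers their overhead.\<close>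
  define I :: "nat \<Rightarrow> 'a regs \<Rightarrow> 'a regs \<Rightarrow> bool" where
    "I = (\<lambda>k g' m'. m' = m \<and> same_below 46 g g' \<and>
      ((\<exists>j\<le>length p. j \<le> length u \<and> g' 46 = Num (a + j) \<and> g' 48 = Num (x + j) \<and>
         g' 47 = Num (length p - j) \<and> g' 50 = Num 1 \<and>
         poss (drop j p) (drop j u) = poss p u \<and> k = 40 * (length p - j) + 80) \<or>
       (g' 50 = Num 0 \<and> g' 49 = Num (if poss p u then 1 else 0))))"
  have body: "runs poss_body g' m' (\<lambda>t g2 m2. \<exists>n'. I n' g2 m2 \<and> t + 2 + n' \<le> k)"
    if inv: "I k g' m'" and ne: "g' 50 \<noteq> g' 0" for k g' m'
  proof -
    note [simp] = poss_body_def
    have sb: "same_below 46 g g'" and m': "m' = m" using inv by (auto simp: I_def)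
    have c': "consts_ok g'" using same_below_consts[OF sb] c by simp
    have g6: "g' 6 = Num F" using same_belowD[OF sb, of 6] g by simp
    obtain j where j: "j \<le> length p" "j \<le> length u" "g' 46 = Num (a + j)" "g' 48 = Num (x + j)"
      "g' 47 = Num (length p - j)" "g' 50 = Num 1" "poss (drop j p) (drop j u) = poss p u"
      "k = 40 * (length p - j) + 80"
      using inv ne consts_okD(1)[OF c'] by (auto simp: I_def)
    have wp: "word_at m (a + j) (drop j p)"
      using p(1) j(1) word_at_append[of m a "take j p" "drop j p"] by simp
    have tu: "text_at m (x + j) (drop j u)" using text_at_drop[OF u(1) j(2)] .
    have fl: "flag (drop j u) (m (x + j + F))"
      using u(2) unfolding flags_def by (metis add.commute add.left_commute)
    show ?thesis
    proof (cases "j = length p")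
      case True
      then have "poss p u" using j(7) poss_empty by simp
      then have "I 0 (g'(49 := Num 1, 50 := Num 0)) m" unfolding I_def using sb by simp
      then show ?thesis using True j m' consts_okD[OF c'] by (auto intro!: exI[of _ 0])
    next
      case False
      then have jp: "j < length p" using j(1) by simp
      have dp: "drop j p = p ! j # drop (Suc j) p" using jp by (simp add: Cons_nth_drop_Suc)
      have ma: "m (a + j) = Gen (p ! j)" using wp dp word_at_Cons by metis
      show ?thesis
      proof (cases "act (drop j u)")
        case False
        then have f0: "m (x + j + F) = Num 0" using fl by (simp add: flag_def)
        show ?thesis
        proof (cases "m (x + j) = m (a + j)")
          case True
          \<comment> \<open>A generator cannot equal the number that ends \<open>u\<close>.\<close>
          have ju: "j < length u"
          proof (rule ccontr)
            assume "\<not> j < length u"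
            then have "is_num (m (x + j))" using tu j(2) by (simp add: text_at_def)
            then show False using True ma by simp
          qed
          have du: "drop j u = u ! j # drop (Suc j) u" using ju by (simp add: Cons_nth_drop_Suc)
          have "m (x + j) = Gen (u ! j)" using tu du word_at_Cons unfolding text_at_def by metis
          then have "u ! j = p ! j" using True ma by simp
          then have "poss (drop (Suc j) p) (drop (Suc j) u) = poss p u"
            using poss_Cons False j(7) du dp by metis
          then have "I (40 * (length p - Suc j) + 80) (g'(51 := Num (x + j + F), 52 := Num 0,
              53 := m (x + j), 54 := m (a + j), 46 := Num (Suc (a + j)),
              48 := Num (Suc (x + j)), 47 := Num (length p - Suc j))) m"
            unfolding I_def using sb ju jp j by (auto intro!: exI[of _ "Suc j"])
          moreover have "14 + (40 * (length p - Suc j) + 80) \<le> k" using jp j(8) by simp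
          ultimately show ?thesis using j True m' f0 g6 jp consts_okD[OF c']
            by (auto simp: diff_Suc)
        next
          case ne: False
          have "\<not> poss (drop j p) (drop j u)"
          proof (cases "drop j u")
            case Nil
            then show ?thesis using poss_Nil dp by simp
          next
            case (Cons b y)
            then have "m (x + j) = Gen b" using tu word_at_Cons unfolding text_at_def by metis
            then have "b \<noteq> p ! j" using ne ma by auto
            then show ?thesis using poss_Cons False Cons dp by metis
          qed
          then have "I 0 (g'(51 := Num (x + j + F), 52 := Num 0,
              53 := m (x + j), 54 := m (a + j), 49 := Num 0, 50 := Num 0)) m"
            unfolding I_def using sb j(7) by auto
          then show ?thesis using j ne m' f0 g6 jp consts_okD[OF c'] by (auto intro!: exI[of _ 0])
        qed
      next
        case True
        then obtain i where i: "i < length ws" "good (drop j u) i" "m (x + j + F) = Num (addr i)"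
          using fl by (auto simp: flag_def)
        obtain y where y: "drop j u = H (ws ! i) @ y" "poss (Z (ws ! i)) y"
          using i(2) unfolding good_def by blast
        have pp: "piece R (drop j p)" using p(2) by (rule piece_drop)
        \<comment> \<open>By \<open>piece_prefix_head_iff\<close> the two heads of
          \<open>poss_headed\<close> may be replaced by the complete relation words.\<close>
        have poss_eq: "poss p u \<longleftrightarrow> prefix (drop j p) (ws ! i) \<or> prefix (drop j p) (ws ! pidx i)"
          using poss_headed[OF _ pp y(2)] piece_prefix_head_iff[OF _ pp] ws_in_W pidx[OF i(1)] i(1)
            j(7) y(1) by metis
        have adn: "addr i \<noteq> 0" using T_le_addr[of i] T_pos by simp
        have mi: "m (addr i) = Num (addr (pidx i))" using rec i(1) unfolding records_def by blast
        have mat: "(\<forall>n<length p - j. m (a + j + n) = m (addr l + 3 + n)) \<longleftrightarrow> prefix (drop j p) (ws ! l)"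
          if "l < length ws" for l
          using match_iff_prefix[OF wp records_word[OF rec that]] by simp
        have kb: "120 \<le> k" using jp j(8) by simp
        let ?g1 = "g'(51 := Num (x + j + F), 52 := Num (addr i), 60 := Num (a + j),
            61 := Num (addr i + 3), 62 := Num (length p - j))"
        have c1: "consts_ok ?g1" using c' by simp
        have "runs match_prog ?g1 m (\<lambda>t g1 m1. m1 = m \<and> same_below 60 ?g1 g1 \<and>
            t \<le> 10 * (length p - j) + 10 \<and>
            g1 65 = Num (if \<forall>n<length p - j. m (a + j + n) = m (addr i + 3 + n) then 1 else 0))"
          by (rule match_prog[OF c1]) simp_all
        then have 1: "runs match_prog ?g1 m (\<lambda>t g1 m1. m1 = m \<and> same_below 60 ?g1 g1 \<and>
            t \<le> 10 * (length p - j) + 10 \<and>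
            g1 65 = Num (if prefix (drop j p) (ws ! i) then 1 else 0))"
          unfolding mat[OF i(1)] .
        have 2: "runs match_prog ?g1 m (\<lambda>t1 g1 m1. runs (Ins (Copy 49 65) ;;
          Cond 65 0
           (Ins (Load 53 52) ;; Ins (Copy 60 46) ;; Ins (Add 61 53 3) ;; Ins (Copy 62 47) ;;
            match_prog ;; Ins (Copy 49 65))
           (Ins (Copy 63 63)) ;;
          Ins (Copy 50 0)) g1 m1 (\<lambda>t2 g2 m2. \<exists>n'. I n' g2 m2 \<and> t1 + t2 + 11 + n' \<le> k))"
          using 1
        proof (rule runs_mono)
          fix t1 g1 m1
          assume *: "m1 = m \<and> same_below 60 ?g1 g1 \<and> t1 \<le> 10 * (length p - j) + 10 \<and>
            g1 65 = Num (if prefix (drop j p) (ws ! i) then 1 else 0)"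
          then have sb1: "same_below 60 ?g1 g1" and m1: "m1 = m" by auto
          have c2: "consts_ok g1" using same_below_consts[OF sb1] c1 by simp
          have sb2: "same_below 46 g g1"
            using sb sb1 unfolding same_below_def by auto
          have gs: "g1 52 = Num (addr i)" "g1 46 = Num (a + j)" "g1 47 = Num (length p - j)"
            using same_belowD[OF sb1] j by auto
          show "runs (Ins (Copy 49 65) ;;
          Cond 65 0
           (Ins (Load 53 52) ;; Ins (Copy 60 46) ;; Ins (Add 61 53 3) ;; Ins (Copy 62 47) ;;
            match_prog ;; Ins (Copy 49 65))
           (Ins (Copy 63 63)) ;;
          Ins (Copy 50 0)) g1 m1 (\<lambda>t2 g2 m2. \<exists>n'. I n' g2 m2 \<and> t1 + t2 + 11 + n' \<le> k)"
          proof (cases "prefix (drop j p) (ws ! i)")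
            case True
            have "I 0 (g1(49 := Num 1, 63 := g1 63, 50 := Num 0)) m"
              unfolding I_def using sb2 True poss_eq by auto
            then show ?thesis using * True kb j(8) consts_okD[OF c2] by (auto intro!: exI[of _ 0])
          next
            case False
            let ?g2 = "g1(49 := Num 0, 53 := Num (addr (pidx i)), 60 := Num (a + j),
                61 := Num (addr (pidx i) + 3), 62 := Num (length p - j))"
            have c3: "consts_ok ?g2" using c2 by simp
            have "runs match_prog ?g2 m (\<lambda>t g2 m2. m2 = m \<and> same_below 60 ?g2 g2 \<and>
                t \<le> 10 * (length p - j) + 10 \<and> g2 65 = Num (if \<forall>n<length p - j.
                  m (a + j + n) = m (addr (pidx i) + 3 + n) then 1 else 0))"
              by (rule match_prog[OF c3]) simp_all
            then have "runs match_prog ?g2 m (\<lambda>t2 g2 m2.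
                \<exists>n'. I n' (g2(49 := g2 65, 50 := g2 0)) m2 \<and> t1 + t2 + 30 + n' \<le> k)"
            proof (rule runs_mono, goal_cases)
              case (1 t2 g2 m2)
              then have sb3: "same_below 60 ?g2 g2" by simp
              have "g2 0 = Num 0" using same_belowD[OF sb3, of 0] consts_okD(1)[OF c2] by simp
              moreover have "g2 65 = Num (if poss p u then 1 else 0)"
                using 1 mat[of "pidx i"] pidx[OF i(1)] poss_eq False by simp
              moreover have "same_below 46 g g2" using sb2 sb3 unfolding same_below_def by auto
              ultimately have "I 0 (g2(49 := g2 65, 50 := g2 0)) m2" unfolding I_def using 1 by simp
              moreover have "t1 + t2 + 30 + 0 \<le> k" using * 1 jp j(8) by simp
              ultimately show ?case by blast
            qed
            then show ?thesis using False * gs mi consts_okD[OF c2]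
              by (auto elim!: runs_mono)
          qed
        qed
        show ?thesis using 2 j m' i adn g6 jp consts_okD[OF c']
          by (auto elim!: runs_mono)
      qed
    qed
  qed
  have init: "I (40 * length p + 80) (g(50 := Num 1)) m"
    unfolding I_def using g by (auto intro!: exI[of _ 0])
  have "runs (While 50 0 poss_body) (g(50 := Num 1)) m
      (\<lambda>t g' m'. g' 50 = g' 0 \<and> (\<exists>n'. I n' g' m' \<and> t + n' \<le> 40 * length p + 80 + 1))"
    by (rule runs_While[where I = I, OF init body])
  then show ?thesis
    unfolding poss_prog_def runs_Seq runs_basic consts_okD(2)[OF c]
  proof (rule runs_mono, goal_cases)
    case (1 t g' m')
    then obtain n' where i: "I n' g' m'" and t: "t + n' \<le> 40 * length p + 81" by auto
    have sb: "same_below 46 g g'" using i by (auto simp: I_def)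
    have "g' 0 = Num 0" using same_belowD[OF sb, of 0] consts_okD(1)[OF c] by simp
    then show ?case using i t 1 by (auto simp: I_def)
  qed
qed

lemma records_fields:
  assumes "records zl m" "i < length ws"
  shows "m (addr i) = Num (addr (pidx i))" "m (addr i + 1) = Num (zl i)"
    "m (Suc (addr i)) = Num (zl i)"
    "m (addr i + 2) = Num (length (ws ! i))" "m (Suc (Suc (addr i))) = Num (length (ws ! i))"
  using assms unfolding records_def by auto

text \<open>Heads are non-empty, so only the flags of proper suffixes are consulted; therefore the
  table can be filled from right to left. One new flag takes a single pass over the relation words,
  with time linear in the length of each.\<close>

lemma flag_prog:
  fixes g m :: "'a regs"
  assumes c: "consts_ok g" and g: "g 4 = Num T" "g 5 = Num TE" "g 6 = Num F" "g 7 = Num x"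
    and rec: "records zlen m" and u: "text_at m x u" "\<And>k. flag (drop (Suc k) u) (m (x + F + Suc k))"
  shows "runs flag_prog g m (\<lambda>t g' m'. m' = m \<and> same_below 40 g g' \<and> t \<le> 100 * (TE - T) + 10 \<and>
    flag u (g' 40))"
proof -
  define I :: "nat \<Rightarrow> 'a regs \<Rightarrow> 'a regs \<Rightarrow> bool" where
    "I = (\<lambda>k g' m'. m' = m \<and> same_below 40 g g' \<and>
      (\<exists>i\<le>length ws. g' 41 = Num (addr i) \<and> k = 100 * (TE - addr i) \<and>
         ((g' 40 = Num 0 \<and> (\<forall>j<i. \<not> good u j)) \<or> (\<exists>j<i. good u j \<and> g' 40 = Num (addr j)))))"
  have body: "runs flag_body g' m' (\<lambda>t g2 m2. \<exists>n'. I n' g2 m2 \<and> t + 2 + n' \<le> k)"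
    if inv: "I k g' m'" and ne: "g' 41 \<noteq> g' 5" for k g' m'
  proof -
    note [simp] = flag_body_def
    have sb: "same_below 40 g g'" and m': "m' = m" using inv by (auto simp: I_def)
    have c': "consts_ok g'" using same_below_consts[OF sb] c by simp
    have g6: "g' 6 = Num F" "g' 7 = Num x" "g' 5 = Num TE" using same_belowD[OF sb] g by auto
    obtain i where i0: "i \<le> length ws" "g' 41 = Num (addr i)" "k = 100 * (TE - addr i)"
      "(g' 40 = Num 0 \<and> (\<forall>j<i. \<not> good u j)) \<or> (\<exists>j<i. good u j \<and> g' 40 = Num (addr j))"
      using inv by (auto simp: I_def)
    have i: "i < length ws" using i0(1,2) ne g6 by (metis le_neq_implies_less)
    let ?w = "ws ! i" and ?h = "length (ws ! i) - zlen i"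
    have lh: "length (H ?w) = ?h" by (rule length_H)
    have f: "m (Suc (addr i)) = Num (zlen i)" "m (Suc (Suc (addr i))) = Num (length ?w)"
      using records_fields[OF rec i] by auto
    have kk: "100 * (TE - addr (Suc i)) + 100 * (length ?w + 3) \<le> k"
      using addr_Suc[OF i] record_end[OF i] i0(3) by simp
    let ?g1 = "g'(42 := Num (zlen i), 43 := Num (length ?w), 44 := Num (addr i + 3), 45 := Num ?h,
      60 := Num (addr i + 3), 61 := Num x, 62 := Num ?h)"
    have c1: "consts_ok ?g1" using c' by simp
    have pos: "(\<forall>n<?h. m (addr i + 3 + n) = m (x + n)) \<longleftrightarrow> prefix (H ?w) u"
      using match_iff_prefix[OF records_head_tail(1)[OF rec i]] u(1) lh
      unfolding text_at_def by auto
    have advance: "I (100 * (TE - addr (Suc i))) (g2(41 := Num (addr (Suc i)))) m"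
      if "same_below 40 g g2" "g2 40 = (if good u i then Num (addr i) else g' 40)" for g2
    proof -
      have "(\<exists>j<Suc i. good u j \<and> g2 40 = Num (addr j)) \<or>
          (g2 40 = Num 0 \<and> (\<forall>j<Suc i. \<not> good u j))"
      proof (cases "good u i")
        case True
        then show ?thesis using that(2) by auto
      next
        case False
        then show ?thesis using that(2) i0(4) by (auto simp: less_Suc_eq)
      qed
      then show ?thesis unfolding I_def
        by (intro conjI exI[of _ "Suc i"]) (use that(1) i in auto)
    qed
    have "runs match_prog ?g1 m (\<lambda>t g1 m1. m1 = m \<and> same_below 60 ?g1 g1 \<and> t \<le> 10 * ?h + 10 \<and>
        g1 65 = Num (if \<forall>n<?h. m (addr i + 3 + n) = m (x + n) then 1 else 0))"
      by (rule match_prog[OF c1]) simp_all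
    then have "runs match_prog ?g1 m (\<lambda>t1 g1 m1. runs (Cond 65 1
       (Ins (Add 46 44 45) ;; Ins (Copy 47 42) ;; Ins (Add 48 7 45) ;; poss_prog ;;
        Cond 49 1 (Ins (Copy 40 41)) (Ins (Copy 63 63)))
       (Ins (Copy 63 63))) g1 m1 (\<lambda>t2 g2 m2. m2 = m \<and> t1 + t2 \<le> 50 * length ?w + 150 \<and>
          same_below 40 g g2 \<and> g2 43 = Num (length ?w) \<and> g2 44 = Num (addr i + 3) \<and>
          g2 40 = (if good u i then Num (addr i) else g' 40)))"
      unfolding pos
    proof (rule runs_mono, goal_cases)
      case (1 t1 g1 m1)
      then have sb1: "same_below 60 ?g1 g1" and m1: "m1 = m" and t1: "t1 \<le> 10 * ?h + 10"
        and g65: "g1 65 = Num (if prefix (H ?w) u then 1 else 0)" by auto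
      have c2: "consts_ok g1" using same_below_consts[OF sb1] c1 by simp
      have sb2: "same_below 40 g g1" using sb sb1 unfolding same_below_def by auto
      have gs: "g1 40 = g' 40" "g1 41 = Num (addr i)" "g1 42 = Num (zlen i)"
        "g1 43 = Num (length ?w)" "g1 44 = Num (addr i + 3)" "g1 45 = Num ?h" "g1 7 = Num x"
        "g1 6 = Num F"
        using same_belowD[OF sb1] i0 g6 by auto
      show ?case
      proof (cases "prefix (H ?w) u")
        case False
        then have "\<not> good u i" by (auto simp: good_def)
        then show ?thesis using False g65 consts_okD[OF c2] m1 t1 sb2 gs by auto
      next
        case True
        then obtain y where y: "u = H ?w @ y" by (auto simp: prefix_def)
        have hpos: "0 < ?h" using H_not_Nil[OF ws_in_W[OF i]] lh by (metis length_greater_0_conv)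
        have dy: "drop ?h u = y" "?h \<le> length u" using y lh by auto
        have ty: "text_at m (x + ?h) y" using text_at_drop[OF u(1) dy(2)] dy(1) by simp
        have fy: "flags m (x + ?h) y"
          unfolding flags_def
        proof
          fix k
          have pos: "flag (drop n u) (m (x + F + n))" if "0 < n" for n
            using u(2)[of "n - 1"] that by simp
          have "flag (drop (?h + k) u) (m (x + F + (?h + k)))" by (rule pos) (use hpos in simp)
          moreover have "drop k y = drop (?h + k) u"
            unfolding dy(1)[symmetric] drop_drop by (simp only: add.commute)
          moreover have "x + ?h + F + k = x + F + (?h + k)" by (simp only: ac_simps)
          ultimately show "flag (drop k y) (m (x + ?h + F + k))" by (simp only:)
        qed
        have gi: "good u i \<longleftrightarrow> poss (Z ?w) y" using y by (auto simp: good_def)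
        let ?g2 = "g1(46 := Num (addr i + 3 + ?h), 47 := Num (zlen i), 48 := Num (x + ?h))"
        have c3: "consts_ok ?g2" using c2 by simp
        have "runs poss_prog ?g2 m (\<lambda>t g2 m2. m2 = m \<and> same_below 46 ?g2 g2 \<and>
            t \<le> 40 * length (Z ?w) + 100 \<and> g2 49 = Num (if poss (Z ?w) y then 1 else 0))"
          by (rule poss_prog[OF c3, where a = "addr i + 3 + ?h" and x = "x + ?h"])
            (use records_head_tail(2)[OF rec i] lh rec ty fy gs in \<open>simp_all add: zlen_def piece_Z\<close>)
        then have "runs poss_prog ?g2 m (\<lambda>t2 g2 m2. runs
            (Cond 49 1 (Ins (Copy 40 41)) (Ins (Copy 63 63))) g2 m2 (\<lambda>t3 g3 m3. m3 = m \<and>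
              t1 + t2 + t3 + 10 \<le> 50 * length ?w + 150 \<and>
          same_below 40 g g3 \<and> g3 43 = Num (length ?w) \<and> g3 44 = Num (addr i + 3) \<and>
          g3 40 = (if good u i then Num (addr i) else g' 40)))"
        proof (rule runs_mono, goal_cases)
          case (1 t2 g2 m2)
          then have sb3: "same_below 46 ?g2 g2" by simp
          have sb4: "same_below 40 g g2" using sb2 sb3 unfolding same_below_def by auto
          have gs3: "g2 43 = Num (length ?w)" "g2 44 = Num (addr i + 3)" "g2 41 = Num (addr i)"
            "g2 40 = g' 40" "g2 1 = Num 1" "g2 (Suc 0) = Num 1"
            using same_belowD[OF sb3] gs consts_okD[OF c2] by auto
          have "length (Z ?w) = zlen i" by (simp add: zlen_def)
          then have "t2 \<le> 40 * zlen i + 100" using 1 by simp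
          then have "t1 + t2 + 20 \<le> 50 * length ?w + 150" using t1 zlen_le[of i] by linarith
          then show ?case using 1 sb4 gs3 gi by simp
        qed
        then show ?thesis using True g65 gs m1 consts_okD[OF c2] by (auto elim!: runs_mono)
      qed
    qed
    then have main: "runs match_prog ?g1 m (\<lambda>t1 g1 m1. runs (Cond 65 1
       (Ins (Add 46 44 45) ;; Ins (Copy 47 42) ;; Ins (Add 48 7 45) ;; poss_prog ;;
        Cond 49 1 (Ins (Copy 40 41)) (Ins (Copy 63 63)))
       (Ins (Copy 63 63)) ;; Ins (Add 41 44 43)) g1 m1
       (\<lambda>t2 g2 m2. \<exists>n'. I n' g2 m2 \<and> 10 + (t1 + t2) + 2 + n' \<le> k))"
    proof (rule runs_mono, goal_cases)
      case (1 t1 g1 m1)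
      then show ?case unfolding runs_Seq
      proof (rule runs_mono, goal_cases)
        case (1 t2 g2 m2)
        then have "I (100 * (TE - addr (Suc i))) (g2(41 := Num (addr (Suc i)))) m"
          using advance by blast
        moreover have "10 + (t1 + (t2 + 1)) + 2 + 100 * (TE - addr (Suc i)) \<le> k" using 1 kk by simp
        moreover have "addr i + 3 + length ?w = addr (Suc i)" using addr_Suc[OF i] by simp
        ultimately show ?case using 1 by auto
      qed
    qed
    show ?thesis using main i0(2) m' f consts_okD[OF c'] g6
      by (auto elim!: runs_mono) (rule exI, rule conjI, assumption, simp)+
  qed
  have init: "I (100 * (TE - T)) (g(40 := Num 0, 41 := Num T)) m"
    unfolding I_def using addr_0 by (auto intro!: exI[of _ 0])
  have "runs (While 41 5 flag_body) (g(40 := Num 0, 41 := Num T)) m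
      (\<lambda>t g' m'. g' 41 = g' 5 \<and> (\<exists>n'. I n' g' m' \<and> t + n' \<le> 100 * (TE - T) + 1))"
    by (rule runs_While[where I = I, OF init body])
  then have "runs flag_prog g m
      (\<lambda>t g' m'. g' 41 = g' 5 \<and> (\<exists>n'. I n' g' m' \<and> t + n' \<le> 100 * (TE - T) + 3))"
    unfolding flag_prog_def using g consts_okD[OF c] by (auto elim!: runs_mono)
  then show ?thesis
  proof (rule runs_mono, goal_cases)
    case (1 t g' m')
    then obtain n' where ii: "I n' g' m'" and t: "t + n' \<le> 100 * (TE - T) + 3" by auto
    have sb: "same_below 40 g g'" and m': "m' = m" using ii by (auto simp: I_def)
    obtain i where i: "i \<le> length ws" "g' 41 = Num (addr i)"
      "(g' 40 = Num 0 \<and> (\<forall>j<i. \<not> good u j)) \<or> (\<exists>j<i. good u j \<and> g' 40 = Num (addr j))"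
      using ii by (auto simp: I_def)
    have "addr i = TE" using i(2) 1 same_belowD[OF sb, of 5] g by simp
    then have "i = length ws" using i(1) addr_Suc[of i] record_end[of i] by fastforce
    then have "flag u (g' 40)" using i(3) act_iff_good by (auto simp: flag_def)
    then show ?case using sb m' t by simp
  qed
qed

text \<open>The word with its table of flags, which lies \<open>F\<close> cells further on. The word ends at
  \<open>ue\<close> and is extended to the left.\<close>

definition stack_at :: "'a regs \<Rightarrow> nat \<Rightarrow> 'a list \<Rightarrow> bool" where
  "stack_at m x u \<longleftrightarrow> text_at m x u \<and> flags m x u \<and> x + length u = ue"

lemma flags_Cons:
  assumes "flag (a # u) (m (x + F))" "flags m (Suc x) u"
  shows "flags m x (a # u)"
  unfolding flags_def
proof
  fix k
  show "flag (drop k (a # u)) (m (x + F + k))"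
    using assms by (cases k) (auto simp: flags_def)
qed

text \<open>Flags depend on suffixes only, so those of \<open>u\<close> remain valid and just the
  new letters, added from right to left, require a pass over the table each.\<close>

lemma prepend_prog:
  fixes g m :: "'a regs"
  assumes c: "consts_ok g" and g: "g 4 = Num T" "g 5 = Num TE" "g 6 = Num F" "g 7 = Num x"
    "g 30 = Num (a + length p)" "g 31 = Num (length p)"
    and rec: "records zlen m" and u: "stack_at m x u" and p: "word_at m a p"
    and le: "S + length p \<le> x" "a + length p \<le> S"
  shows "runs prepend_prog g m (\<lambda>t g' m'. (\<forall>y<S. m' y = m y) \<and> records zlen m' \<and>
    (\<forall>r<30. r \<noteq> 7 \<longrightarrow> g' r = g r) \<and> g' 7 = Num (x - length p) \<and> stack_at m' (x - length p) (p @ u) \<and>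
    t \<le> length p * (100 * (TE - T) + 30) + 10)"
proof -
  let ?n = "length p" and ?c = "100 * (TE - T) + 30"
  define I :: "nat \<Rightarrow> 'a regs \<Rightarrow> 'a regs \<Rightarrow> bool" where
    "I = (\<lambda>k g' m'. (\<forall>y<S. m' y = m y) \<and> (\<forall>r<30. r \<noteq> 7 \<longrightarrow> g' r = g r) \<and>
      (\<exists>j\<le>?n. g' 31 = Num j \<and> g' 30 = Num (a + j) \<and> g' 7 = Num (x - (?n - j)) \<and> k = j * ?c \<and>
         stack_at m' (x - (?n - j)) (drop j p @ u)))"
  have body: "runs prepend_body g' m'
      (\<lambda>t g2 m2. \<exists>n'. I n' g2 m2 \<and> t + 2 + n' \<le> k)"
    if inv: "I k g' m'" and ne: "g' 31 \<noteq> g' 0" for k g' m'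
  proof -
    note [simp] = prepend_body_def
    have mS: "\<forall>y<S. m' y = m y" and fr: "\<forall>r<30. r \<noteq> 7 \<longrightarrow> g' r = g r"
      using inv by (auto simp: I_def)
    have c': "consts_ok g'" using fr c by (simp add: consts_ok_def)
    obtain j where j: "j \<le> ?n" "g' 31 = Num j" "g' 30 = Num (a + j)" "g' 7 = Num (x - (?n - j))"
      "k = j * ?c" "stack_at m' (x - (?n - j)) (drop j p @ u)"
      using inv by (auto simp: I_def)
    have "j \<noteq> 0" using j(2) ne consts_okD(1)[OF c'] by auto
    then obtain i where i: "j = Suc i" by (cases j) auto
    define y where "y = x - (?n - i)"
    have y: "x - (?n - j) = Suc y" "S \<le> y" using j(1) le(1) i unfolding y_def by auto
    let ?v = "drop j p @ u"
    have st: "stack_at m' (Suc y) ?v" using j(6) y(1) by simp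
    have dp: "drop i p @ u = p ! i # ?v" using i j(1) by (metis Cons_nth_drop_Suc Suc_le_eq append_Cons)
    have yue: "Suc y + length ?v = ue" using st by (simp add: stack_at_def)
    have "a + i < S" using le(2) j(1) i by simp
    then have ma: "m' (a + i) = Gen (p ! i)" using mS p j(1) i by (simp add: word_at_def)
    let ?m1 = "m'(y := Gen (p ! i))"
    let ?g1 = "g'(30 := Num (a + i), 7 := Num y, 32 := Gen (p ! i))"
    have mS1: "\<forall>z<S. ?m1 z = m z" using mS y(2) by simp
    have rec1: "records zlen ?m1"
      by (rule records_cong[OF rec]) (use mS1 TE_less_S in simp)
    have w1: "word_at ?m1 (Suc y) ?v"
      using st word_at_cong[of ?v ?m1 "Suc y" m'] by (simp add: stack_at_def text_at_def)
    have n1: "is_num (?m1 ue)" using st yue by (auto simp: stack_at_def text_at_def)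
    have tv: "text_at ?m1 y (p ! i # ?v)"
      using w1 n1 yue by (simp add: text_at_def word_at_Cons)
    have fv: "flag (drop (Suc n) (p ! i # ?v)) (?m1 (y + F + Suc n))" for n
    proof -
      have "y + F + Suc n \<noteq> y" by simp
      moreover have "flag (drop n ?v) (m' (Suc y + F + n))"
        using st unfolding stack_at_def flags_def by blast
      ultimately show ?thesis by simp
    qed
    have c1: "consts_ok ?g1" using c' by simp
    have "runs flag_prog ?g1 ?m1 (\<lambda>t g2 m2. m2 = ?m1 \<and> same_below 40 ?g1 g2 \<and>
        t \<le> 100 * (TE - T) + 10 \<and> flag (p ! i # ?v) (g2 40))"
      by (rule flag_prog[OF c1 _ _ _ _ rec1 tv fv]) (use fr g in simp_all)
    then have "runs flag_prog ?g1 ?m1 (\<lambda>t1 g1 m1. runs (Ins (Add 33 7 6) ;; Ins (Store 33 40) ;;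
        Ins (Sub 31 31 1)) g1 m1 (\<lambda>t2 g2 m2. \<exists>n'. I n' g2 m2 \<and> 4 + (t1 + t2) + 2 + n' \<le> k))"
    proof (rule runs_mono, goal_cases)
      case (1 t g2 m2)
      then have m2: "m2 = ?m1" and sb: "same_below 40 ?g1 g2" and t: "t \<le> 100 * (TE - T) + 10"
        and fl: "flag (p ! i # ?v) (g2 40)" by auto
      have gs: "g2 7 = Num y" "g2 6 = Num F" "g2 31 = Num (Suc i)" "g2 1 = Num 1"
        "g2 (Suc 0) = Num 1" "g2 30 = Num (a + i)"
        using same_belowD[OF sb] j(2) i fr g consts_okD[OF c'] by auto
      let ?m3 = "?m1(y + F := g2 40)"
      \<comment> \<open>The new flag is stored behind the end marker and hence damages neither the
        word nor the marker.\<close>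
      have yF: "ue < y + F" using y(2) F by simp
      have "\<forall>z<S. ?m3 z = m z" using mS1 yF y(2) yue by auto
      moreover have "stack_at ?m3 y (p ! i # ?v)"
      proof -
        have "text_at ?m3 y (p ! i # ?v)"
        proof -
          have "word_at ?m3 y (p ! i # ?v)"
            using tv word_at_cong[of "p ! i # ?v" ?m3 y ?m1] yF yue by (simp add: text_at_def)
          moreover have "is_num (?m3 ue)" using n1 yF by simp
          ultimately show ?thesis unfolding text_at_def using yue by (metis add_Suc_shift length_Cons)
        qed
        moreover have "flags ?m3 y (p ! i # ?v)"
        proof (rule flags_Cons)
          show "flag (p ! i # ?v) (?m3 (y + F))" using fl by simp
          show "flags ?m3 (Suc y) ?v"
            using st fv unfolding flags_def stack_at_def by simp
        qed
        ultimately show ?thesis using yue by (simp add: stack_at_def)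
      qed
      moreover have "\<forall>r<30. r \<noteq> 7 \<longrightarrow> g2 r = g r" using sb fr unfolding same_below_def by auto
      ultimately have "I (i * ?c) (g2(33 := Num (y + F), 31 := Num i)) ?m3"
        unfolding I_def using i j(1) gs dp y_def by (auto intro!: exI[of _ i])
      moreover have "4 + (t + 3) + 2 + i * ?c \<le> k" using j(5) i t by simp
      ultimately show ?case using gs m2 by auto
    qed
    moreover have "x - (?n - j) - 1 = y" using y(1) by simp
    ultimately show ?thesis using j ma i consts_okD[OF c'] by (auto elim!: runs_mono)
  qed
  have init: "I (?n * ?c) g m" unfolding I_def using g u by auto
  have "runs prepend_prog g m
      (\<lambda>t g' m'. g' 31 = g' 0 \<and> (\<exists>n'. I n' g' m' \<and> t + n' \<le> ?n * ?c + 1))"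
    unfolding prepend_prog_def by (rule runs_While[where I = I, OF init body])
  then show ?thesis
  proof (rule runs_mono, goal_cases)
    case (1 t g' m')
    then obtain n' where ii: "I n' g' m'" and t: "t + n' \<le> ?n * ?c + 1" by auto
    have mS: "\<forall>y<S. m' y = m y" and fr: "\<forall>r<30. r \<noteq> 7 \<longrightarrow> g' r = g r"
      using ii by (auto simp: I_def)
    have "g' 0 = Num 0" using fr c by (simp add: consts_ok_def)
    then have "g' 7 = Num (x - ?n)" "stack_at m' (x - ?n) (p @ u)"
      using ii 1 by (auto simp: I_def)
    moreover have "records zlen m'" by (rule records_cong[OF rec]) (use mS TE_less_S in simp)
    ultimately show ?case using mS fr t by simp
  qed
qed

end

section \<open>The main loop\<close>

definition fail_prog :: com where
  "fail_prog = Ins (Copy 2 0) ;; Ins (Copy 11 0)"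

definition scan_body :: com where
  "scan_body =
    Cond 25 16
    (Ins (Copy 27 0))
    (Ins (Add 28 26 25) ;; Ins (Load 29 28) ;;
     Cond 29 0 (Ins (Add 25 25 1)) (Ins (Copy 27 0)))"

definition scan_prog :: com where
  "scan_prog =
    Ins (Copy 25 0) ;; Ins (Add 26 7 6) ;; Ins (Copy 27 1) ;;
    While 27 0 scan_body"

definition replace_prog :: com where
  "replace_prog = Ins (Add 7 7 16) ;; Ins (Add 30 24 21) ;; Ins (Copy 31 21) ;; prepend_prog"

text \<open>If an active suffix was found at \<open>k < zlen i\<close>, cancelling the head
  suffices, by \<open>equiv_active_same\<close>. Otherwise \<open>equiv_inactive_same\<close>
  applies, and in both words \<open>Z r\<close> gives way to \<open>Z r'\<close>.\<close>

definition same_prog :: com where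
  "same_prog =
    Cond 25 16
     (Ins (Copy 60 19) ;; Ins (Copy 61 9) ;; Ins (Copy 62 16) ;; match_prog ;;
      Cond 65 1
       (Ins (Add 9 9 16) ;; Ins (Sub 9 9 21) ;;
        Ins (Copy 60 24) ;; Ins (Copy 61 9) ;; Ins (Copy 62 21) ;; copy_prog ;;
        replace_prog)
       fail_prog)
     (Ins (Copy 63 63))"

text \<open>Carries out \<open>equiv_active_other\<close>. Register 26 receives the length of
  \<open>drop k (Z r)\<close> and register 27 the length of what precedes it in \<open>Z r'\<close>;
  by truncated subtraction register 28 is 0 iff that suffix is not longer than
  \<open>Z r'\<close>.\<close>

definition suffix_prog :: com where
  "suffix_prog =
    Ins (Sub 26 16 25) ;; Ins (Sub 28 26 21) ;; Ins (Sub 27 21 26) ;;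
    Cond 28 0
     (Ins (Add 60 19 25) ;; Ins (Add 61 24 27) ;; Ins (Copy 62 26) ;; match_prog ;;
      Cond 65 1
       (Ins (Copy 60 24) ;; Ins (Copy 61 9) ;; Ins (Copy 62 27) ;; match_prog ;;
        Cond 65 1 (Ins (Add 7 7 25) ;; Ins (Add 9 9 27)) fail_prog)
       fail_prog)
     fail_prog"

text \<open>The three outcomes follow \<open>equiv_inactive_other\<close>,
  \<open>equiv_active_other_literal\<close> and \<open>equiv_active_other\<close>.\<close>

definition other_prog :: com where
  "other_prog =
    Cond 25 16
     replace_prog
     (Ins (Copy 60 24) ;; Ins (Copy 61 9) ;; Ins (Copy 62 21) ;; match_prog ;;
      Cond 65 1
       (Ins (Add 9 9 21) ;; Ins (Sub 9 9 16) ;;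
        Ins (Copy 60 19) ;; Ins (Copy 61 9) ;; Ins (Copy 62 16) ;; copy_prog)
       suffix_prog)"

text \<open>By \<open>M \<le> L\<close> a tail written to the left of an address that is at least
  \<open>L\<close> does not fall below address 0; \<open>room\<close> likewise keeps the shorter
  word, with a tail in front, above \<open>S\<close>.\<close>

locale main_machine = word_machine R ws pidx T S ue F
  for R :: "'a relations" and ws pidx T S ue F +
  fixes N M L ve :: nat
  assumes word_length: "w \<in> set ws \<Longrightarrow> length w \<le> M"
    and M_le_L: "M \<le> L" and room: "S + M + N \<le> ue" and ve_less_T: "ve < T"
begin

definition regs_ok :: "'a regs \<Rightarrow> bool" where
  "regs_ok g \<longleftrightarrow> consts_ok g \<and> g 4 = Num T \<and> g 5 = Num TE \<and> g 6 = Num F \<and> g 8 = Num ue \<and>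
    g 10 = Num ve"

definition mem_ok :: "'a regs \<Rightarrow> bool" where
  "mem_ok m \<longleftrightarrow> records zlen m \<and> is_num (m ve)"

lemma regs_ok_frame:
  assumes "regs_ok g" "\<And>r. r \<in> {0, 1, 3, 4, 5, 6, 8, 10} \<Longrightarrow> g' r = g r"
  shows "regs_ok g'"
  using assms by (simp add: regs_ok_def consts_ok_def)

lemma regs_ok_same_below: "regs_ok g \<Longrightarrow> same_below k g g' \<Longrightarrow> 11 \<le> k \<Longrightarrow> regs_ok g'"
  by (erule regs_ok_frame) (auto simp: same_below_def)

lemma regs_ok_upd [simp]:
  "11 \<le> r \<or> r = 2 \<or> r = 7 \<or> r = 9 \<Longrightarrow> regs_ok (g(r := x)) \<longleftrightarrow> regs_ok g"
  by (auto simp: regs_ok_def consts_ok_def)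

lemma regs_okD:
  assumes "regs_ok g"
  shows "consts_ok g" "g 0 = Num 0" "g 1 = Num 1" "g (Suc 0) = Num 1" "g 3 = Num 3" "g 4 = Num T"
    "g 5 = Num TE" "g 6 = Num F" "g 8 = Num ue" "g 10 = Num ve"
  using assms by (auto simp: regs_ok_def consts_ok_def)

text \<open>A step puts up to \<open>M\<close> letters in front, each with a pass over the table.
  The remaining part covers matching, scanning and copying, and prepays the later stripping of those
  letters.\<close>

definition step_cost :: nat where
  "step_cost = (M + 1) * (100 * (TE - T) + 300)"

text \<open>Both words are a piece followed by a suffix of the corresponding input word. Every letter of
  the suffix of the shorter word pays for a step that applies a relation, every letter of the piece
  for stripping it. The bound \<open>L\<close> leaves room for pieces to be written over the memory
  to the left of the longer word.\<close>

definition live :: "nat \<Rightarrow> bool \<Rightarrow> 'a regs \<Rightarrow> 'a regs \<Rightarrow> bool" where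
  "live k ans g m \<longleftrightarrow> regs_ok g \<and> mem_ok m \<and> g 11 = Num 1 \<and>
    (\<exists>x y q z q' z'. g 7 = Num x \<and> stack_at m x (q @ z) \<and> piece R q \<and> length z \<le> N \<and>
       g 9 = Num y \<and> word_at m y (q' @ z') \<and> y + length (q' @ z') = ve \<and> piece R q' \<and>
       L \<le> y + length q' \<and> step_cost * length z + 20 * length q + 40 \<le> k \<and>
       (ans \<longleftrightarrow> E (q @ z) (q' @ z')))"

definition finished :: "bool \<Rightarrow> 'a regs \<Rightarrow> bool" where
  "finished ans g \<longleftrightarrow> consts_ok g \<and> g 11 = Num 0 \<and> (g 2 = Num 1 \<longleftrightarrow> ans)"

definition outcome :: "nat \<Rightarrow> bool \<Rightarrow> nat \<Rightarrow> 'a regs \<Rightarrow> 'a regs \<Rightarrow> bool" where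
  "outcome k ans t g m \<longleftrightarrow>
    finished ans g \<and> t \<le> k \<or> (\<exists>k'. live k' ans g m \<and> t + k' \<le> k)"

lemma outcome_mono: "outcome k ans t g m \<Longrightarrow> t' + k \<le> k' + t \<Longrightarrow> outcome k' ans t' g m"
  unfolding outcome_def by force

lemma mem_ok_cong:
  assumes "mem_ok m" "m' ve = m ve" "\<And>z. T \<le> z \<Longrightarrow> z \<le> TE \<Longrightarrow> m' z = m z"
  shows "mem_ok m'"
  using assms records_cong[of zlen m m'] unfolding mem_ok_def by auto

lemma stack_at_cong:
  assumes "stack_at m x u" "\<And>z. x \<le> z \<Longrightarrow> m' z = m z"
  shows "stack_at m' x u"
proof -
  have "word_at m' x u = word_at m x u" by (rule word_at_cong) (use assms(2) in simp)
  moreover have "m' (x + length u) = m (x + length u)" using assms(2) by simp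
  moreover have "flags m' x u = flags m x u" unfolding flags_def using assms(2) by simp
  ultimately show ?thesis using assms(1) unfolding stack_at_def text_at_def by auto
qed

lemma stack_at_drop: "stack_at m x u \<Longrightarrow> k \<le> length u \<Longrightarrow> stack_at m (x + k) (drop k u)"
  unfolding stack_at_def using text_at_drop flags_drop by auto

lemma stack_at_append: "stack_at m x (p @ u) \<Longrightarrow> stack_at m (x + length p) u"
  using stack_at_drop[of m x "p @ u" "length p"] by simp

lemma fail_prog:
  assumes "regs_ok g" "\<not> ans"
  shows "runs fail_prog g m (\<lambda>t g' m'. outcome (2 + k) ans t g' m')"
  unfolding fail_prog_def using assms regs_okD[OF assms(1)]
  by (simp add: outcome_def finished_def consts_ok_def)

lemma scan_prog:
  fixes g m :: "'a regs"
  assumes c: "consts_ok g" and g: "g 7 = Num x" "g 6 = Num F" "g 16 = Num n" and u: "stack_at m x u"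
  shows "runs scan_prog g m (\<lambda>t g' m'. m' = m \<and> same_below 25 g g' \<and> t \<le> 10 * n + 20 \<and>
    (\<exists>k\<le>n. g' 25 = Num k \<and> (\<forall>j<k. \<not> act (drop j u)) \<and> (k < n \<longrightarrow> act (drop k u))))"
proof -
  define I :: "nat \<Rightarrow> 'a regs \<Rightarrow> 'a regs \<Rightarrow> bool" where
    "I = (\<lambda>b g' m'. m' = m \<and> same_below 25 g g' \<and> g' 26 = Num (x + F) \<and>
      (\<exists>k\<le>n. g' 25 = Num k \<and> (\<forall>j<k. \<not> act (drop j u)) \<and>
        ((g' 27 = Num 1 \<and> b = 10 * (n - k) + 10) \<or> (g' 27 = Num 0 \<and> (k < n \<longrightarrow> act (drop k u))))))"
  have body: "runs scan_body g' m'
      (\<lambda>t g2 m2. \<exists>n'. I n' g2 m2 \<and> t + 2 + n' \<le> b)"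
    if inv: "I b g' m'" and ne: "g' 27 \<noteq> g' 0" for b g' m'
  proof -
    note [simp] = scan_body_def
    have sb: "same_below 25 g g'" and m': "m' = m" using inv by (auto simp: I_def)
    have c': "consts_ok g'" using same_below_consts[OF sb] c by simp
    obtain k where k: "k \<le> n" "g' 25 = Num k" "\<forall>j<k. \<not> act (drop j u)" "g' 27 = Num 1"
      "b = 10 * (n - k) + 10" "g' 26 = Num (x + F)"
      using inv ne consts_okD(1)[OF c'] by (auto simp: I_def)
    have g16: "g' 16 = Num n" using same_belowD[OF sb] g by simp
    have fl: "flag (drop k u) (m (x + F + k))" using u unfolding stack_at_def flags_def by blast
    show ?thesis
    proof (cases "k = n")
      case True
      then have "I 0 (g'(27 := Num 0)) m" unfolding I_def using sb k by auto
      then show ?thesis using True k m' g16 consts_okD[OF c'] by (auto intro!: exI[of _ 0])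
    next
      case False
      then have kn: "k < n" using k(1) by simp
      show ?thesis
      proof (cases "act (drop k u)")
        case True
        then obtain i where i: "m (x + F + k) = Num (addr i)" using fl by (auto simp: flag_def)
        have "addr i \<noteq> 0" using T_le_addr[of i] T_pos by simp
        moreover have "I 0 (g'(28 := Num (x + F + k), 29 := Num (addr i), 27 := Num 0)) m"
          unfolding I_def using sb k True by auto
        moreover have "20 \<le> b" using k kn by simp
        ultimately show ?thesis using kn k m' g16 i consts_okD[OF c'] by (auto intro!: exI[of _ 0])
      next
        case False
        then have z: "m (x + F + k) = Num 0" using fl by (auto simp: flag_def)
        have "I (10 * (n - Suc k) + 10) (g'(28 := Num (x + F + k), 29 := Num 0, 25 := Num (Suc k))) m"
          unfolding I_def using sb k False kn
          by (intro conjI exI[of _ "Suc k"]) (auto simp: less_Suc_eq)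
        moreover have "9 + (10 * (n - Suc k) + 10) \<le> b" using k kn by simp
        ultimately show ?thesis using kn k m' g16 z consts_okD[OF c'] by auto
      qed
    qed
  qed
  have init: "I (10 * n + 10) (g(25 := Num 0, 26 := Num (x + F), 27 := Num 1)) m"
    unfolding I_def by (intro conjI exI[of _ 0]) auto
  have "runs (While 27 0 scan_body)
      (g(25 := Num 0, 26 := Num (x + F), 27 := Num 1)) m
      (\<lambda>t g' m'. g' 27 = g' 0 \<and> (\<exists>n'. I n' g' m' \<and> t + n' \<le> 10 * n + 10 + 1))"
    by (rule runs_While[where I = I, OF init body])
  then have "runs scan_prog g m
      (\<lambda>t g' m'. g' 27 = g' 0 \<and> (\<exists>n'. I n' g' m' \<and> t + n' \<le> 10 * n + 14))"
    unfolding scan_prog_def using g consts_okD[OF c] by (auto elim!: runs_mono)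
  then show ?thesis
  proof (rule runs_mono, goal_cases)
    case (1 t g' m')
    then obtain n' where ii: "I n' g' m'" and t: "t + n' \<le> 10 * n + 14" by auto
    have sb: "same_below 25 g g'" and m': "m' = m" using ii by (auto simp: I_def)
    have "g' 0 = Num 0" using same_belowD[OF sb, of 0] consts_okD[OF c] by simp
    then have "\<exists>k\<le>n. g' 25 = Num k \<and> (\<forall>j<k. \<not> act (drop j u)) \<and> (k < n \<longrightarrow> act (drop k u))"
      using ii 1 by (auto simp: I_def)
    then show ?case using sb m' t by simp
  qed
qed

section \<open>Steps that apply a relation\<close>

definition rel_regs :: "nat \<Rightarrow> 'a regs \<Rightarrow> bool" where
  "rel_regs i g \<longleftrightarrow> i < length ws \<and>
    g 16 = Num (zlen i) \<and> g 17 = Num (length (H (ws ! i))) \<and> g 18 = Num (addr i + 3) \<and>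
    g 19 = Num (addr i + 3 + length (H (ws ! i))) \<and>
    g 21 = Num (zlen (pidx i)) \<and> g 22 = Num (length (H (ws ! pidx i))) \<and>
    g 23 = Num (addr (pidx i) + 3) \<and>
    g 24 = Num (addr (pidx i) + 3 + length (H (ws ! pidx i)))"

lemma rel_regs_frame:
  "rel_regs i g \<Longrightarrow> (\<And>r. 16 \<le> r \<Longrightarrow> r < 25 \<Longrightarrow> g' r = g r) \<Longrightarrow> rel_regs i g'"
  by (simp add: rel_regs_def)

lemma zlen_le_M: "i < length ws \<Longrightarrow> zlen i \<le> M"
  using zlen_le[of i] word_length[of "ws ! i"] nth_mem[of i ws] by simp

definition prepend_cost :: nat where "prepend_cost = M * (100 * (TE - T) + 30) + 10"

lemma tail_word:
  assumes "mem_ok m" "i < length ws"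
  shows "word_at m (addr i + 3 + length (H (ws ! i))) (Z (ws ! i))"
    "addr i + 3 + length (H (ws ! i)) + zlen i \<le> TE"
proof -
  show "word_at m (addr i + 3 + length (H (ws ! i))) (Z (ws ! i))"
    using assms records_head_tail(2) unfolding mem_ok_def by blast
  show "addr i + 3 + length (H (ws ! i)) + zlen i \<le> TE"
    using record_end[OF assms(2)] length_H[of i] zlen_le[of i] by simp
qed

text \<open>Used in both inactive cases: with \<open>q = Z r'\<close> if the longer word has
  received the new tail too, and with \<open>q = []\<close> if it had the head \<open>H r'\<close>
  from the start.\<close>

lemma replace_prog:
  fixes g m :: "'a regs"
  assumes g: "regs_ok g" "g 11 = Num 1" "rel_regs i g" "g 7 = Num x" "g 9 = Num y"
    and m: "mem_ok m" and u: "stack_at m x (Z (ws ! i) @ u)" "length u \<le> N"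
    and v: "word_at m y (q @ v)" "y + length (q @ v) = ve" "piece R q" "L \<le> y + length q"
    and ans: "ans \<longleftrightarrow> E (Z (ws ! pidx i) @ u) (q @ v)"
  shows "runs replace_prog g m
    (outcome (step_cost * length u + 20 * M + prepend_cost + 43) ans)"
proof -
  have i: "i < length ws" and p: "pidx i < length ws" and gs: "g 16 = Num (zlen i)"
    "g 21 = Num (zlen (pidx i))"
    "g 24 = Num (addr (pidx i) + 3 + length (H (ws ! pidx i)))"
    using g(3) pidx by (auto simp: rel_regs_def)
  let ?p = "Z (ws ! pidx i)" and ?a = "addr (pidx i) + 3 + length (H (ws ! pidx i))"
  have lp: "length ?p = zlen (pidx i)" "length (Z (ws ! i)) = zlen i" by (simp_all add: zlen_def)
  have st: "stack_at m (x + zlen i) u" using stack_at_append[OF u(1)] lp by simp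
  have xe: "x + zlen i + length u = ue" using st by (simp add: stack_at_def)
  have pM: "length ?p \<le> M" using zlen_le_M[OF p] lp by simp
  let ?g1 = "g(7 := Num (x + zlen i), 30 := Num (?a + zlen (pidx i)), 31 := Num (zlen (pidx i)))"
  have rg: "regs_ok ?g1" using g(1) by simp
  note r1 = regs_okD[OF rg]
  have "runs prepend_prog ?g1 m (\<lambda>t g' m'. (\<forall>y<S. m' y = m y) \<and> records zlen m' \<and>
    (\<forall>r<30. r \<noteq> 7 \<longrightarrow> g' r = ?g1 r) \<and> g' 7 = Num (x + zlen i - length ?p) \<and>
    stack_at m' (x + zlen i - length ?p) (?p @ u) \<and>
    t \<le> length ?p * (100 * (TE - T) + 30) + 10)"
    by (rule prepend_prog[OF r1(1) r1(6) r1(7) r1(8), where a = ?a])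
      (use m st tail_word[OF m p] lp pM xe u(2) room TE_less_S in \<open>simp_all add: mem_ok_def\<close>)
  then have "runs prepend_prog ?g1 m
    (\<lambda>t. outcome (step_cost * length u + 20 * M + prepend_cost + 43) ans (Suc (Suc (Suc t))))"
  proof (rule runs_mono, goal_cases)
    case (1 t g' m')
    then have mS: "\<forall>y<S. m' y = m y" and rec: "records zlen m'"
      and fr: "\<forall>r<30. r \<noteq> 7 \<longrightarrow> g' r = ?g1 r" and g7: "g' 7 = Num (x + zlen i - length ?p)"
      and st': "stack_at m' (x + zlen i - length ?p) (?p @ u)"
      and t: "t \<le> length ?p * (100 * (TE - T) + 30) + 10" by auto
    have veS: "ve < S" using ve_less_T T_le_addr[of "length ws"] TE_less_S by simp
    have "mem_ok m'" using rec m mS veS by (simp add: mem_ok_def)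
    moreover have "regs_ok g'" by (rule regs_ok_frame[OF rg]) (use fr in auto)
    moreover have "word_at m' y (q @ v)"
    proof -
      have "m' (y + k) = m (y + k)" if "k < length (q @ v)" for k
        using mS veS v(2) that by simp
      then show ?thesis using v(1) word_at_cong by blast
    qed
    moreover have "g' 9 = Num y" "g' 11 = Num 1" using fr g by auto
    moreover have "20 * length ?p \<le> 20 * M" using pM by simp
    ultimately have "live (step_cost * length u + 20 * M + 40) ans g' m'"
      unfolding live_def using g7 st' piece_Z u(2) v(2-4) ans by fastforce
    moreover have "length ?p * (100 * (TE - T) + 30) \<le> M * (100 * (TE - T) + 30)"
      using pM by (rule mult_le_mono1)
    then have "Suc (Suc (Suc t)) + (step_cost * length u + 20 * M + 40)
        \<le> step_cost * length u + 20 * M + prepend_cost + 43"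
      using t unfolding prepend_cost_def by linarith
    ultimately show ?case unfolding outcome_def by blast
  qed
  then show ?thesis unfolding replace_prog_def using g gs by (auto elim!: runs_mono simp: add.commute)
qed

lemma word_at_overwrite:
  assumes "m' = (\<lambda>x. if b \<le> x \<and> x < b + length p then m (a + (x - b)) else m x)"
    "word_at m a p" "word_at m (b + length p) w"
  shows "word_at m' b (p @ w)"
proof -
  have "word_at m' b p" using assms(1,2) by (simp add: word_at_def)
  moreover have "word_at m' (b + length p) w" using assms(1,3) by (simp add: word_at_def)
  ultimately show ?thesis by (simp add: word_at_append)
qed

lemma ve_less_S: "ve < S"
  using ve_less_T T_le_addr[of "length ws"] TE_less_S by simp

text \<open>Everything written ends at or before \<open>ve\<close>, hence below the table, the
  shorter word and the end marker of the longer word.\<close>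

lemma overwrite_long_word:
  assumes m: "mem_ok m" and u: "stack_at m x u" "S \<le> x"
    and w: "word_at m (b + length p) w" "b + length p + length w = ve"
    and p: "word_at m a p" "T \<le> a"
    and m': "m' = (\<lambda>z. if b \<le> z \<and> z < b + length p then m (a + (z - b)) else m z)"
  shows "mem_ok m'" "stack_at m' x u" "word_at m' b (p @ w)" "b + length p \<le> a"
proof -
  have far: "m' z = m z" if "ve \<le> z" for z using that w(2) m' by simp
  show "mem_ok m'" by (rule mem_ok_cong[OF m]) (use far ve_less_T in auto)
  show "stack_at m' x u" by (rule stack_at_cong[OF u(1)]) (use far ve_less_S u(2) in auto)
  show "word_at m' b (p @ w)" using word_at_overwrite[OF m' p(1) w(1)] .
  show "b + length p \<le> a" using w(2) ve_less_T p(2) by simp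
qed

lemma match_long_word:
  fixes g m :: "'a regs"
  assumes g: "regs_ok g" "g 60 = Num a" "g 61 = Num y" "g 62 = Num (length p)" and m: "mem_ok m"
    and p: "word_at m a p" "length p \<le> M" and v: "word_at m y v" "y + length v = ve"
  shows "runs match_prog g m (\<lambda>t g' m'. m' = m \<and> same_below 60 g g' \<and> t \<le> 10 * M + 10 \<and>
    g' 65 = Num (if prefix p v then 1 else 0))"
proof -
  have "is_num (m (y + length v))" using m v(2) by (simp add: mem_ok_def)
  then have eq: "(\<forall>i<length p. m (a + i) = m (y + i)) \<longleftrightarrow> prefix p v"
    using match_iff_prefix[OF p(1) v(1)] by simp
  show ?thesis
    using match_prog[OF regs_okD(1)[OF g(1)] g(2-4), of m] unfolding eq
    by (rule runs_mono) (use p(2) in auto)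
qed

lemma live_suffixes:
  assumes "regs_ok g" "mem_ok m" "g 11 = Num 1" "g 7 = Num x" "stack_at m x u" "length u \<le> N"
    "g 9 = Num y" "word_at m y v" "y + length v = ve" "L \<le> y" "ans \<longleftrightarrow> E u v"
  shows "live (step_cost * length u + 40) ans g m"
proof -
  have "stack_at m x ([] @ u)" "piece R ([] :: 'a list)" "word_at m y ([] @ v)"
    "y + length ([] @ v) = ve" "L \<le> y + length ([] :: 'a list)" "ans \<longleftrightarrow> E ([] @ u) ([] @ v)"
    "step_cost * length u + 20 * length ([] :: 'a list) + 40 \<le> step_cost * length u + 40"
    using assms by auto
  then show ?thesis unfolding live_def using assms(1-4,6,7) by blast
qed

definition rest_cost :: nat where "rest_cost = prepend_cost + 80 * M + 200"

lemma same_prog: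
  fixes g m :: "'a regs"
  assumes g: "regs_ok g" "g 11 = Num 1" "rel_regs i g" "g 25 = Num k" "g 7 = Num x" "g 9 = Num y"
    and m: "mem_ok m" and u: "stack_at m x u" "length u \<le> N" "poss (Z (ws ! i)) u"
    and k: "k \<le> zlen i" "\<forall>j<k. \<not> act (drop j u)" "k < zlen i \<longrightarrow> act (drop k u)"
    and v: "word_at m y v" "y + length v = ve" "L \<le> y"
  shows "runs same_prog g m (outcome (step_cost * length u + rest_cost)
    (E (H (ws ! i) @ u) (H (ws ! i) @ v)))"
proof -
  let ?r = "ws ! i" and ?r' = "ws ! pidx i"
  let ?ans = "E (H ?r @ u) (H ?r @ v)"
  have i: "i < length ws" using g(3) by (simp add: rel_regs_def)
  have pr: "partner R ?r ?r'" and p: "pidx i < length ws" using pidx[OF i] by auto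
  have gs: "g 16 = Num (zlen i)" "g 19 = Num (addr i + 3 + length (H ?r))"
    "g 21 = Num (zlen (pidx i))" "g 24 = Num (addr (pidx i) + 3 + length (H ?r'))"
    using g(3) by (auto simp: rel_regs_def)
  have lz: "length (Z ?r) = zlen i" "length (Z ?r') = zlen (pidx i)" by (simp_all add: zlen_def)
  have zM: "zlen i \<le> M" "zlen (pidx i) \<le> M" using zlen_le_M i p by auto
  show ?thesis
  proof (cases "k = zlen i")
    case False
    then have "k < length (Z ?r)" "act (drop k u)" using k lz by auto
    then have "act_before (length (Z ?r)) u" unfolding act_before_def by blast
    then have eq: "?ans \<longleftrightarrow> E u v" using equiv_active_same[OF pr u(3)] by blast
    have "live (step_cost * length u + 40) ?ans (g(63 := g 63)) m"
      by (rule live_suffixes[where x = x and y = y])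
        (use g m u v eq in \<open>simp_all del: fun_upd_apply add: fun_upd_triv\<close>)
    then have "outcome (step_cost * length u + rest_cost) ?ans 3 (g(63 := g 63)) m"
      unfolding outcome_def rest_cost_def by fastforce
    then show ?thesis unfolding same_prog_def using False g(4) gs by (simp add: numeral_3_eq_3)
  next
    case True
    then have na: "\<not> act_before (length (Z ?r)) u" using k(2) lz by (simp add: act_before_def)
    obtain u2 where u2: "u = Z ?r @ u2" using poss_inactive[OF u(3) na] .
    have ans: "?ans \<longleftrightarrow> (\<exists>v'. v = Z ?r @ v' \<and> E (Z ?r' @ u2) (Z ?r' @ v'))"
      using equiv_inactive_same[OF pr] na u2 by simp
    let ?g1 = "g(60 := Num (addr i + 3 + length (H ?r)), 61 := Num y, 62 := Num (zlen i))"
    have "runs match_prog ?g1 m (\<lambda>t g' m'. m' = m \<and> same_below 60 ?g1 g' \<and> t \<le> 10 * M + 10 \<and>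
      g' 65 = Num (if prefix (Z ?r) v then 1 else 0))"
      by (rule match_long_word[OF _ _ _ _ m tail_word(1)[OF m i] _ v(1,2)])
        (use g lz zM in simp_all)
    then have main: "runs match_prog ?g1 m (\<lambda>t1 g1 m1. runs (Cond 65 1
       (Ins (Add 9 9 16) ;; Ins (Sub 9 9 21) ;;
        Ins (Copy 60 24) ;; Ins (Copy 61 9) ;; Ins (Copy 62 21) ;; copy_prog ;;
        replace_prog)
       fail_prog) g1 m1 (\<lambda>t2. outcome (step_cost * length u + rest_cost) ?ans (Suc (Suc (Suc (Suc (t1 + t2)))))))"
    proof (rule runs_mono, goal_cases)
      case (1 t1 g1 m1)
      then have m1: "m1 = m" and sb: "same_below 60 ?g1 g1" and t1: "t1 \<le> 10 * M + 10"
        and g65: "g1 65 = Num (if prefix (Z ?r) v then 1 else 0)" by auto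
      have sb0: "same_below 60 g g1" using sb unfolding same_below_def by auto
      have rg: "regs_ok g1" using regs_ok_same_below[OF g(1) sb0] by simp
      note sd = same_belowD[OF sb0] and rd = regs_okD[OF rg]
      show ?case
      proof (cases "prefix (Z ?r) v")
        case False
        then have "\<not> ?ans" unfolding ans by (auto simp: prefix_def)
        then have "runs fail_prog g1 m (\<lambda>t2 g2 m2.
            outcome (step_cost * length u + rest_cost) ?ans (Suc (Suc (Suc (Suc (t1 + (t2 + 2)))))) g2 m2)"
          unfolding fail_prog_def using rd t1
          by (simp add: outcome_def finished_def rest_cost_def consts_ok_def)
        then show ?thesis using False g65 m1 rd by simp
      next
        case True
        then obtain v2 where v2: "v = Z ?r @ v2" by (auto simp: prefix_def)
        have ans2: "?ans \<longleftrightarrow> E (Z ?r' @ u2) (Z ?r' @ v2)" unfolding ans using v2 by simp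
        \<comment> \<open>\<open>Z r'\<close> is placed so that it ends where \<open>Z r\<close>
          ended. It may begin left of \<open>y\<close>; since \<open>y\<close> is at least
          \<open>L\<close>, the subtraction is not truncated.\<close>
        define b where "b = y + zlen i - zlen (pidx i)"
        have b: "b + length (Z ?r') = y + zlen i" using v(3) M_le_L zM lz unfolding b_def by simp
        have w2: "word_at m (b + length (Z ?r')) v2" "b + length (Z ?r') + length v2 = ve"
          using v(1,2) v2 b lz by (simp_all add: word_at_append)
        have xS: "S \<le> x" using u(1,2) room by (simp add: stack_at_def)
        let ?a = "addr (pidx i) + 3 + length (H ?r')"
        let ?g2 = "g1(9 := Num b, 60 := Num ?a, 61 := Num b, 62 := Num (zlen (pidx i)))"
        have src: "word_at m ?a (Z ?r')" "T \<le> ?a" using tail_word[OF m p] T_le_addr[of "pidx i"] by auto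
        note ow = overwrite_long_word[OF m u(1) xS w2 src]
        have rg2: "regs_ok ?g2" using rg by simp
        have "runs copy_prog ?g2 m (\<lambda>t g' m'. same_below 60 ?g2 g' \<and> t \<le> 10 * zlen (pidx i) + 10 \<and>
          m' = (\<lambda>z. if b \<le> z \<and> z < b + zlen (pidx i) then m (?a + (z - b)) else m z))"
          by (rule copy_prog[OF regs_okD(1)[OF rg2]])
            (use ow(4)[OF HOL.refl] lz in simp_all)
        then have "runs copy_prog ?g2 m (\<lambda>t2 g2 m2. runs replace_prog g2 m2 (\<lambda>t3.
            outcome (step_cost * length u + rest_cost) ?ans
              (Suc (Suc (Suc (Suc (t1 + (Suc (Suc (Suc (Suc (Suc (t2 + t3))))) + 1))))))))"
        proof (rule runs_mono, goal_cases)
          case (1 t2 g2 m2)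
          then have sb2: "same_below 60 ?g2 g2" and t2: "t2 \<le> 10 * zlen (pidx i) + 10"
            and m2: "m2 = (\<lambda>z. if b \<le> z \<and> z < b + length (Z ?r') then m (?a + (z - b)) else m z)"
            using lz by auto
          have rg3: "regs_ok g2" using regs_ok_same_below[OF rg2 sb2] by simp
          have rr: "rel_regs i g2"
            by (rule rel_regs_frame[OF g(3)]) (use same_belowD[OF sb2] sd in auto)
          have gg: "g2 11 = Num 1" "g2 7 = Num x" "g2 9 = Num b"
            using same_belowD[OF sb2] sd g by auto
          have "runs replace_prog g2 m2
            (outcome (step_cost * length u2 + 20 * M + prepend_cost + 43) ?ans)"
            by (rule replace_prog[OF rg3 gg(1) rr gg(2,3) ow(1)[OF m2] _ _ ow(3)[OF m2]])
              (use ow(2)[OF m2] u2 u(2) w2 b v(3) ans2 in \<open>simp_all add: piece_Z\<close>)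
          then show ?case
          proof (rule runs_mono)
            fix t3 g3 m3
            assume o: "outcome (step_cost * length u2 + 20 * M + prepend_cost + 43) ?ans t3 g3 m3"
            have "step_cost * length u2 \<le> step_cost * length u" using u2 by simp
            then have "Suc (Suc (Suc (Suc (t1 + (Suc (Suc (Suc (Suc (Suc (t2 + t3))))) + 1))))) +
                (step_cost * length u2 + 20 * M + prepend_cost + 43)
              \<le> step_cost * length u + rest_cost + t3"
              using t1 t2 zM unfolding rest_cost_def by linarith
            then show "outcome (step_cost * length u + rest_cost) ?ans
              (Suc (Suc (Suc (Suc (t1 + (Suc (Suc (Suc (Suc (Suc (t2 + t3))))) + 1)))))) g3 m3"
              by (rule outcome_mono[OF o])
          qed
        qed
        then show ?thesis using True g65 m1 rd sd gs g b_def by (auto elim!: runs_mono)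
      qed
    qed
    then show ?thesis unfolding same_prog_def using True g(4,6) gs
      by (auto elim!: runs_mono)
  qed
qed

lemma suffix_prog:
  fixes g m :: "'a regs"
  assumes g: "regs_ok g" "g 11 = Num 1" "rel_regs i g" "g 25 = Num k" "g 7 = Num x" "g 9 = Num y"
    and m: "mem_ok m" and u: "stack_at m x u" "length u \<le> N"
    and k: "k < zlen i" "k \<le> length u"
    and v: "word_at m y v" "y + length v = ve" "L \<le> y"
    and ans: "ans \<longleftrightarrow> (\<exists>z w. Z (ws ! pidx i) = z @ drop k (Z (ws ! i)) \<and> v = z @ w \<and> E (drop k u) w)"
  shows "runs suffix_prog g m (outcome (step_cost * length u + 20 * M + 100) ans)"
proof -
  let ?r = "ws ! i" and ?r' = "ws ! pidx i"
  have i: "i < length ws" using g(3) by (simp add: rel_regs_def)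
  have p: "pidx i < length ws" using pidx[OF i] by auto
  let ?a = "addr i + 3 + length (H ?r)" and ?a' = "addr (pidx i) + 3 + length (H ?r')"
  let ?n = "zlen i - k"
  let ?l = "zlen (pidx i) - ?n"
  have gs: "g 16 = Num (zlen i)" "g 19 = Num ?a" "g 21 = Num (zlen (pidx i))" "g 24 = Num ?a'"
    using g(3) by (auto simp: rel_regs_def)
  have lz: "length (Z ?r) = zlen i" "length (Z ?r') = zlen (pidx i)" by (simp_all add: zlen_def)
  have zM: "zlen i \<le> M" "zlen (pidx i) \<le> M" using zlen_le_M i p by auto
  note rd = regs_okD[OF g(1)]
  show ?thesis
  proof (cases "?n \<le> zlen (pidx i)")
    case False
    have "\<not> ans"
    proof
      assume ans
      then obtain z where "Z ?r' = z @ drop k (Z ?r)" using ans by blast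
      then have "zlen (pidx i) = length z + ?n" using lz by (metis length_append length_drop)
      then show False using False by simp
    qed
    moreover have "zlen (pidx i) < ?n" "0 < ?n - zlen (pidx i)" using False by auto
    ultimately show ?thesis unfolding suffix_prog_def fail_prog_def using gs g(4) rd
      by (simp add: outcome_def finished_def consts_ok_def)
  next
    case True
    have wz: "word_at m (?a + k) (drop k (Z ?r))"
      using tail_word(1)[OF m i] word_at_append[of m ?a "take k (Z ?r)" "drop k (Z ?r)"] k(1) lz
      by simp
    have wz': "word_at m ?a' (take ?l (Z ?r'))" "word_at m (?a' + ?l) (drop ?l (Z ?r'))"
      using tail_word(1)[OF m p] word_at_append[of m ?a' "take ?l (Z ?r')" "drop ?l (Z ?r')"] lz
      by simp_all
    have ln: "length (drop k (Z ?r)) = ?n" "length (drop ?l (Z ?r')) = ?n" using lz True by auto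
    have eq1: "(\<forall>j<?n. m (?a + k + j) = m (?a' + ?l + j)) \<longleftrightarrow> drop k (Z ?r) = drop ?l (Z ?r')"
    proof
      assume *: "\<forall>j<?n. m (?a + k + j) = m (?a' + ?l + j)"
      show "drop k (Z ?r) = drop ?l (Z ?r')"
      proof (rule nth_equalityI)
        show "length (drop k (Z ?r)) = length (drop ?l (Z ?r'))" using ln by simp
        fix j assume "j < length (drop k (Z ?r))"
        then have "j < ?n" using ln by simp
        then have "Gen (drop k (Z ?r) ! j) = Gen (drop ?l (Z ?r') ! j)"
          using * wz wz'(2) ln unfolding word_at_def by metis
        then show "drop k (Z ?r) ! j = drop ?l (Z ?r') ! j" by simp
      qed
    next
      assume *: "drop k (Z ?r) = drop ?l (Z ?r')"
      then show "\<forall>j<?n. m (?a + k + j) = m (?a' + ?l + j)"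
        using wz wz'(2) ln unfolding word_at_def by metis
    qed
    let ?g1 = "g(26 := Num ?n, 28 := Num 0, 27 := Num ?l, 60 := Num (?a + k), 61 := Num (?a' + ?l),
      62 := Num ?n)"
    have rg1: "regs_ok ?g1" using g(1) by simp
    have "runs match_prog ?g1 m (\<lambda>t g' m'. m' = m \<and> same_below 60 ?g1 g' \<and> t \<le> 10 * ?n + 10 \<and>
      g' 65 = Num (if \<forall>j<?n. m (?a + k + j) = m (?a' + ?l + j) then 1 else 0))"
      by (rule match_prog[OF regs_okD(1)[OF rg1]]) simp_all
    then have main: "runs match_prog ?g1 m (\<lambda>t1 g1 m1. runs (Cond 65 1
       (Ins (Copy 60 24) ;; Ins (Copy 61 9) ;; Ins (Copy 62 27) ;; match_prog ;;
        Cond 65 1 (Ins (Add 7 7 25) ;; Ins (Add 9 9 27)) fail_prog)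
       fail_prog) g1 m1 (\<lambda>t2. outcome (step_cost * length u + 20 * M + 100) ans
         (Suc (Suc (Suc (Suc (Suc (Suc (Suc (t1 + t2))))))))))"
      unfolding eq1
    proof (rule runs_mono, goal_cases)
      case (1 t1 g1 m1)
      then have m1: "m1 = m" and sb: "same_below 60 ?g1 g1" and t1: "t1 \<le> 10 * M + 10"
        and g65: "g1 65 = Num (if drop k (Z ?r) = drop ?l (Z ?r') then 1 else 0)" using zM by auto
      have rg: "regs_ok g1" using regs_ok_same_below[OF rg1 sb] by simp
      note sd = same_belowD[OF sb] and rd = regs_okD[OF rg]
      show ?case
      proof (cases "drop k (Z ?r) = drop ?l (Z ?r')")
        case False
        have "\<not> ans"
        proof
          assume ans
          then obtain z where z: "Z ?r' = z @ drop k (Z ?r)" using ans by blast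
          then have "zlen (pidx i) = length z + ?n" using lz by (metis length_append length_drop)
          then have "length z = ?l" by simp
          then have "drop ?l (Z ?r') = drop k (Z ?r)" using z by (metis append_eq_conv_conj)
          then show False using False by simp
        qed
        then show ?thesis unfolding fail_prog_def using False g65 m1 rd t1
          by (simp add: outcome_def finished_def consts_ok_def)
      next
        case eq: True
        then have zr: "Z ?r' = take ?l (Z ?r') @ drop k (Z ?r)" by simp
        have ans2: "ans \<longleftrightarrow> (\<exists>w. v = take ?l (Z ?r') @ w \<and> E (drop k u) w)"
        proof -
          have "z = take ?l (Z ?r')" if "Z ?r' = z @ drop k (Z ?r)" for z
            using that zr by (metis append_same_eq)
          then show ?thesis using ans zr by blast
        qed
        let ?g2 = "g1(60 := Num ?a', 61 := Num y, 62 := Num ?l)"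
        have rg2: "regs_ok ?g2" using rg by simp
        have ll: "length (take ?l (Z ?r')) = ?l" using lz by simp
        have "runs match_prog ?g2 m (\<lambda>t g' m'. m' = m \<and> same_below 60 ?g2 g' \<and> t \<le> 10 * M + 10 \<and>
          g' 65 = Num (if prefix (take ?l (Z ?r')) v then 1 else 0))"
          by (rule match_long_word[OF rg2 _ _ _ m wz'(1) _ v(1,2)]) (use ll zM in simp_all)
        then have "runs match_prog ?g2 m (\<lambda>t2 g2 m2. runs
            (Cond 65 1 (Ins (Add 7 7 25) ;; Ins (Add 9 9 27)) fail_prog) g2 m2
            (\<lambda>t3. outcome (step_cost * length u + 20 * M + 100) ans
              (Suc (Suc (Suc (Suc (Suc (Suc (Suc (Suc (Suc (Suc (Suc (t1 + (t2 + t3)))))))))))))))"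
        proof (rule runs_mono, goal_cases)
          case (1 t2 g2 m2)
          then have m2: "m2 = m" and sb2: "same_below 60 ?g2 g2" and t2: "t2 \<le> 10 * M + 10"
            and g65: "g2 65 = Num (if prefix (take ?l (Z ?r')) v then 1 else 0)" by auto
          have rg3: "regs_ok g2" using regs_ok_same_below[OF rg2 sb2] by simp
          note sd2 = same_belowD[OF sb2] and rd3 = regs_okD[OF rg3]
          show ?case
          proof (cases "prefix (take ?l (Z ?r')) v")
            case False
            then have "\<not> ans" unfolding ans2 by (auto simp: prefix_def)
            then show ?thesis unfolding fail_prog_def using False g65 m2 rd3 t1 t2
              by (simp add: outcome_def finished_def consts_ok_def)
          next
            case True
            then obtain w where w: "v = take ?l (Z ?r') @ w" by (auto simp: prefix_def)
            have "ans \<longleftrightarrow> E (drop k u) w" unfolding ans2 using w by auto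
            then have "live (step_cost * length (drop k u) + 40) ans
                (g2(7 := Num (x + k), 9 := Num (y + ?l))) m"
              by (rule live_suffixes[rotated -1, where x = "x + k" and y = "y + ?l"])
                (use rg3 m sd2 sd g stack_at_drop[OF u(1) k(2)] u(2) v w ll in
                  \<open>auto simp: word_at_append\<close>)
            moreover have "step_cost * length (drop k u) \<le> step_cost * length u" by simp
            then have "Suc (Suc (Suc (Suc (Suc (Suc (Suc (Suc (Suc (Suc (Suc (t1 + (t2 + 3))))))))))))
                + (step_cost * length (drop k u) + 40) \<le> step_cost * length u + 20 * M + 100"
              using t1 t2 by linarith
            ultimately have "outcome (step_cost * length u + 20 * M + 100) ans
              (Suc (Suc (Suc (Suc (Suc (Suc (Suc (Suc (Suc (Suc (Suc (t1 + (t2 + 3)))))))))))))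
              (g2(7 := Num (x + k), 9 := Num (y + ?l))) m" unfolding outcome_def by blast
            moreover have "g2 7 = Num x" "g2 9 = Num y" "g2 25 = Num k" "g2 27 = Num ?l"
              using sd2 sd g by auto
            ultimately show ?thesis using True g65 m2 rd3 by (simp add: numeral_3_eq_3)
          qed
        qed
        moreover have "g1 24 = Num ?a'" "g1 9 = Num y" "g1 27 = Num ?l" using sd g gs by auto
        ultimately show ?thesis using eq g65 m1 rd by (auto elim!: runs_mono)
      qed
    qed
    have "?n - zlen (pidx i) = 0" using True by simp
    then show ?thesis unfolding suffix_prog_def using main g gs rd
      by (auto elim!: runs_mono)
  qed
qed

lemma other_prog:
  fixes g m :: "'a regs"
  assumes g: "regs_ok g" "g 11 = Num 1" "rel_regs i g" "g 25 = Num k" "g 7 = Num x" "g 9 = Num y"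
    and m: "mem_ok m" and u: "stack_at m x u" "length u \<le> N" "poss (Z (ws ! i)) u"
    and k: "k \<le> zlen i" "\<forall>j<k. \<not> act (drop j u)" "k < zlen i \<longrightarrow> act (drop k u)"
    and v: "word_at m y v" "y + length v = ve" "L \<le> y"
  shows "runs other_prog g m (outcome (step_cost * length u + rest_cost)
    (E (H (ws ! i) @ u) (H (ws ! pidx i) @ v)))"
proof -
  let ?r = "ws ! i" and ?r' = "ws ! pidx i"
  let ?ans = "E (H ?r @ u) (H ?r' @ v)"
  have i: "i < length ws" using g(3) by (simp add: rel_regs_def)
  have pr: "partner R ?r ?r'" and p: "pidx i < length ws" using pidx[OF i] by auto
  let ?a = "addr i + 3 + length (H ?r)" and ?a' = "addr (pidx i) + 3 + length (H ?r')"
  have gs: "g 16 = Num (zlen i)" "g 19 = Num ?a" "g 21 = Num (zlen (pidx i))" "g 24 = Num ?a'"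
    using g(3) by (auto simp: rel_regs_def)
  have lz: "length (Z ?r) = zlen i" "length (Z ?r') = zlen (pidx i)" by (simp_all add: zlen_def)
  have zM: "zlen i \<le> M" "zlen (pidx i) \<le> M" using zlen_le_M i p by auto
  show ?thesis
  proof (cases "k = zlen i")
    case True
    then have na: "\<not> act_before (length (Z ?r)) u" using k(2) lz by (simp add: act_before_def)
    obtain u2 where u2: "u = Z ?r @ u2" using poss_inactive[OF u(3) na] .
    have ans: "?ans \<longleftrightarrow> E (Z ?r' @ u2) v" using equiv_inactive_other[OF pr] na u2 by simp
    have "runs replace_prog g m (outcome (step_cost * length u2 + 20 * M + prepend_cost + 43) ?ans)"
      by (rule replace_prog[OF g(1-3,5,6) m, where q = "[]" and v = v])
        (use u u2 v ans in simp_all)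
    then have "runs replace_prog g m (\<lambda>t. outcome (step_cost * length u + rest_cost) ?ans (Suc t))"
    proof (rule runs_mono)
      fix t g3 m3
      assume o: "outcome (step_cost * length u2 + 20 * M + prepend_cost + 43) ?ans t g3 m3"
      have "step_cost * length u2 \<le> step_cost * length u" using u2 by simp
      then have "Suc t + (step_cost * length u2 + 20 * M + prepend_cost + 43)
          \<le> step_cost * length u + rest_cost + t"
        unfolding rest_cost_def by linarith
      then show "outcome (step_cost * length u + rest_cost) ?ans (Suc t) g3 m3"
        by (rule outcome_mono[OF o])
    qed
    then show ?thesis unfolding other_prog_def using True g(4) gs by simp
  next
    case False
    then have kz: "k < length (Z ?r)" "act (drop k u)" using k lz by auto
    then have ab: "act_before (length (Z ?r)) u" unfolding act_before_def by blast
    have ku: "k \<le> length u"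
    proof (rule ccontr)
      assume "\<not> k \<le> length u"
      then have "drop k u = []" by simp
      then show False using kz(2) not_act_Nil by simp
    qed
    let ?g1 = "g(60 := Num ?a', 61 := Num y, 62 := Num (zlen (pidx i)))"
    have "runs match_prog ?g1 m (\<lambda>t g' m'. m' = m \<and> same_below 60 ?g1 g' \<and> t \<le> 10 * M + 10 \<and>
      g' 65 = Num (if prefix (Z ?r') v then 1 else 0))"
      by (rule match_long_word[OF _ _ _ _ m tail_word(1)[OF m p] _ v(1,2)])
        (use g lz zM in simp_all)
    then have main: "runs match_prog ?g1 m (\<lambda>t1 g1 m1. runs (Cond 65 1
       (Ins (Add 9 9 21) ;; Ins (Sub 9 9 16) ;;
        Ins (Copy 60 19) ;; Ins (Copy 61 9) ;; Ins (Copy 62 16) ;; copy_prog)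
       suffix_prog) g1 m1 (\<lambda>t2. outcome (step_cost * length u + rest_cost) ?ans
         (Suc (Suc (Suc (Suc (Suc (t1 + t2))))))))"
    proof (rule runs_mono, goal_cases)
      case (1 t1 g1 m1)
      then have m1: "m1 = m" and sb: "same_below 60 ?g1 g1" and t1: "t1 \<le> 10 * M + 10"
        and g65: "g1 65 = Num (if prefix (Z ?r') v then 1 else 0)" by auto
      have sb0: "same_below 60 g g1" using sb unfolding same_below_def by auto
      have rg: "regs_ok g1" using regs_ok_same_below[OF g(1) sb0] by simp
      note sd = same_belowD[OF sb0] and rd = regs_okD[OF rg]
      have rr: "rel_regs i g1" by (rule rel_regs_frame[OF g(3)]) (use sd in auto)
      show ?case
      proof (cases "prefix (Z ?r') v")
        case False
        have "runs suffix_prog g1 m (outcome (step_cost * length u + 20 * M + 100) ?ans)"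
          by (rule suffix_prog[OF rg _ rr _ _ _ m u(1,2) _ ku v
                equiv_active_other[OF pr u(3) kz k(2) False]])
            (use sd g kz lz in simp_all)
        then have "runs suffix_prog g1 m (\<lambda>t. outcome (step_cost * length u + rest_cost) ?ans
            (Suc (Suc (Suc (Suc (Suc (t1 + (t + 2))))))))"
        proof (rule runs_mono)
          fix t g3 m3
          assume o: "outcome (step_cost * length u + 20 * M + 100) ?ans t g3 m3"
          have "Suc (Suc (Suc (Suc (Suc (t1 + (t + 2)))))) + (step_cost * length u + 20 * M + 100)
            \<le> step_cost * length u + rest_cost + t"
            using t1 unfolding rest_cost_def by linarith
          then show "outcome (step_cost * length u + rest_cost) ?ans
              (Suc (Suc (Suc (Suc (Suc (t1 + (t + 2))))))) g3 m3" by (rule outcome_mono[OF o])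
        qed
        then show ?thesis using False g65 m1 rd by simp
      next
        case True
        then obtain v2 where v2: "v = Z ?r' @ v2" by (auto simp: prefix_def)
        have ans: "?ans \<longleftrightarrow> E u (Z ?r @ v2)"
          using equiv_active_other_literal[OF pr u(3) ab] v2 by simp
        define b where "b = y + zlen (pidx i) - zlen i"
        have b: "b + length (Z ?r) = y + zlen (pidx i)"
          using v(3) M_le_L zM lz unfolding b_def by simp
        have w2: "word_at m (b + length (Z ?r)) v2" "b + length (Z ?r) + length v2 = ve"
          using v(1,2) v2 b lz by (simp_all add: word_at_append)
        have xS: "S \<le> x" using u(1,2) room by (simp add: stack_at_def)
        let ?g2 = "g1(9 := Num b, 60 := Num ?a, 61 := Num b, 62 := Num (zlen i))"
        have src: "word_at m ?a (Z ?r)" "T \<le> ?a" using tail_word[OF m i] T_le_addr[of i] by auto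
        note ow = overwrite_long_word[OF m u(1) xS w2 src]
        have rg2: "regs_ok ?g2" using rg by simp
        have "runs copy_prog ?g2 m (\<lambda>t g' m'. same_below 60 ?g2 g' \<and> t \<le> 10 * zlen i + 10 \<and>
          m' = (\<lambda>z. if b \<le> z \<and> z < b + zlen i then m (?a + (z - b)) else m z))"
          by (rule copy_prog[OF regs_okD(1)[OF rg2]])
            (use ow(4)[OF HOL.refl] lz in simp_all)
        then have "runs copy_prog ?g2 m (\<lambda>t2.
            outcome (step_cost * length u + rest_cost) ?ans
              (Suc (Suc (Suc (Suc (Suc (t1 + (Suc (Suc (Suc (Suc (Suc t2)))) + 1))))))))"
        proof (rule runs_mono, goal_cases)
          case (1 t2 g2 m2)
          then have sb2: "same_below 60 ?g2 g2" and t2: "t2 \<le> 10 * zlen i + 10"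
            and m2: "m2 = (\<lambda>z. if b \<le> z \<and> z < b + length (Z ?r) then m (?a + (z - b)) else m z)"
            using lz by auto
          have rg3: "regs_ok g2" using regs_ok_same_below[OF rg2 sb2] by simp
          have gg: "g2 11 = Num 1" "g2 7 = Num x" "g2 9 = Num b"
            using same_belowD[OF sb2] sd g by auto
          \<comment> \<open>Here the longer word receives the tail, so \<open>q'\<close> becomes
            \<open>Z r\<close> while \<open>q\<close> is empty, and no new flags are needed.\<close>
          have "stack_at m2 x ([] @ u)" "piece R ([] :: 'a list)"
            "b + length (Z ?r @ v2) = ve" "L \<le> b + length (Z ?r)"
            "step_cost * length u + 20 * length ([] :: 'a list) + 40 \<le> step_cost * length u + 40"
            "?ans \<longleftrightarrow> E ([] @ u) (Z ?r @ v2)"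
            using ow(2)[OF m2] w2(2) b v(3) ans by auto
          then have "live (step_cost * length u + 40) ?ans g2 m2"
            unfolding live_def using rg3 ow(1)[OF m2] gg u(2) ow(3)[OF m2] piece_Z by blast
          moreover have "Suc (Suc (Suc (Suc (Suc (t1 + (Suc (Suc (Suc (Suc (Suc t2)))) + 1)))))) +
              (step_cost * length u + 40) \<le> step_cost * length u + rest_cost"
            using t1 t2 zM unfolding rest_cost_def by linarith
          ultimately show ?case unfolding outcome_def by blast
        qed
        then show ?thesis using True g65 m1 rd sd gs g b_def by (auto elim!: runs_mono)
      qed
    qed
    then show ?thesis unfolding other_prog_def using False g(4,6) gs
      by (auto elim!: runs_mono)
  qed
qed

end

section \<open>One round of the comparison\<close>

definition load_prog :: com where
  "load_prog =
    Ins (Add 14 13 1) ;; Ins (Load 16 14) ;; Ins (Add 14 14 1) ;; Ins (Load 17 14) ;;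
    Ins (Sub 17 17 16) ;; Ins (Add 18 13 3) ;; Ins (Add 19 18 17) ;; Ins (Load 20 13) ;;
    Ins (Add 14 20 1) ;; Ins (Load 21 14) ;; Ins (Add 14 14 1) ;; Ins (Load 22 14) ;;
    Ins (Sub 22 22 21) ;; Ins (Add 23 20 3) ;; Ins (Add 24 23 22)"

definition rel_prog :: com where
  "rel_prog =
    load_prog ;; Ins (Add 7 7 17) ;; scan_prog ;;
    Ins (Copy 60 18) ;; Ins (Copy 61 9) ;; Ins (Copy 62 17) ;; match_prog ;;
    Cond 65 1
     (Ins (Add 9 9 17) ;; same_prog)
     (Ins (Copy 60 23) ;; Ins (Copy 61 9) ;; Ins (Copy 62 22) ;; match_prog ;;
      Cond 65 1 (Ins (Add 9 9 22) ;; other_prog) fail_prog)"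

definition step_prog :: com where
  "step_prog =
    Cond 7 8
     (Cond 9 10 (Ins (Copy 2 1)) (Ins (Copy 2 0)) ;; Ins (Copy 11 0))
     (Ins (Add 12 7 6) ;; Ins (Load 13 12) ;;
      Cond 13 0
       (Ins (Load 14 7) ;; Ins (Load 15 9) ;;
        Cond 14 15 (Ins (Add 7 7 1) ;; Ins (Add 9 9 1)) fail_prog)
       rel_prog)"

context main_machine
begin

lemma load_prog:
  fixes g m :: "'a regs"
  assumes g: "regs_ok g" "g 13 = Num (addr i)" and i: "i < length ws" and m: "mem_ok m"
  shows "runs load_prog g m (\<lambda>t g' m'. t = 15 \<and> m' = m \<and> same_below 14 g g' \<and> rel_regs i g')"
proof -
  have p: "pidx i < length ws" using pidx i by blast
  have rec: "records zlen m" using m by (simp add: mem_ok_def)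
  have f: "m (addr i) = Num (addr (pidx i))" "m (Suc (addr i)) = Num (zlen i)"
    "m (Suc (Suc (addr i))) = Num (length (ws ! i))"
    "m (Suc (addr (pidx i))) = Num (zlen (pidx i))"
    "m (Suc (Suc (addr (pidx i)))) = Num (length (ws ! pidx i))"
    using records_fields[OF rec i] records_fields[OF rec p] by auto
  show ?thesis
    unfolding load_prog_def rel_regs_def using regs_okD[OF g(1)] g(2) i f length_H by simp
qed

lemma rel_prog:
  fixes g m :: "'a regs"
  assumes g: "regs_ok g" "g 11 = Num 1" "g 13 = Num (addr i)" "g 7 = Num x" "g 9 = Num y"
    and i: "i < length ws"
    and m: "mem_ok m" and u: "stack_at m x (H (ws ! i) @ u)" "length u \<le> N" "poss (Z (ws ! i)) u"
    and v: "word_at m y (q @ v)" "y + length (q @ v) = ve" "piece R q" "L \<le> y + length q"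
  shows "runs rel_prog g m (outcome (step_cost * length u + rest_cost + 30 * M + 140)
    (E (H (ws ! i) @ u) (q @ v)))"
proof -
  let ?r = "ws ! i" and ?r' = "ws ! pidx i"
  let ?ans = "E (H ?r @ u) (q @ v)"
  let ?K = "step_cost * length u + rest_cost + 30 * M + 140"
  have pr: "partner R ?r ?r'" and p: "pidx i < length ws" using pidx[OF i] by auto
  have W: "?r \<in> W" "?r' \<in> W" using ws_in_W i p by auto
  have lM: "length (H ?r) \<le> M" "length (H ?r') \<le> M"
    using word_length[of ?r] word_length[of ?r'] i p length_H by (simp_all add: le_trans)
  have heads: "word_at m (addr i + 3) (H ?r)" "word_at m (addr (pidx i) + 3) (H ?r')"
    using records_head_tail(1) m i p unfolding mem_ok_def by blast+
  have st: "stack_at m (x + length (H ?r)) u" using stack_at_append[OF u(1)] .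
  \<comment> \<open>The piece \<open>q\<close> ends inside the head, so removing the head removes
    all of \<open>q\<close>; the rest then starts at an address that is again at least
    \<open>L\<close>.\<close>
  have rest_of: "\<exists>v'. q @ v = H s @ v' \<and> word_at m (y + length (H s)) v' \<and>
      y + length (H s) + length v' = ve \<and> L \<le> y + length (H s)"
    if s: "s \<in> W" "prefix (H s) (q @ v)" for s
  proof -
    obtain v' where v': "q @ v = H s @ v'" using s(2) by (auto simp: prefix_def)
    obtain h where "H s = q @ h" using piece_before_head[OF v(3) s(1) v'] by blast
    then have "L \<le> y + length (H s)" using v(4) by simp
    then show ?thesis using v' v(1,2) by (auto simp: word_at_append)
  qed
  have B: "runs (Ins (Copy 60 18) ;; Ins (Copy 61 9) ;; Ins (Copy 62 17) ;; match_prog ;;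
    Cond 65 1
     (Ins (Add 9 9 17) ;; same_prog)
     (Ins (Copy 60 23) ;; Ins (Copy 61 9) ;; Ins (Copy 62 22) ;; match_prog ;;
      Cond 65 1 (Ins (Add 9 9 22) ;; other_prog) fail_prog)) g2 m
      (\<lambda>t. outcome (step_cost * length u + rest_cost + 20 * M + 100) ?ans t)"
    if g2: "regs_ok g2" "g2 11 = Num 1" "rel_regs i g2" "g2 25 = Num k"
      "g2 7 = Num (x + length (H ?r))" "g2 9 = Num y"
      and k: "k \<le> zlen i" "\<forall>j<k. \<not> act (drop j u)" "k < zlen i \<longrightarrow> act (drop k u)" for g2 k
  proof -
    let ?L = "step_cost * length u + rest_cost + 20 * M + 100"
    have gs: "g2 17 = Num (length (H ?r))" "g2 18 = Num (addr i + 3)"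
      "g2 22 = Num (length (H ?r'))" "g2 23 = Num (addr (pidx i) + 3)"
      using g2(3) by (auto simp: rel_regs_def)
    let ?g3 = "g2(60 := Num (addr i + 3), 61 := Num y, 62 := Num (length (H ?r)))"
    have rg3: "regs_ok ?g3" using g2(1) by simp
    have "runs match_prog ?g3 m (\<lambda>t g' m'. m' = m \<and> same_below 60 ?g3 g' \<and> t \<le> 10 * M + 10 \<and>
      g' 65 = Num (if prefix (H ?r) (q @ v) then 1 else 0))"
      by (rule match_long_word[OF rg3 _ _ _ m heads(1) lM(1) v(1,2)]) simp_all
    then have "runs match_prog ?g3 m (\<lambda>t1 g1 m1. runs (Cond 65 1
     (Ins (Add 9 9 17) ;; same_prog)
     (Ins (Copy 60 23) ;; Ins (Copy 61 9) ;; Ins (Copy 62 22) ;; match_prog ;;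
      Cond 65 1 (Ins (Add 9 9 22) ;; other_prog) fail_prog)) g1 m1
       (\<lambda>t2. outcome ?L ?ans (Suc (Suc (Suc (t1 + t2))))))"
    proof (rule runs_mono, goal_cases)
      case (1 t1 g1 m1)
      then have m1: "m1 = m" and sb: "same_below 60 ?g3 g1" and t1: "t1 \<le> 10 * M + 10"
        and g65: "g1 65 = Num (if prefix (H ?r) (q @ v) then 1 else 0)" by auto
      have sb0: "same_below 60 g2 g1" using sb unfolding same_below_def by auto
      have rg: "regs_ok g1" using regs_ok_same_below[OF g2(1) sb0] by simp
      note sd = same_belowD[OF sb0] and rd = regs_okD[OF rg]
      show ?case
      proof (cases "prefix (H ?r) (q @ v)")
        case True
        obtain v' where v': "q @ v = H ?r @ v'" "word_at m (y + length (H ?r)) v'"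
          "y + length (H ?r) + length v' = ve" "L \<le> y + length (H ?r)"
          using rest_of[OF W(1) True] by blast
        let ?g4 = "g1(9 := Num (y + length (H ?r)))"
        have rr: "rel_regs i ?g4" by (rule rel_regs_frame[OF g2(3)]) (use sd in auto)
        have "runs same_prog ?g4 m
            (outcome (step_cost * length u + rest_cost) (E (H ?r @ u) (H ?r @ v')))"
          by (rule same_prog[OF _ _ rr _ _ _ m st u(2,3) k v'(2-4)]) (use rg sd g2 in simp_all)
        then have "runs same_prog ?g4 m (\<lambda>t. outcome ?L ?ans
            (Suc (Suc (Suc (t1 + (Suc t + 1))))))"
          unfolding v'(1)
        proof (rule runs_mono)
          fix t g5 m5
          assume "outcome (step_cost * length u + rest_cost) (E (H ?r @ u) (H ?r @ v')) t g5 m5"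
          then show "outcome ?L (E (H ?r @ u) (H ?r @ v')) (Suc (Suc (Suc (t1 + (Suc t + 1))))) g5 m5"
            by (rule outcome_mono) (use t1 in linarith)
        qed
        then show ?thesis using True g65 m1 rd sd gs g2 by simp
      next
        case nH: False
        let ?g4 = "g1(60 := Num (addr (pidx i) + 3), 61 := Num y, 62 := Num (length (H ?r')))"
        have rg4: "regs_ok ?g4" using rg by simp
        have "runs match_prog ?g4 m (\<lambda>t g' m'. m' = m \<and> same_below 60 ?g4 g' \<and> t \<le> 10 * M + 10 \<and>
          g' 65 = Num (if prefix (H ?r') (q @ v) then 1 else 0))"
          by (rule match_long_word[OF rg4 _ _ _ m heads(2) lM(2) v(1,2)]) simp_all
        then have "runs match_prog ?g4 m (\<lambda>t2 g5 m5. runs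
          (Cond 65 1 (Ins (Add 9 9 22) ;; other_prog) fail_prog) g5 m5
          (\<lambda>t3. outcome ?L ?ans (Suc (Suc (Suc (t1 + (Suc (Suc (Suc (t2 + t3))) + 2)))))))"
        proof (rule runs_mono, goal_cases)
          case (1 t2 g5 m5)
          then have m5: "m5 = m" and sb5: "same_below 60 ?g4 g5" and t2: "t2 \<le> 10 * M + 10"
            and g65: "g5 65 = Num (if prefix (H ?r') (q @ v) then 1 else 0)" by auto
          have sb6: "same_below 60 g2 g5" using sb0 sb5 unfolding same_below_def by auto
          have rg5: "regs_ok g5" using regs_ok_same_below[OF g2(1) sb6] by simp
          note sd5 = same_belowD[OF sb6] and rd5 = regs_okD[OF rg5]
          show ?case
          proof (cases "prefix (H ?r') (q @ v)")
            case True
            obtain v' where v': "q @ v = H ?r' @ v'" "word_at m (y + length (H ?r')) v'"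
              "y + length (H ?r') + length v' = ve" "L \<le> y + length (H ?r')"
              using rest_of[OF W(2) True] by blast
            let ?g6 = "g5(9 := Num (y + length (H ?r')))"
            have rr: "rel_regs i ?g6" by (rule rel_regs_frame[OF g2(3)]) (use sd5 in auto)
            have "runs other_prog ?g6 m
                (outcome (step_cost * length u + rest_cost) (E (H ?r @ u) (H ?r' @ v')))"
              by (rule other_prog[OF _ _ rr _ _ _ m st u(2,3) k v'(2-4)])
                (use rg5 sd5 g2 in simp_all)
            then have "runs other_prog ?g6 m (\<lambda>t. outcome ?L ?ans
                (Suc (Suc (Suc (t1 + (Suc (Suc (Suc (t2 + (Suc t + 1)))) + 2))))))"
              unfolding v'(1)
            proof (rule runs_mono)
              fix t g7 m7
              assume "outcome (step_cost * length u + rest_cost) (E (H ?r @ u) (H ?r' @ v')) t g7 m7"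
              then show "outcome ?L (E (H ?r @ u) (H ?r' @ v'))
                  (Suc (Suc (Suc (t1 + (Suc (Suc (Suc (t2 + (Suc t + 1)))) + 2))))) g7 m7"
                by (rule outcome_mono) (use t1 t2 in linarith)
            qed
            then show ?thesis using True g65 m5 rd5 sd5 gs g2 by simp
          next
            case False
            have "\<not> ?ans" using headed_equiv_prefix[OF pr u(3)] nH False by blast
            then show ?thesis unfolding fail_prog_def using False g65 m5 rd5 t1 t2
              by (simp add: outcome_def finished_def consts_ok_def)
          qed
        qed
        then show ?thesis using nH g65 m1 rd sd gs g2 by (auto elim!: runs_mono)
      qed
    qed
    then show ?thesis using gs g2 by (auto elim!: runs_mono)
  qed
  have A: "runs (Ins (Add 7 7 17) ;; scan_prog ;;
    Ins (Copy 60 18) ;; Ins (Copy 61 9) ;; Ins (Copy 62 17) ;; match_prog ;;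
    Cond 65 1
     (Ins (Add 9 9 17) ;; same_prog)
     (Ins (Copy 60 23) ;; Ins (Copy 61 9) ;; Ins (Copy 62 22) ;; match_prog ;;
      Cond 65 1 (Ins (Add 9 9 22) ;; other_prog) fail_prog)) g1 m
      (\<lambda>t. outcome ?K ?ans (15 + t))"
    if sb: "same_below 14 g g1" and rr: "rel_regs i g1" for g1
  proof -
    note sd = same_belowD[OF sb]
    let ?g2 = "g1(7 := Num (x + length (H ?r)))"
    have rg: "regs_ok g1" using regs_ok_same_below[OF g(1) sb] by simp
    have gs: "g1 16 = Num (zlen i)" "g1 17 = Num (length (H ?r))" using rr by (auto simp: rel_regs_def)
    have "runs scan_prog ?g2 m (\<lambda>t g' m'. m' = m \<and> same_below 25 ?g2 g' \<and> t \<le> 10 * zlen i + 20 \<and>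
      (\<exists>k\<le>zlen i. g' 25 = Num k \<and> (\<forall>j<k. \<not> act (drop j u)) \<and> (k < zlen i \<longrightarrow> act (drop k u))))"
      by (rule scan_prog[OF _ _ _ _ st]) (use regs_okD[OF rg] gs in simp_all)
    then have "runs scan_prog ?g2 m (\<lambda>t1 g3 m3. runs (Ins (Copy 60 18) ;; Ins (Copy 61 9) ;;
      Ins (Copy 62 17) ;; match_prog ;;
      Cond 65 1
       (Ins (Add 9 9 17) ;; same_prog)
       (Ins (Copy 60 23) ;; Ins (Copy 61 9) ;; Ins (Copy 62 22) ;; match_prog ;;
        Cond 65 1 (Ins (Add 9 9 22) ;; other_prog) fail_prog)) g3 m3
        (\<lambda>t2. outcome ?K ?ans (15 + (1 + (t1 + t2)))))"
    proof (rule runs_mono, goal_cases)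
      case (1 t1 g3 m3)
      then obtain k where m3: "m3 = m" and sb3: "same_below 25 ?g2 g3" and t1: "t1 \<le> 10 * M + 20"
        and k: "k \<le> zlen i" "g3 25 = Num k" "\<forall>j<k. \<not> act (drop j u)"
          "k < zlen i \<longrightarrow> act (drop k u)" using zlen_le_M[OF i] by auto
      note sd3 = same_belowD[OF sb3]
      have rg3: "regs_ok g3" by (rule regs_ok_frame[OF rg]) (use sd3 in auto)
      have rr3: "rel_regs i g3" by (rule rel_regs_frame[OF rr]) (use sd3 in auto)
      have "g3 11 = Num 1" "g3 7 = Num (x + length (H ?r))" "g3 9 = Num y" using sd3 sd g by auto
      from B[OF rg3 this(1) rr3 k(2) this(2,3) k(1,3,4)] show ?case unfolding m3
      proof (rule runs_mono)
        fix t g7 m7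
        assume "outcome (step_cost * length u + rest_cost + 20 * M + 100) ?ans t g7 m7"
        then show "outcome ?K ?ans (15 + (1 + (t1 + t))) g7 m7"
          by (rule outcome_mono) (use t1 in linarith)
      qed
    qed
    moreover have "g1 7 = Num x" using sd g by simp
    ultimately show ?thesis using gs by (simp only: runs_Seq runs_basic num.simps)
  qed
  show ?thesis unfolding rel_prog_def runs_Seq[of load_prog]
    using load_prog[OF g(1,3) i m]
  proof (rule runs_mono, goal_cases)
    case (1 t g1 m1)
    then show ?case using A[of g1] by (simp only:)
  qed
qed

text \<open>Stripping a letter releases 20 units of potential: from the piece if it is non-empty,
  otherwise from the input suffix, a letter of which is worth \<open>step_cost\<close>, more than
  enough.\<close>

lemma piece_tl_decomposition:
  assumes "piece R q" "q @ z = a # w"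
  obtains q' z' where "piece R q'" "w = q' @ z'" "length z' \<le> length z"
    "step_cost * length z' + 20 * length q' + 20 \<le> step_cost * length z + 20 * length q"
    "length q = length q' + 1 \<and> length z' = length z \<or> q = [] \<and> q' = [] \<and> length z = length z' + 1"
proof (cases q)
  case Nil
  have "20 \<le> step_cost" unfolding step_cost_def by simp
  then show thesis using that[of "[]" w] assms Nil by simp
next
  case (Cons b q1)
  then have "q1 = drop 1 q" by simp
  then have "piece R q1" using piece_drop[OF assms(1)] by simp
  then show thesis using that[of q1 z] assms Cons by simp
qed

lemma liveI:
  assumes "regs_ok g" "mem_ok m" "g 11 = Num 1" "g 7 = Num x" "stack_at m x (q @ z)" "piece R q"
    "length z \<le> N" "g 9 = Num y" "word_at m y (q' @ z')" "y + length (q' @ z') = ve" "piece R q'"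
    "L \<le> y + length q'" "step_cost * length z + 20 * length q + 40 \<le> k"
    "ans \<longleftrightarrow> E (q @ z) (q' @ z')"
  shows "live k ans g m"
  unfolding live_def using assms by blast

text \<open>The two additional units pay for the test and the jump back of the surrounding
  loop.\<close>

lemma step_prog:
  fixes g m :: "'a regs"
  assumes l: "live k ans g m"
  shows "runs step_prog g m (\<lambda>t. outcome k ans (t + 2))"
proof -
  obtain x y q z q' z' where g: "regs_ok g" "g 11 = Num 1" "g 7 = Num x" "g 9 = Num y"
    and m: "mem_ok m" and u: "stack_at m x (q @ z)" "piece R q" "length z \<le> N"
    and v: "word_at m y (q' @ z')" "y + length (q' @ z') = ve" "piece R q'" "L \<le> y + length q'"
    and k: "step_cost * length z + 20 * length q + 40 \<le> k"
    and ans: "ans \<longleftrightarrow> E (q @ z) (q' @ z')"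
    using l unfolding live_def by blast
  note rd = regs_okD[OF g(1)]
  have xe: "x + length (q @ z) = ue" using u(1) by (simp add: stack_at_def)
  have k40: "40 \<le> k" using k by simp
  show ?thesis
  proof (cases "q @ z = []")
    case True
    \<comment> \<open>Only the empty word is equivalent to the empty word, and the program
      recognises it by \<open>y = ve\<close>.\<close>
    have "ans \<longleftrightarrow> q' @ z' = []" unfolding ans True using E_Nil by auto
    then have "ans \<longleftrightarrow> y = ve" using v(2) by auto
    moreover have "x = ue" using xe True by simp
    ultimately show ?thesis unfolding step_prog_def using rd g k40
      by (auto simp: outcome_def finished_def consts_ok_def)
  next
    case ne: False
    have xu: "x \<noteq> ue" using xe ne by auto
    have fl: "flag (q @ z) (m (x + F))"
      using u(1) unfolding stack_at_def flags_def by (metis add.right_neutral drop0)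
    show ?thesis
    proof (cases "act (q @ z)")
      case False
      then have f0: "m (x + F) = Num 0" using fl by (simp add: flag_def)
      obtain a w where w: "q @ z = a # w" using ne by (cases "q @ z") auto
      have ma: "m x = Gen a"
        using u(1) w word_at_Cons unfolding stack_at_def text_at_def by metis
      have iff: "ans \<longleftrightarrow> (\<exists>v'. q' @ z' = a # v' \<and> E w v')"
        unfolding ans w using not_act_Cons False w by metis
      show ?thesis
      proof (cases "m y = Gen a")
        case True
        have "q' @ z' \<noteq> []"
        proof
          assume "q' @ z' = []"
          then have "is_num (m y)" using v(2) m by (simp add: mem_ok_def)
          then show False using True by simp
        qed
        then obtain b w' where w': "q' @ z' = b # w'" by (cases "q' @ z'") auto
        have b: "b = a" using v(1) w' word_at_Cons True by (metis cell.inject(2))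
        obtain q1 z1 where u1: "piece R q1" "w = q1 @ z1" "length z1 \<le> length z"
          "step_cost * length z1 + 20 * length q1 + 20 \<le> step_cost * length z + 20 * length q"
          using piece_tl_decomposition[OF u(2) w] by blast
        obtain q2 z2 where v1: "piece R q2" "w' = q2 @ z2"
          "length q' = length q2 + 1 \<and> length z2 = length z' \<or> q' = [] \<and> q2 = [] \<and> length z' = length z2 + 1"
          using piece_tl_decomposition[OF v(3) w'] by blast
        have ans2: "ans \<longleftrightarrow> E (q1 @ z1) (q2 @ z2)" using iff w' b u1 v1 by simp
        have "stack_at m (Suc x) (q1 @ z1)" using stack_at_drop[OF u(1), of 1] w u1(2) by simp
        moreover have "word_at m (Suc y) (q2 @ z2)" using v(1) w' v1(2) by (simp add: word_at_Cons)
        moreover have "Suc y + length (q2 @ z2) = ve" using v(2) w' v1(2) by simp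
        moreover have "L \<le> Suc y + length q2" using v(4) v1(3) by auto
        moreover have "step_cost * length z1 + 20 * length q1 + 40 \<le> k - 20" using u1(4) k by simp
        ultimately have "live (k - 20) ans (g(12 := Num (x + F), 13 := Num 0, 14 := Gen a,
            15 := Gen a, 7 := Num (Suc x), 9 := Num (Suc y))) m"
          by (intro liveI[OF _ m _ _ _ u1(1) _ _ _ _ v1(1) _ _ ans2]) (use g u1(3) u(3) in auto)
        then have "outcome k ans 14 (g(12 := Num (x + F), 13 := Num 0, 14 := Gen a,
            15 := Gen a, 7 := Num (Suc x), 9 := Num (Suc y))) m"
          unfolding outcome_def using k40 by (intro disjI2 exI[of _ "k - 20"]) auto
        then have "outcome k ans 13 (g(12 := Num (x + F), 13 := Num 0, 14 := Gen a,
            15 := Gen a, 7 := Num (Suc x), 9 := Num (Suc y))) m"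
          by (rule outcome_mono) simp
        then show ?thesis unfolding step_prog_def using rd g xu f0 ma True
          by (auto simp: eval_nat_numeral elim!: outcome_mono)
      next
        case False
        have "\<not> ans"
        proof
          assume ans
          then obtain v' where "q' @ z' = a # v'" using iff by blast
          then show False using v(1) word_at_Cons False by metis
        qed
        then show ?thesis unfolding step_prog_def fail_prog_def using rd g xu f0 ma False k40
          by (auto simp: outcome_def finished_def consts_ok_def)
      qed
    next
      case True
      then obtain i where i: "i < length ws" "good (q @ z) i" "m (x + F) = Num (addr i)"
        using fl by (auto simp: flag_def)
      obtain u' where u': "q @ z = H (ws ! i) @ u'" "poss (Z (ws ! i)) u'"
        using i(2) unfolding good_def by blast
      \<comment> \<open>The decisive point for the running time: the piece \<open>q\<close> ends
        strictly inside the head, so applying a relation uses up a letter of \<open>z\<close>, which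
        pays \<open>step_cost\<close>.\<close>
      obtain h where h: "h \<noteq> []" "z = h @ u'"
        using piece_before_head[OF u(2) ws_in_W[OF i(1)] u'(1)] by blast
      then have lz: "length u' + 1 \<le> length z" by (cases h) auto
      then have "step_cost * (length u' + 1) \<le> step_cost * length z" by (rule mult_le_mono2)
      then have sc: "step_cost * length u' + step_cost + 40 \<le> k" using k by simp
      have "0 < length (ws ! i)" using relation_word_not_Nil ws_in_W[OF i(1)] by blast
      then have M1: "1 \<le> M" using word_length[OF nth_mem[OF i(1)]] by linarith
      \<comment> \<open>The products of \<open>M\<close> with the size of the table agree on both
        sides; the surplus per letter covers the constants as soon as
        \<open>1 \<le> M\<close>.\<close>
      have cost: "rest_cost + 30 * M + 160 \<le> step_cost + 40"
      proof -
        define d where "d = TE - T"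
        show ?thesis using M1 unfolding rest_cost_def prepend_cost_def step_cost_def d_def[symmetric]
          by (simp add: algebra_simps)
      qed
      let ?g1 = "g(12 := Num (x + F), 13 := Num (addr i))"
      have adn: "addr i \<noteq> 0" using T_le_addr[of i] T_pos by simp
      have "runs rel_prog ?g1 m (outcome (step_cost * length u' + rest_cost + 30 * M + 140)
          (E (H (ws ! i) @ u') (q' @ z')))"
        by (rule rel_prog[OF _ _ _ _ _ i(1) m _ _ u'(2) v])
          (use g u(1,3) u'(1) lz in simp_all)
      then have "runs rel_prog ?g1 m (\<lambda>t. outcome k ans (Suc (Suc (Suc (Suc (t + 4))))))"
      proof (rule runs_mono)
        fix t g' m'
        assume "outcome (step_cost * length u' + rest_cost + 30 * M + 140)
          (E (H (ws ! i) @ u') (q' @ z')) t g' m'"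
        then show "outcome k ans (Suc (Suc (Suc (Suc (t + 4))))) g' m'"
          unfolding ans u'(1) by (rule outcome_mono) (use sc cost in linarith)
      qed
      then show ?thesis unfolding step_prog_def using rd g xu i(3) adn
        by (auto simp: eval_nat_numeral elim!: runs_mono)
    qed
  qed
qed

lemma main_loop:
  fixes g m :: "'a regs"
  assumes "live k ans g m"
  shows "runs (While 11 0 step_prog) g m (\<lambda>t g' m'. t \<le> k + 1 \<and> (g' 2 = g' 1 \<longleftrightarrow> ans))"
proof -
  define I :: "nat \<Rightarrow> 'a regs \<Rightarrow> 'a regs \<Rightarrow> bool" where
    "I = (\<lambda>k g m. live k ans g m \<or> finished ans g)"
  have body: "runs step_prog g m (\<lambda>t g' m'. \<exists>n'. I n' g' m' \<and> t + 2 + n' \<le> n)"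
    if "I n g m" "g 11 \<noteq> g 0" for n g m
  proof -
    have "\<not> finished ans g" using that(2) consts_okD(1)[of g] by (auto simp: finished_def)
    then have "live n ans g m" using that(1) by (simp add: I_def)
    from step_prog[OF this] show ?thesis
    proof (rule runs_mono, goal_cases)
      case (1 t g' m')
      then show ?case unfolding outcome_def I_def by (metis add.right_neutral)
    qed
  qed
  have "I k g m" using assms by (simp add: I_def)
  then have "runs (While 11 0 step_prog) g m
      (\<lambda>t g' m'. g' 11 = g' 0 \<and> (\<exists>n'. I n' g' m' \<and> t + n' \<le> k + 1))"
    by (rule runs_While[where I = I, OF _ body])
  then show ?thesis
  proof (rule runs_mono, goal_cases)
    case (1 t g' m')
    then obtain n' where n': "live n' ans g' m' \<or> finished ans g'" by (auto simp: I_def)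
    moreover have "\<not> live n' ans g' m'" using 1 regs_okD(2)[of g'] by (auto simp: live_def)
    ultimately have "finished ans g'" by blast
    then show ?case using 1 consts_okD(2)[of g'] by (auto simp: finished_def)
  qed
qed

end

section \<open>Computing the tails of the relation words\<close>

text \<open>A suffix of a relation word is a piece iff it also ends at some other address of the table of
  records, so the longest common suffix is determined for all these addresses.\<close>

definition best_suffix_body :: com where
  "best_suffix_body =
    Cond 20 19
     (Ins (Copy 63 63))
     (Ins (Copy 60 19) ;; Ins (Copy 61 20) ;; common_suffix_prog ;; Ins (Sub 23 62 21) ;;
      Cond 23 0 (Ins (Copy 63 63)) (Ins (Copy 21 62))) ;;
    Ins (Add 20 20 1)"

definition best_suffix_prog :: com where
  "best_suffix_prog =
    While 20 22 best_suffix_body"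

definition tail_body :: com where
  "tail_body =
    Ins (Add 17 16 1) ;; Ins (Add 17 17 1) ;; Ins (Load 18 17) ;;
    Ins (Add 19 16 3) ;; Ins (Add 19 19 18) ;; Ins (Copy 20 4) ;; Ins (Copy 21 0) ;;
    best_suffix_prog ;;
    Ins (Add 17 16 1) ;; Ins (Store 17 21) ;; Ins (Copy 16 19)"

text \<open>The exclusive bound in register 22 is one more than \<open>TE\<close>, because the last
  relation word ends at the address \<open>TE\<close> itself.\<close>

definition tail_prog :: com where
  "tail_prog =
    Ins (Copy 16 4) ;; Ins (Add 22 5 1) ;;
    While 16 5 tail_body"

section \<open>Pieces as common suffixes in the table\<close>

context c4_relations
begin

text \<open>Converse of \<open>two_occurrences_piece\<close>: a non-empty piece has two different
  occurrences, and at least one of them is not the given one in \<open>r\<close> behind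
  \<open>a\<close>.\<close>

lemma piece_other_occurrence:
  assumes "piece R p" "p \<noteq> []"
  shows "\<exists>s\<in>W. \<exists>c d. s = c @ p @ d \<and> (s \<noteq> r \<or> c \<noteq> a)"
proof -
  have two: ?thesis if "s \<in> W" "t \<in> W" "sublist p s" "sublist p t" "s \<noteq> t" for s t
  proof (cases "s = r")
    case False
    then show ?thesis using that(1,3) unfolding sublist_def by blast
  next
    case True
    then have "t \<noteq> r" using that(5) by simp
    then show ?thesis using that(2,4) unfolding sublist_def by blast
  qed
  have sides: "fst e \<in> W" "snd e \<in> W" if "e \<in> R" for e
    using that by (auto simp: relation_words_def)
  consider "\<exists>e\<in>R. \<exists>f\<in>R. e \<noteq> f \<and> factor_of_side p e \<and> factor_of_side p f"
    | "\<exists>(l, r)\<in>R. sublist p l \<and> sublist p r" | "\<exists>w\<in>relation_words R. occurs_twice p w"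
    using assms unfolding piece_def by blast
  then show ?thesis
  proof cases
    case 1
    then obtain e f where e: "e \<in> R" "f \<in> R" "e \<noteq> f" "factor_of_side p e" "factor_of_side p f"
      by blast
    obtain s where s: "s = fst e \<or> s = snd e" "sublist p s"
      using e(4) unfolding factor_of_side_def by blast
    obtain t where t: "t = fst f \<or> t = snd f" "sublist p t"
      using e(5) unfolding factor_of_side_def by blast
    have W: "s \<in> W" "t \<in> W" using s(1) t(1) sides e(1,2) by blast+
    \<comment> \<open>A common side of two different relations would be a piece itself.\<close>
    have "s \<noteq> t"
    proof
      assume st: "s = t"
      have "factor_of_side s e" using s(1) by (auto simp: factor_of_side_def)
      moreover have "factor_of_side s f" using t(1) st by (auto simp: factor_of_side_def)
      ultimately have "piece R s" using factor_two_relations_piece e(1-3) by blast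
      then show False using not_piece W(1) by blast
    qed
    then show ?thesis using two W s(2) t(2) by blast
  next
    case 2
    then obtain l l' where l: "(l, l') \<in> R" "sublist p l" "sublist p l'" by blast
    then have "l \<noteq> l'" using partner_ne[of l l'] by (simp add: partner_def)
    then show ?thesis using two[of l l'] l sides[OF l(1)] by auto
  next
    case 3
    then obtain w x y x' y' where w: "w \<in> W" "w = x @ p @ y" "w = x' @ p @ y'" "x \<noteq> x'"
      unfolding occurs_twice_def by blast
    show ?thesis
    proof (cases "x = a")
      case True
      then have "x' \<noteq> a" using w(4) by simp
      then show ?thesis using w(1,3) by blast
    next
      case False
      then show ?thesis using w(1,2) by blast
    qed
  qed
qed

end

context word_machine
begin

abbreviation rend :: "nat \<Rightarrow> nat" where "rend i \<equiv> addr i + 3 + length (ws ! i)"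

lemma locate_address:
  assumes "n \<le> length ws" "T \<le> x" "x < addr n"
  shows "\<exists>i<n. \<exists>c<3 + length (ws ! i). x = addr i + c"
  using assms
proof (induction n)
  case (Suc n)
  show ?case
  proof (cases "x < addr n")
    case True
    then show ?thesis using Suc less_Suc_eq by auto
  next
    case False
    then have "x = addr n + (x - addr n)" "x - addr n < 3 + length (ws ! n)"
      using Suc.prems addr_Suc[of n] by auto
    then show ?thesis by (metis lessI)
  qed
qed (simp add: addr_0)

lemma letter_before_end:
  assumes "records zl m" "i < length ws" "j < length (ws ! i)"
  shows "m (rend i - 1 - j) = Gen (ws ! i ! (length (ws ! i) - 1 - j))"
proof -
  have "m (addr i + 3 + (length (ws ! i) - 1 - j)) = Gen (ws ! i ! (length (ws ! i) - 1 - j))"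
    using records_word(1)[OF assms(1,2), unfolded word_at_def, rule_format,
        of "length (ws ! i) - 1 - j"] assms(3) by simp
  moreover have "addr i + 3 + (length (ws ! i) - 1 - j) = rend i - 1 - j" using assms(3) by simp
  ultimately show ?thesis by simp
qed

text \<open>The \<open>K\<close> cells before \<open>e\<close> all hold generators, so they lie
  among the letters of a single record, and \<open>e \<noteq> rend i\<close> makes them a second
  occurrence of the suffix.\<close>

lemma common_suffix_is_piece:
  assumes rec: "records zl m" and i: "i < length ws" and T0: "is_num (m (T - 1))"
    and e: "T \<le> e" "e \<le> TE" "e \<noteq> rend i" and K: "K \<le> length (ws ! i)"
    and eq: "\<forall>j<K. m (rend i - 1 - j) = m (e - 1 - j)"
  shows "piece R (drop (length (ws ! i) - K) (ws ! i))"
proof (cases "K = 0")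
  case False
  let ?r = "ws ! i"
  have gen: "m (e - 1 - j) = Gen (?r ! (length ?r - 1 - j))" if "j < K" for j
    using letter_before_end[OF rec i, of j] eq that K by simp
  \<comment> \<open>The cell in front of the table holds a number, which bounds every comparison
    from below.\<close>
  have "e \<noteq> T"
  proof
    assume "e = T"
    then show False using gen[of 0] False T0 by simp
  qed
  then have "T \<le> e - 1" "e - 1 < addr (length ws)" using e T_pos by auto
  then obtain l c where l: "l < length ws" "c < 3 + length (ws ! l)" "e - 1 = addr l + c"
    using locate_address by blast
  let ?s = "ws ! l"
  note f = records_fields[OF rec l(1)]
  have head: "is_num (m (addr l + b))" if "b < 3" for b
  proof -
    have "b = 0 \<or> b = 1 \<or> b = 2" using that by auto
    then show ?thesis using f by auto
  qed
  have "3 \<le> c"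
  proof (rule ccontr)
    assume "\<not> 3 \<le> c"
    then show False using head[of c] gen[of 0] False l(3) by simp
  qed
  then obtain d where d: "c = 3 + d" by (metis le_Suc_ex)
  have dl: "d < length ?s" using l(2) d by simp
  \<comment> \<open>Otherwise the comparison would have run into the last header cell of record
    \<open>l\<close>, which holds a number.\<close>
  have Kd: "K \<le> d + 1"
  proof (rule ccontr)
    assume "\<not> K \<le> d + 1"
    then have "d + 1 < K" by simp
    then have "m (e - 1 - (d + 1)) = Gen (?r ! (length ?r - 1 - (d + 1)))" by (rule gen)
    moreover have "e - 1 - (d + 1) = addr l + 2" using l(3) d by simp
    ultimately show False using head[of 2] by simp
  qed
  have let_eq: "?s ! (d - j) = ?r ! (length ?r - 1 - j)" if "j < K" for j
  proof -
    have "m (addr l + 3 + (d - j)) = Gen (?s ! (d - j))"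
      using records_word(1)[OF rec l(1)] dl unfolding word_at_def by simp
    moreover have "addr l + 3 + (d - j) = e - 1 - j" using l(3) d that Kd by simp
    ultimately show ?thesis using gen[OF that] by simp
  qed
  let ?p = "drop (length ?r - K) ?r"
  have p: "take K (drop (d + 1 - K) ?s) = ?p"
  proof (rule nth_equalityI)
    show len: "length (take K (drop (d + 1 - K) ?s)) = length ?p" using K Kd dl by simp
    fix n assume "n < length (take K (drop (d + 1 - K) ?s))"
    then have n: "n < K" using len K by simp
    have "?s ! (d - (K - 1 - n)) = ?r ! (length ?r - 1 - (K - 1 - n))" 
      by (rule let_eq) (use n in simp)
    moreover have "d - (K - 1 - n) = d + 1 - K + n" "length ?r - 1 - (K - 1 - n) = length ?r - K + n"
      using n K Kd by auto
    ultimately show "take K (drop (d + 1 - K) ?s) ! n = ?p ! n" using n K Kd dl by simp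
  qed
  have s: "?s = take (d + 1 - K) ?s @ ?p @ drop K (drop (d + 1 - K) ?s)"
    unfolding p[symmetric] by (metis append_take_drop_id)
  have r: "?r = take (length ?r - K) ?r @ ?p @ []" by simp
  have "?r \<noteq> ?s \<or> take (length ?r - K) ?r \<noteq> take (d + 1 - K) ?s"
  proof (rule ccontr)
    assume "\<not> ?thesis"
    then have eqs: "?r = ?s" "take (length ?r - K) ?r = take (d + 1 - K) ?s" by auto
    have "l = i" using eqs(1) distinct_ws i l(1) by (metis nth_eq_iff_index_eq)
    have "length (take (length ?r - K) ?r) = length (take (d + 1 - K) ?s)" using eqs(2) by simp
    then have "length ?r - K = d + 1 - K" using K Kd dl by simp
    then have "length ?r = d + 1" using K Kd by simp
    then have "e = rend i" using l(3) d \<open>l = i\<close> e(1) T_pos by simp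
    then show False using e(3) by simp
  qed
  then show ?thesis using two_occurrences_piece[OF ws_in_W[OF i] ws_in_W[OF l(1)] r s] by blast
qed simp

text \<open>The address \<open>e\<close> is the end of the second occurrence. If it were
  \<open>rend i\<close>, both occurrences would lie in the same record at the same position.\<close>

lemma piece_is_common_suffix:
  assumes rec: "records zl m" and i: "i < length ws" and n: "0 < n" "n \<le> length (ws ! i)"
    and p: "piece R (drop (length (ws ! i) - n) (ws ! i))"
  shows "\<exists>e. T \<le> e \<and> e \<le> TE \<and> e \<noteq> rend i \<and> (\<forall>j<n. m (rend i - 1 - j) = m (e - 1 - j))"
proof -
  let ?r = "ws ! i"
  let ?p = "drop (length ?r - n) ?r"
  have lp: "length ?p = n" using n by simp
  then have pne: "?p \<noteq> []" using n(1) by auto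
  obtain s c d where s: "s \<in> W" "s = c @ ?p @ d" "s \<noteq> ?r \<or> c \<noteq> take (length ?r - n) ?r"
    using piece_other_occurrence[OF p pne] by metis
  obtain l where l: "l < length ws" "s = ws ! l" using s(1) set_ws by (metis in_set_conv_nth)
  have ls: "length (ws ! l) = length c + n + length d" using s(2) l(2) lp by (metis add.assoc length_append)
  define e where "e = addr l + 3 + length c + n"
  have e: "T \<le> e" "e \<le> TE" using T_le_addr[of l] record_end[OF l(1)] ls unfolding e_def by auto
  have "e \<noteq> rend i"
  proof
    assume er: "e = rend i"
    have "\<not> l < i"
    proof
      assume "l < i"
      then have "addr (Suc l) \<le> addr i" by (intro addr_mono) simp
      then show False using er addr_Suc[OF l(1)] ls n unfolding e_def by simp
    qed
    moreover have "\<not> i < l"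
    proof
      assume "i < l"
      then have "addr (Suc i) \<le> addr l" by (intro addr_mono) simp
      then show False using er addr_Suc[OF i] unfolding e_def by simp
    qed
    ultimately have "l = i" by simp
    then have sr: "s = ?r" using l(2) by simp
    have "length c + n = length ?r" using er \<open>l = i\<close> unfolding e_def by simp
    moreover have "c = take (length c) ?r" using s(2) sr by (metis append_eq_conv_conj)
    ultimately have "c = take (length ?r - n) ?r" by (metis add_diff_cancel_right')
    then show False using s(3) sr by simp
  qed
  moreover have "m (rend i - 1 - j) = m (e - 1 - j)" if j: "j < n" for j
  proof -
    have "m (addr l + 3 + (length c + (n - 1 - j))) = Gen (ws ! l ! (length c + (n - 1 - j)))"
      using records_word(1)[OF rec l(1), unfolded word_at_def, rule_format,
          of "length c + (n - 1 - j)"] ls n j by simp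
    moreover have "addr l + 3 + (length c + (n - 1 - j)) = e - 1 - j" using j unfolding e_def by simp
    moreover have "ws ! l ! (length c + (n - 1 - j)) = ?p ! (n - 1 - j)"
    proof -
      have "(c @ ?p @ d) ! (length c + (n - 1 - j)) = ?p ! (n - 1 - j)"
        using lp j unfolding nth_append_length_plus by (simp add: nth_append)
      then show ?thesis using s(2) l(2) by simp
    qed
    moreover have "?p ! (n - 1 - j) = ?r ! (length ?r - 1 - j)"
    proof -
      have "length ?r - n + (n - 1 - j) = length ?r - 1 - j" using n j by simp
      then show ?thesis using n(2) by simp
    qed
    ultimately show ?thesis using letter_before_end[OF rec i, of j] n j by simp
  qed
  ultimately show ?thesis using e by blast
qed

text \<open>Agreement along the whole of \<open>ws ! i\<close> would make this relation word a
  piece, so the comparison stops within its length.\<close>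

lemma first_mismatch:
  assumes rec: "records zl m" and i: "i < length ws" and T0: "is_num (m (T - 1))"
    and e: "T \<le> e" "e \<le> TE" "e \<noteq> rend i"
  obtains K where "K < length (ws ! i)" "\<forall>j<K. m (rend i - 1 - j) = m (e - 1 - j)"
    "m (rend i - 1 - K) \<noteq> m (e - 1 - K)"
proof -
  have ex: "\<exists>K<length (ws ! i). m (rend i - 1 - K) \<noteq> m (e - 1 - K)"
  proof (rule ccontr)
    assume "\<not> ?thesis"
    then have "\<forall>j<length (ws ! i). m (rend i - 1 - j) = m (e - 1 - j)" by blast
    from common_suffix_is_piece[OF rec i T0 e _ this] have "piece R (ws ! i)" by simp
    then show False using not_piece ws_in_W[OF i] by blast
  qed
  define K where "K = (LEAST K. m (rend i - 1 - K) \<noteq> m (e - 1 - K))"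
  have "m (rend i - 1 - K) \<noteq> m (e - 1 - K)" unfolding K_def by (rule LeastI_ex) (use ex in blast)
  moreover have "\<forall>j<K. m (rend i - 1 - j) = m (e - 1 - j)"
    unfolding K_def using not_less_Least by blast
  moreover have "K < length (ws ! i)"
    using ex unfolding K_def by (metis (mono_tags, lifting) Least_le le_less_trans)
  ultimately show thesis using that by blast
qed

text \<open>Holds for any \<open>zl\<close>: tail lengths entered before are numbers and match no
  letter, so the table may be completed while it is being searched.\<close>

lemma best_suffix_prog:
  fixes g m :: "'a regs"
  assumes c: "consts_ok g" and i: "i < length ws"
    and g: "g 19 = Num (rend i)" "g 20 = Num T" "g 21 = Num 0" "g 22 = Num (TE + 1)"
    and rec: "records zl m" and T0: "is_num (m (T - 1))"
  shows "runs best_suffix_prog g m (\<lambda>t g' m'. m' = m \<and> same_below 20 g g' \<and>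
    (\<forall>r. 24 \<le> r \<longrightarrow> r < 60 \<longrightarrow> g' r = g r) \<and> g' 22 = g 22 \<and>
    t \<le> (TE + 1 - T) * (10 * length (ws ! i) + 50) + 1 \<and> g' 21 = Num (zlen i))"
proof -
  let ?r = "ws ! i"
  let ?c = "10 * length ?r + 50"
  define match where "match = (\<lambda>e n. \<forall>j<n. m (rend i - 1 - j) = m (e - 1 - j))"
  define I :: "nat \<Rightarrow> 'a regs \<Rightarrow> 'a regs \<Rightarrow> bool" where
    "I = (\<lambda>k g' m'. m' = m \<and> same_below 20 g g' \<and>
      (\<forall>r. 24 \<le> r \<longrightarrow> r < 60 \<longrightarrow> g' r = g r) \<and> g' 22 = g 22 \<and>
      (\<exists>e b. T \<le> e \<and> e \<le> TE + 1 \<and> g' 20 = Num e \<and> g' 21 = Num b \<and> k = (TE + 1 - e) * ?c \<and>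
        b \<le> length ?r \<and> piece R (drop (length ?r - b) ?r) \<and>
        (\<forall>e' n. T \<le> e' \<longrightarrow> e' < e \<longrightarrow> e' \<noteq> rend i \<longrightarrow> match e' n \<longrightarrow> n \<le> b)))"
  have body: "runs best_suffix_body g' m' (\<lambda>t g2 m2. \<exists>n'. I n' g2 m2 \<and> t + 2 + n' \<le> k)"
    if inv: "I k g' m'" and ne: "g' 20 \<noteq> g' 22" for k g' m'
  proof -
    note [simp] = best_suffix_body_def
    have sb: "same_below 20 g g'" and m': "m' = m" and g22: "g' 22 = Num (TE + 1)"
      and fr: "\<forall>r. 24 \<le> r \<longrightarrow> r < 60 \<longrightarrow> g' r = g r"
      using inv g by (auto simp: I_def)
    have c': "consts_ok g'" using same_below_consts[OF sb] c by simp
    have g19: "g' 19 = Num (rend i)" using same_belowD[OF sb] g by simp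
    obtain e b where e: "T \<le> e" "e \<le> TE + 1" "g' 20 = Num e" "g' 21 = Num b" "k = (TE + 1 - e) * ?c"
      "b \<le> length ?r" "piece R (drop (length ?r - b) ?r)"
      "\<forall>e' n. T \<le> e' \<longrightarrow> e' < e \<longrightarrow> e' \<noteq> rend i \<longrightarrow> match e' n \<longrightarrow> n \<le> b"
      using inv by (auto simp: I_def)
    have eT: "e \<le> TE" using e(2,3) ne g22 by simp
    have kc: "k = (TE + 1 - Suc e) * ?c + ?c"
    proof -
      have "TE + 1 - e = Suc (TE + 1 - Suc e)" using eT by simp
      then show ?thesis using e(5) by simp
    qed
    show ?thesis
    proof (cases "e = rend i")
      case True
      have "I ((TE + 1 - Suc e) * ?c) (g'(63 := g' 63, 20 := Num (Suc e))) m"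
        unfolding I_def
        by (intro conjI exI[of _ "Suc e"] exI[of _ b])
          (use sb fr g22 g e eT True in \<open>auto simp: less_Suc_eq\<close>)
      moreover have "5 + (TE + 1 - Suc e) * ?c \<le> k" using kc by simp
      ultimately show ?thesis using True e(3) g19 m' consts_okD[OF c'] by auto
    next
      case False
      obtain K where K: "K < length ?r" "\<forall>j<K. m (rend i - 1 - j) = m (e - 1 - j)"
        "m (rend i - 1 - K) \<noteq> m (e - 1 - K)"
        using first_mismatch[OF rec i T0 e(1) eT False] .
      have pK: "piece R (drop (length ?r - K) ?r)"
        using common_suffix_is_piece[OF rec i T0 e(1) eT False _ K(2)] K(1) by simp
      have mK: "n \<le> K" if "match e n" for n
      proof (rule ccontr)
        assume "\<not> n \<le> K"
        then show False using that K(3) unfolding match_def by auto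
      qed
      let ?g1 = "g'(60 := Num (rend i), 61 := Num e)"
      have c1: "consts_ok ?g1" using c' by simp
      have next_I: "I ((TE + 1 - Suc e) * ?c) g2 m"
        if "same_below 20 g g2" "\<forall>r. 24 \<le> r \<longrightarrow> r < 60 \<longrightarrow> g2 r = g r" "g2 22 = g 22" "g2 20 = Num (Suc e)" "g2 21 = Num (max b K)" for g2
      proof -
        have "piece R (drop (length ?r - max b K) ?r)" using pK e(7) by (simp add: max_def)
        moreover have "\<forall>e' n. T \<le> e' \<longrightarrow> e' < Suc e \<longrightarrow> e' \<noteq> rend i \<longrightarrow> match e' n \<longrightarrow> n \<le> max b K"
          using e(8) mK by (auto simp: less_Suc_eq le_max_iff_disj)
        moreover have "T \<le> Suc e" "Suc e \<le> TE + 1" "max b K \<le> length ?r" using e eT K(1) by auto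
        ultimately show ?thesis unfolding I_def using that by blast
      qed
      have "runs common_suffix_prog ?g1 m (\<lambda>t g' m'. m' = m \<and> same_below 60 ?g1 g' \<and>
          t \<le> 10 * K + 20 \<and> g' 62 = Num K)"
        by (rule common_suffix_prog[OF c1 _ _ K(2,3)]) simp_all
      then have "runs common_suffix_prog ?g1 m (\<lambda>t1 g1 m1. runs (Ins (Sub 23 62 21) ;;
        Cond 23 0 (Ins (Copy 63 63)) (Ins (Copy 21 62))) g1 m1 (\<lambda>t2 g2 m2.
          \<exists>n'. I n' (g2(20 := Num (Suc (num (g2 20))))) m2 \<and> t1 + t2 + 20 + n' \<le> k))"
      proof (rule runs_mono, goal_cases)
        case (1 t1 g1 m1)
        then have m1: "m1 = m" and sb1: "same_below 60 ?g1 g1" and t1: "t1 \<le> 10 * K + 20"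
          and g62: "g1 62 = Num K" by auto
        have c2: "consts_ok g1" using same_below_consts[OF sb1] c1 by simp
        have sb2: "same_below 20 g g1" using sb sb1 unfolding same_below_def by auto
        have fr1: "\<forall>r. 24 \<le> r \<longrightarrow> r < 60 \<longrightarrow> g1 r = g r"
          using fr sb1 unfolding same_below_def by auto
        have gs: "g1 20 = Num e" "g1 21 = Num b" "g1 22 = Num (TE + 1)"
          using same_belowD[OF sb1] e g22 by auto
        have bound: "t1 + 24 + (TE + 1 - Suc e) * ?c \<le> k" using t1 K(1) kc by simp
        show ?case
        proof (cases "K \<le> b")
          case True
          then have "I ((TE + 1 - Suc e) * ?c) (g1(23 := Num 0, 63 := g1 63, 20 := Num (Suc e))) m"
            by (intro next_I) (use sb2 fr1 gs g in \<open>simp_all add: max_def\<close>)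
          then show ?thesis using True bound gs g62 m1 consts_okD[OF c2] by auto
        next
          case False
          then have "I ((TE + 1 - Suc e) * ?c) (g1(23 := Num (K - b), 21 := Num K, 20 := Num (Suc e))) m"
            by (intro next_I) (use sb2 fr1 gs g in \<open>simp_all add: max_def\<close>)
          then show ?thesis using False bound gs g62 m1 consts_okD[OF c2] by auto
        qed
      qed
      then have "runs (Cond 20 19
       (Ins (Copy 63 63))
       (Ins (Copy 60 19) ;; Ins (Copy 61 20) ;; common_suffix_prog ;; Ins (Sub 23 62 21) ;;
        Cond 23 0 (Ins (Copy 63 63)) (Ins (Copy 21 62)))) g' m (\<lambda>t g2 m2.
          \<exists>n'. I n' (g2(20 := Num (Suc (num (g2 20))))) m2 \<and> t + 10 + n' \<le> k)"
        using False e(3) g19 unfolding runs_Cond runs_Seq runs_basic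
        by (auto elim!: runs_mono) (rule exI, rule conjI, assumption, simp)+
      then show ?thesis unfolding m' best_suffix_body_def runs_Seq[of "Cond 20 19 _ _"]
      proof (rule runs_mono, goal_cases)
        case (1 t g2 m2)
        then obtain n' where n': "I n' (g2(20 := Num (Suc (num (g2 20))))) m2" "t + 10 + n' \<le> k"
          by blast
        then have "(g2(20 := Num (Suc (num (g2 20))))) 0 = Num 0" "(g2(20 := Num (Suc (num (g2 20))))) 1 = Num 1"
          using c consts_okD(1,2)[OF c] same_belowD[of 20 g "g2(20 := Num (Suc (num (g2 20))))"]
          unfolding I_def by auto
        then show ?case using n' by (auto intro!: exI[of _ n'])
      qed
    qed
  qed
  have init: "I ((TE + 1 - T) * ?c) g m"
    unfolding I_def
    by (intro conjI exI[of _ T] exI[of _ 0]) (use g T_le_addr[of "length ws"] in auto)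
  have "runs best_suffix_prog g m
      (\<lambda>t g' m'. g' 20 = g' 22 \<and> (\<exists>n'. I n' g' m' \<and> t + n' \<le> (TE + 1 - T) * ?c + 1))"
    unfolding best_suffix_prog_def by (rule runs_While[where I = I, OF init body])
  then show ?thesis
  proof (rule runs_mono, goal_cases)
    case (1 t g' m')
    then obtain n' where ii: "I n' g' m'" and t: "t + n' \<le> (TE + 1 - T) * ?c + 1" by auto
    then obtain e b where e: "g' 20 = Num e" "g' 21 = Num b" "b \<le> length ?r"
      "piece R (drop (length ?r - b) ?r)"
      "\<forall>e' n. T \<le> e' \<longrightarrow> e' < e \<longrightarrow> e' \<noteq> rend i \<longrightarrow> match e' n \<longrightarrow> n \<le> b"
      by (auto simp: I_def)
    have eT: "e = TE + 1" using 1 e(1) ii g by (auto simp: I_def)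
    have "b \<le> tail_length R ?r" using tail_length_properties(3)[OF e(3,4)] .
    moreover have "tail_length R ?r \<le> b"
    proof (cases "tail_length R ?r = 0")
      case False
      then obtain e' where "T \<le> e'" "e' \<le> TE" "e' \<noteq> rend i" "match e' (tail_length R ?r)"
        using piece_is_common_suffix[OF rec i, of "tail_length R ?r"] tail_length_properties(1,2)[of ?r]
        unfolding match_def by blast
      then show ?thesis using e(5) eT by auto
    qed simp
    ultimately have "b = zlen i" by (simp add: zlen_def length_Z)
    then show ?case using ii t e(2) by (auto simp: I_def)
  qed
qed

text \<open>Each relation word is compared with every address of the table, in time linear in that
  word; summed over the records this is quadratic in the size of the table.\<close>

lemma tail_prog:
  fixes g m :: "'a regs"
  assumes c: "consts_ok g" and g: "g 4 = Num T" "g 5 = Num TE"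
    and rec: "records (\<lambda>_. 0) m" and T0: "is_num (m (T - 1))"
  shows "runs tail_prog g m (\<lambda>t g' m'. same_below 16 g g' \<and>
    (\<forall>r. 24 \<le> r \<longrightarrow> r < 60 \<longrightarrow> g' r = g r) \<and> records zlen m' \<and>
    (\<forall>x. x < T \<or> TE \<le> x \<longrightarrow> m' x = m x) \<and> t \<le> (TE - T) * (40 * (TE + 1 - T) + 40) + 10)"
proof -
  let ?c = "40 * (TE + 1 - T) + 40"
  \<comment> \<open>Records before number \<open>i\<close> have their tail lengths already; the
    others still have the initial 0.\<close>
  define zl where "zl = (\<lambda>i j. if j < i then zlen j else 0)"
  define I :: "nat \<Rightarrow> 'a regs \<Rightarrow> 'a regs \<Rightarrow> bool" where
    "I = (\<lambda>k g' m'. same_below 16 g g' \<and> g' 22 = Num (TE + 1) \<and>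
      (\<forall>r. 24 \<le> r \<longrightarrow> r < 60 \<longrightarrow> g' r = g r) \<and> (\<forall>x. x < T \<or> TE \<le> x \<longrightarrow> m' x = m x) \<and>
      (\<exists>i\<le>length ws. g' 16 = Num (addr i) \<and> k = (TE - addr i) * ?c \<and> records (zl i) m'))"
  have body: "runs tail_body g' m'
      (\<lambda>t g2 m2. \<exists>n'. I n' g2 m2 \<and> t + 2 + n' \<le> k)"
    if inv: "I k g' m'" and ne: "g' 16 \<noteq> g' 5" for k g' m'
  proof -
    note [simp] = tail_body_def
    have sb: "same_below 16 g g'" and g22: "g' 22 = Num (TE + 1)"
      and fr: "\<forall>r. 24 \<le> r \<longrightarrow> r < 60 \<longrightarrow> g' r = g r"
      and out: "\<forall>x. x < T \<or> TE \<le> x \<longrightarrow> m' x = m x" using inv by (auto simp: I_def)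
    have c': "consts_ok g'" using same_below_consts[OF sb] c by simp
    have g45: "g' 4 = Num T" "g' 5 = Num TE" using same_belowD[OF sb] g by auto
    obtain i where i0: "i \<le> length ws" "g' 16 = Num (addr i)" "k = (TE - addr i) * ?c"
      "records (zl i) m'" using inv by (auto simp: I_def)
    have i: "i < length ws" using i0(1,2) ne g45 by (metis le_neq_implies_less)
    have T0': "is_num (m' (T - 1))" using T0 out T_pos by simp
    note f = records_fields[OF i0(4) i]
    have kc: "(TE - addr (Suc i)) * ?c + (3 + length (ws ! i)) * ?c \<le> k"
    proof -
      have "TE - addr i = (TE - addr (Suc i)) + (3 + length (ws ! i))"
        using addr_Suc[OF i] record_end[OF i] by simp
      then show ?thesis using i0(3) by (simp only: add_mult_distrib)
    qed
    let ?g1 = "g'(17 := Num (Suc (Suc (addr i))), 18 := Num (length (ws ! i)), 19 := Num (rend i),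
      20 := Num T, 21 := Num 0)"
    have c1: "consts_ok ?g1" using c' by simp
    have "runs best_suffix_prog ?g1 m' (\<lambda>t g2 m2. m2 = m' \<and> same_below 20 ?g1 g2 \<and>
      (\<forall>r. 24 \<le> r \<longrightarrow> r < 60 \<longrightarrow> g2 r = ?g1 r) \<and> g2 22 = ?g1 22 \<and>
      t \<le> (TE + 1 - T) * (10 * length (ws ! i) + 50) + 1 \<and> g2 21 = Num (zlen i))"
      by (rule best_suffix_prog[OF c1 i _ _ _ _ i0(4) T0']) (use g22 in simp_all)
    then have "runs best_suffix_prog ?g1 m' (\<lambda>t1 g1 m1. runs (Ins (Add 17 16 1) ;;
        Ins (Store 17 21) ;; Ins (Copy 16 19)) g1 m1
        (\<lambda>t2 g2 m2. \<exists>n'. I n' g2 m2 \<and> 7 + (t1 + t2) + 2 + n' \<le> k))"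
    proof (rule runs_mono, goal_cases)
      case (1 t1 g1 m1)
      then have m1: "m1 = m'" and sb1: "same_below 20 ?g1 g1" and z: "g1 21 = Num (zlen i)"
        and fr1: "\<forall>r. 24 \<le> r \<longrightarrow> r < 60 \<longrightarrow> g1 r = ?g1 r" and g1: "g1 22 = Num (TE + 1)"
        and t1: "t1 \<le> (TE + 1 - T) * (10 * length (ws ! i) + 50) + 1" using g22 by auto
      have c2: "consts_ok g1" using same_below_consts[OF sb1] c1 by simp
      have gs: "g1 16 = Num (addr i)" "g1 19 = Num (rend i)" using same_belowD[OF sb1] i0 by auto
      let ?m2 = "m'(Suc (addr i) := Num (zlen i))"
      let ?g2 = "g1(17 := Num (Suc (addr i)), 16 := Num (rend i))"
      have "records (zl (Suc i)) ?m2"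
      proof -
        have other: "?m2 (addr j + b) = m' (addr j + b)"
          if "j < length ws" "b < 3 + length (ws ! j)" "b \<noteq> 1 \<or> j \<noteq> i" for j b
        proof -
          have "addr j + b \<noteq> Suc (addr i)"
          proof
            assume eq: "addr j + b = Suc (addr i)"
            show False
            proof (cases j i rule: linorder_cases)
              case less
              then have "addr (Suc j) \<le> addr i" by (intro addr_mono) simp
              then show False using eq that(2) addr_Suc[OF that(1)] by simp
            next
              case equal
              then show False using eq that(3) by simp
            next
              case greater
              then have "addr (Suc i) \<le> addr j" by (intro addr_mono) simp
              then show False using eq addr_Suc[OF i] by simp
            qed
          qed
          then show ?thesis by simp
        qed
        have "?m2 (addr j) = Num (addr (pidx j)) \<and> ?m2 (addr j + 1) = Num (zl (Suc i) j) \<and>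
          ?m2 (addr j + 2) = Num (length (ws ! j)) \<and> word_at ?m2 (addr j + 3) (ws ! j)"
          if j: "j < length ws" for j
        proof -
          note fj = records_fields[OF i0(4) j]
          have "?m2 (addr j) = m' (addr j)" "?m2 (addr j + 2) = m' (addr j + 2)"
            using other[OF j, of 0] other[OF j, of 2] by auto
          moreover have "word_at ?m2 (addr j + 3) (ws ! j)"
            using records_word(1)[OF i0(4) j] other[OF j, of "3 + _"]
            by (simp add: word_at_def add.assoc del: fun_upd_apply)
          moreover have "?m2 (addr j + 1) = Num (zl (Suc i) j)"
          proof (cases "j = i")
            case True
            then show ?thesis by (simp add: zl_def)
          next
            case False
            then have "?m2 (addr j + 1) = m' (addr j + 1)" using other[OF j, of 1] by simp
            moreover have "zl (Suc i) j = zl i j" using False by (auto simp: zl_def)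
            ultimately show ?thesis using fj by simp
          qed
          ultimately show ?thesis using fj by simp
        qed
        moreover have "is_num (?m2 TE)"
          using i0(4) by (simp add: records_def)
        ultimately show ?thesis unfolding records_def by blast
      qed
      moreover have "same_below 16 g ?g2" using sb sb1 unfolding same_below_def by auto
      moreover have "\<forall>x. x < T \<or> TE \<le> x \<longrightarrow> ?m2 x = m x"
        using out record_end[OF i] T_le_addr[of i] by auto
      moreover have "\<forall>r. 24 \<le> r \<longrightarrow> r < 60 \<longrightarrow> ?g2 r = g r" using fr fr1 by auto
      moreover have "rend i = addr (Suc i)" using addr_Suc[OF i] by simp
      ultimately have "I ((TE - addr (Suc i)) * ?c) ?g2 ?m2"
        unfolding I_def using i g1 by (intro conjI exI[of _ "Suc i"]) auto
      moreover have "7 + (t1 + 3) + 2 + (TE - addr (Suc i)) * ?c \<le> k"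
      proof -
        define d where "d = TE + 1 - T"
        have "t1 + 12 \<le> (3 + length (ws ! i)) * ?c"
          using t1 unfolding d_def[symmetric] by (simp add: algebra_simps)
        then show ?thesis using kc by linarith
      qed
      ultimately show ?case using gs z m1 consts_okD[OF c2] by auto
    qed
    then show ?thesis using i0(2) g45 f consts_okD[OF c'] by (auto elim!: runs_mono)
  qed
  have init: "I ((TE - T) * ?c) (g(16 := Num T, 22 := Num (TE + 1))) m"
    unfolding I_def
    by (intro conjI exI[of _ 0]) (use rec addr_0 in \<open>auto simp: zl_def\<close>)
  have "runs (While 16 5
     tail_body)
      (g(16 := Num T, 22 := Num (TE + 1))) m
      (\<lambda>t g' m'. g' 16 = g' 5 \<and> (\<exists>n'. I n' g' m' \<and> t + n' \<le> (TE - T) * ?c + 1))"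
    by (rule runs_While[where I = I, OF init body])
  then have "runs tail_prog g m
      (\<lambda>t g' m'. g' 16 = g' 5 \<and> (\<exists>n'. I n' g' m' \<and> t + n' \<le> (TE - T) * ?c + 3))"
    unfolding tail_prog_def using g consts_okD[OF c] by (auto elim!: runs_mono)
  then show ?thesis
  proof (rule runs_mono, goal_cases)
    case (1 t g' m')
    then obtain n' where ii: "I n' g' m'" and t: "t + n' \<le> (TE - T) * ?c + 3" by auto
    then obtain i where i: "i \<le> length ws" "g' 16 = Num (addr i)" "records (zl i) m'"
      by (auto simp: I_def)
    have "g' 5 = Num TE" using ii g same_belowD[of 16 g g' 5] by (auto simp: I_def)
    then have "addr i = TE" using 1 i(2) by simp
    then have il: "i = length ws" using i(1) addr_Suc[of i] record_end[of i] by fastforce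
    have "records zlen m'" using i(3) unfolding il records_def by (simp add: zl_def)
    then show ?case using ii t by (auto simp: I_def)
  qed
qed

end

section \<open>Reading the input\<close>

text \<open>Called twice per relation with the two record addresses exchanged, which links the
  partners. The tail length is set to 0 and is filled in by \<open>tail_prog\<close>.\<close>

definition record_prog :: "nat \<Rightarrow> nat \<Rightarrow> com" where
  "record_prog d e =
    Ins (Load 18 16) ;; Ins (Store d e) ;; Ins (Add 30 d 1) ;; Ins (Store 30 0) ;;
    Ins (Add 30 30 1) ;; Ins (Store 30 18) ;;
    Ins (Add 60 16 1) ;; Ins (Add 61 d 3) ;; Ins (Copy 62 18) ;; copy_prog ;;
    Ins (Add 16 16 18) ;; Ins (Add 16 16 1)"

definition table_body :: com where
  "table_body =
    Ins (Load 18 16) ;; Ins (Add 29 28 3) ;; Ins (Add 29 29 18) ;;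
    record_prog 28 29 ;; record_prog 29 28 ;;
    Ins (Add 28 29 3) ;; Ins (Add 28 28 18) ;; Ins (Sub 17 17 1)"

definition table_prog :: com where
  "table_prog =
    Ins (Copy 16 15) ;; Ins (Copy 28 4) ;; Ins (Copy 17 14) ;;
    While 17 0 table_body ;;
    Ins (Copy 5 28)"

definition parse_body :: com where
  "parse_body =
    Ins (Load 18 16) ;; Ins (Add 16 16 18) ;; Ins (Add 16 16 1) ;;
    Ins (Load 18 16) ;; Ins (Add 16 16 18) ;; Ins (Add 16 16 1) ;; Ins (Sub 17 17 1)"

text \<open>Only length cells are read and all letters are skipped, so the time depends on the
  number of relations alone. By \<open>Add 4 24 1\<close> one cell with 0 remains between input and
  table: it ends the last input word and bounds the table from below.\<close>

definition parse_prog :: com where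
  "parse_prog =
    Ins (Const 1 1) ;; Ins (Const 3 3) ;; Ins (Load 12 0) ;; Ins (Add 13 12 1) ;; Ins (Load 14 13) ;;
    Ins (Add 15 13 1) ;; Ins (Copy 16 15) ;; Ins (Copy 17 14) ;;
    While 17 0 parse_body ;;
    Ins (Load 19 16) ;; Ins (Add 20 16 1) ;; Ins (Add 21 20 19) ;; Ins (Load 22 21) ;;
    Ins (Add 23 21 1) ;; Ins (Add 24 23 22) ;; Ins (Sub 25 19 22) ;;
    Cond 25 0
     (Ins (Copy 26 20) ;; Ins (Copy 27 19) ;; Ins (Copy 9 23) ;; Ins (Copy 10 24))
     (Ins (Copy 26 23) ;; Ins (Copy 27 22) ;; Ins (Copy 9 20) ;; Ins (Copy 10 21)) ;;
    Ins (Add 4 24 1)"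

lemma record_prog:
  fixes g m :: "'a regs"
  assumes c: "consts_ok g" and de: "d = 28 \<or> d = 29" "e = 28 \<or> e = 29"
    and g: "g 16 = Num p" "g d = Num t" "g e = Num q"
    and m: "m p = Num (length w)" "word_at m (p + 1) w" and le: "p + 1 + length w \<le> t"
  shows "runs (record_prog d e) g m (\<lambda>s g' m'. s \<le> 10 * length w + 30 \<and>
    (\<forall>r<60. r \<noteq> 16 \<longrightarrow> r \<noteq> 18 \<longrightarrow> r \<noteq> 30 \<longrightarrow> g' r = g r) \<and>
    g' 16 = Num (p + 1 + length w) \<and> g' 18 = Num (length w) \<and>
    m' t = Num q \<and> m' (t + 1) = Num 0 \<and> m' (t + 2) = Num (length w) \<and> word_at m' (t + 3) w \<and>
    (\<forall>x. x < t \<or> t + 3 + length w \<le> x \<longrightarrow> m' x = m x))"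
proof -
  let ?m1 = "m(t := Num q, t + 1 := Num 0, t + 2 := Num (length w))"
  let ?g1 = "g(18 := Num (length w), 30 := Num (t + 2), 60 := Num (p + 1), 61 := Num (t + 3),
    62 := Num (length w))"
  have dn: "d \<noteq> 18" "d \<noteq> 30" "d \<noteq> 60" "e \<noteq> 18" using de by auto
  have c1: "consts_ok ?g1" using c by simp
  have w1: "word_at ?m1 (p + 1) w" using m(2) le by (simp add: word_at_def)
  have "runs copy_prog ?g1 ?m1 (\<lambda>s g' m'. same_below 60 ?g1 g' \<and> s \<le> 10 * length w + 10 \<and>
    m' = (\<lambda>x. if t + 3 \<le> x \<and> x < t + 3 + length w then ?m1 (p + 1 + (x - (t + 3))) else ?m1 x))"
    by (rule copy_prog[OF c1]) (use le in simp_all)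
  then have "runs copy_prog ?g1 ?m1 (\<lambda>s g2 m2. runs (Ins (Add 16 16 18) ;; Ins (Add 16 16 1)) g2 m2
    (\<lambda>s2 g' m'. s + s2 + 9 \<le> 10 * length w + 30 \<and>
    (\<forall>r<60. r \<noteq> 16 \<longrightarrow> r \<noteq> 18 \<longrightarrow> r \<noteq> 30 \<longrightarrow> g' r = g r) \<and>
    g' 16 = Num (p + 1 + length w) \<and> g' 18 = Num (length w) \<and>
    m' t = Num q \<and> m' (t + 1) = Num 0 \<and> m' (t + 2) = Num (length w) \<and> word_at m' (t + 3) w \<and>
    (\<forall>x. x < t \<or> t + 3 + length w \<le> x \<longrightarrow> m' x = m x)))"
  proof (rule runs_mono, goal_cases)
    case (1 s g2 m2)
    then have sb: "same_below 60 ?g1 g2" and s: "s \<le> 10 * length w + 10"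
      and m2: "m2 = (\<lambda>x. if t + 3 \<le> x \<and> x < t + 3 + length w then ?m1 (p + 1 + (x - (t + 3))) else ?m1 x)"
      by auto
    note sd = same_belowD[OF sb]
    have "g2 16 = Num p" "g2 18 = Num (length w)" "g2 1 = Num 1" "g2 (Suc 0) = Num 1"
      using sd g consts_okD[OF c] by auto
    moreover have "word_at m2 (t + 3) w"
      unfolding m2 using w1 by (simp add: word_at_def del: fun_upd_apply)
    moreover have "m2 t = Num q" "m2 (t + 1) = Num 0" "m2 (t + 2) = Num (length w)"
      "\<forall>x. x < t \<or> t + 3 + length w \<le> x \<longrightarrow> m2 x = m x"
      unfolding m2 by auto
    moreover have "\<forall>r<60. r \<noteq> 16 \<longrightarrow> r \<noteq> 18 \<longrightarrow> r \<noteq> 30 \<longrightarrow> g2 r = g r" using sd by auto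
    ultimately show ?case using s by simp
  qed
  then show ?thesis unfolding record_prog_def
    using g m(1) dn consts_okD[OF c] by (auto elim!: runs_mono)
qed

section \<open>Addresses of the encoded relation words\<close>

definition input_addr :: "nat \<Rightarrow> 'a list list \<Rightarrow> nat \<Rightarrow> nat" where
  "input_addr P ws i = P + sum_list (map (\<lambda>w. length w + 1) (take i ws))"

definition input_words :: "'a regs \<Rightarrow> nat \<Rightarrow> 'a list list \<Rightarrow> bool" where
  "input_words m P ws \<longleftrightarrow> (\<forall>i<length ws. m (input_addr P ws i) = Num (length (ws ! i)) \<and>
    word_at m (input_addr P ws i + 1) (ws ! i))"

lemma input_addr_Suc:
  "i < length ws \<Longrightarrow> input_addr P ws (Suc i) = input_addr P ws i + 1 + length (ws ! i)"
  by (simp add: input_addr_def take_Suc_conv_app_nth)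

lemma input_addr_mono: "i \<le> j \<Longrightarrow> input_addr P ws i \<le> input_addr P ws j"
proof -
  assume "i \<le> j"
  then have "take j ws = take i ws @ take (j - i) (drop i ws)"
    using take_add[of i "j - i" ws] by simp
  then show ?thesis by (simp add: input_addr_def)
qed

lemma parse_prog:
  fixes m :: "'a regs"
  assumes m: "m 0 = Num la" "m (la + 1) = Num n" "input_words m (la + 2) ws" "length ws = 2 * n"
    and U: "U = input_addr (la + 2) ws (2 * n)" "m U = Num lu" "m (U + 1 + lu) = Num lv"
  shows "runs parse_prog (\<lambda>_. Num 0) m (\<lambda>t g' m'. m' = m \<and> t \<le> 10 * n + 30 \<and> consts_ok g' \<and>
    g' 14 = Num n \<and> g' 15 = Num (la + 2) \<and> g' 4 = Num (U + 2 + lu + lv + 1) \<and>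
    (if lu \<le> lv
     then g' 26 = Num (U + 1) \<and> g' 27 = Num lu \<and> g' 9 = Num (U + 2 + lu) \<and> g' 10 = Num (U + 2 + lu + lv)
     else g' 26 = Num (U + 2 + lu) \<and> g' 27 = Num lv \<and> g' 9 = Num (U + 1) \<and> g' 10 = Num (U + 1 + lu)))"
proof -
  let ?A = "input_addr (la + 2) ws"
  define I :: "nat \<Rightarrow> 'a regs \<Rightarrow> 'a regs \<Rightarrow> bool" where
    "I = (\<lambda>b g' m'. m' = m \<and> consts_ok g' \<and> g' 14 = Num n \<and> g' 15 = Num (la + 2) \<and>
      (\<exists>k\<le>n. g' 16 = Num (?A (2 * k)) \<and> g' 17 = Num (n - k) \<and> b = 10 * (n - k)))"
  have body: "runs parse_body g' m'
      (\<lambda>t g2 m2. \<exists>n'. I n' g2 m2 \<and> t + 2 + n' \<le> b)"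
    if inv: "I b g' m'" and ne: "g' 17 \<noteq> g' 0" for b g' m'
  proof -
    note [simp] = parse_body_def
    have m': "m' = m" and c': "consts_ok g'" and fr: "g' 14 = Num n" "g' 15 = Num (la + 2)"
      using inv by (auto simp: I_def)
    obtain k where k: "k \<le> n" "g' 16 = Num (?A (2 * k))" "g' 17 = Num (n - k)" "b = 10 * (n - k)"
      using inv by (auto simp: I_def)
    have kn: "k < n" using k ne consts_okD(1)[OF c'] by auto
    have i: "2 * k < length ws" "Suc (2 * k) < length ws" using kn m(4) by auto
    have f: "m (?A (2 * k)) = Num (length (ws ! (2 * k)))"
      "m (?A (Suc (2 * k))) = Num (length (ws ! Suc (2 * k)))"
      using m(3) i unfolding input_words_def by auto
    have a: "?A (2 * k) + length (ws ! (2 * k)) + 1 = ?A (Suc (2 * k))"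
      "?A (Suc (2 * k)) + length (ws ! Suc (2 * k)) + 1 = ?A (2 * Suc k)"
      using input_addr_Suc[OF i(1), of "la + 2"] input_addr_Suc[OF i(2), of "la + 2"] by auto
    have "I (10 * (n - Suc k)) (g'(18 := Num (length (ws ! Suc (2 * k))), 16 := Num (?A (2 * Suc k)),
        17 := Num (n - Suc k))) m"
      unfolding I_def using c' fr kn by (intro conjI exI[of _ "Suc k"]) auto
    moreover have "9 + 10 * (n - Suc k) \<le> b" using kn k by simp
    moreover have "g'(18 := Num (length (ws ! (2 * k))), 16 := Num (?A (Suc (2 * k))),
        18 := Num (length (ws ! Suc (2 * k))), 16 := Num (?A (2 * Suc k)), 17 := Num (n - Suc k)) =
      g'(18 := Num (length (ws ! Suc (2 * k))), 16 := Num (?A (2 * Suc k)), 17 := Num (n - Suc k))"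
      by (auto simp: fun_eq_iff)
    ultimately have "I (10 * (n - Suc k)) (g'(18 := Num (length (ws ! (2 * k))),
        16 := Num (?A (2 * k) + length (ws ! (2 * k)) + 1),
        18 := Num (length (ws ! Suc (2 * k))),
        16 := Num (?A (2 * k) + length (ws ! (2 * k)) + 1 + length (ws ! Suc (2 * k)) + 1),
        17 := Num (n - Suc k))) m \<and> 9 + 10 * (n - Suc k) \<le> b"
      unfolding a by simp
    then show ?thesis
      using k m' f(1) f(2)[folded a(1)] consts_okD[OF c'] by (auto intro!: exI[of _ "10 * (n - Suc k)"]
        simp: fun_upd_twist)
  qed
  let ?g = "(\<lambda>_. Num 0)(1 := Num 1, 3 := Num 3, 12 := Num la, 13 := Num (la + 1), 14 := Num n,
    15 := Num (la + 2), 16 := Num (la + 2), 17 := Num n) :: 'a regs"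
  have "I (10 * n) ?g m"
    unfolding I_def by (intro conjI exI[of _ 0]) (auto simp: consts_ok_def input_addr_def)
  then have "runs (While 17 0 parse_body) ?g m
      (\<lambda>t g' m'. g' 17 = g' 0 \<and> (\<exists>n'. I n' g' m' \<and> t + n' \<le> 10 * n + 1))"
    by (rule runs_While[where I = I, OF _ body])
  then have "runs (While 17 0 parse_body) ?g m
      (\<lambda>t g' m'. m' = m \<and> consts_ok g' \<and> g' 14 = Num n \<and> g' 15 = Num (la + 2) \<and>
        g' 16 = Num U \<and> t \<le> 10 * n + 1)"
  proof (rule runs_mono, goal_cases)
    case (1 t g' m')
    then obtain n' k where k: "m' = m" "consts_ok g'" "g' 14 = Num n" "g' 15 = Num (la + 2)" "k \<le> n"
      "g' 16 = Num (?A (2 * k))" "g' 17 = Num (n - k)" "t + n' \<le> 10 * n + 1"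
      by (auto simp: I_def)
    have "k = n" using 1 k consts_okD(1)[OF k(2)] by auto
    then show ?case using k U by simp
  qed
  then show ?thesis
    unfolding parse_prog_def using m(1,2) U(2,3)
    by (auto elim!: runs_mono simp: consts_ok_def)
qed

context word_machine
begin

lemma table_prog:
  fixes g m :: "'a regs"
  assumes c: "consts_ok g" and g: "g 4 = Num T" "g 14 = Num n" "g 15 = Num P"
    and ws: "length ws = 2 * n" "\<And>i. i < length ws \<Longrightarrow> pidx i = (if even i then i + 1 else i - 1)"
    and inp: "input_words m P ws" "input_addr P ws (2 * n) \<le> T" and TE0: "is_num (m TE)"
  shows "runs table_prog g m (\<lambda>t g' m'. (\<forall>r<28. r \<noteq> 5 \<longrightarrow> r \<notin> {16, 17, 18} \<longrightarrow> g' r = g r) \<and>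
    g' 5 = Num TE \<and> records (\<lambda>_. 0) m' \<and> (\<forall>x. x < T \<or> TE \<le> x \<longrightarrow> m' x = m x) \<and>
    t \<le> 20 * (TE - T) + 10)"
proof -
  let ?A = "input_addr P ws"
  define recorded where "recorded = (\<lambda>k (m' :: 'a regs). \<forall>i<k.
    m' (addr i) = Num (addr (pidx i)) \<and> m' (addr i + 1) = Num 0 \<and>
    m' (addr i + 2) = Num (length (ws ! i)) \<and> word_at m' (addr i + 3) (ws ! i))"
  define I :: "nat \<Rightarrow> 'a regs \<Rightarrow> 'a regs \<Rightarrow> bool" where
    "I = (\<lambda>b g' m'. (\<forall>r<28. r \<notin> {16, 17, 18} \<longrightarrow> g' r = g r) \<and>
      (\<exists>k\<le>n. g' 16 = Num (?A (2 * k)) \<and> g' 17 = Num (n - k) \<and> g' 28 = Num (addr (2 * k)) \<and>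
        b = 20 * (TE - addr (2 * k)) \<and> recorded (2 * k) m' \<and>
        (\<forall>x. x < T \<or> addr (2 * k) \<le> x \<longrightarrow> m' x = m x)))"
  have body: "runs table_body g' m'
      (\<lambda>t g2 m2. \<exists>n'. I n' g2 m2 \<and> t + 2 + n' \<le> b)"
    if inv: "I b g' m'" and ne: "g' 17 \<noteq> g' 0" for b g' m'
  proof -
    note [simp] = table_body_def
    have fr: "\<forall>r<28. r \<notin> {16, 17, 18} \<longrightarrow> g' r = g r" using inv by (auto simp: I_def)
    have c': "consts_ok g'" using fr c by (simp add: consts_ok_def)
    obtain k where k: "k \<le> n" "g' 16 = Num (?A (2 * k))" "g' 17 = Num (n - k)"
      "g' 28 = Num (addr (2 * k))" "b = 20 * (TE - addr (2 * k))" "recorded (2 * k) m'"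
      "\<forall>x. x < T \<or> addr (2 * k) \<le> x \<longrightarrow> m' x = m x"
      using inv by (auto simp: I_def)
    have kn: "k < n" using k ne consts_okD(1)[OF c'] by auto
    let ?i = "2 * k" and ?j = "Suc (2 * k)"
    let ?l = "ws ! ?i" and ?r = "ws ! ?j"
    have i: "?i < length ws" "?j < length ws" using kn ws(1) by auto
    have A: "?A ?j = ?A ?i + 1 + length ?l" "?A (2 * Suc k) = ?A ?j + 1 + length ?r"
      using input_addr_Suc[OF i(1)] input_addr_Suc[OF i(2)] by auto
    have AT: "?A (2 * Suc k) \<le> T"
      using input_addr_mono[of "2 * Suc k" "2 * n" P ws] kn inp(2) by simp
    have B: "addr ?j = addr ?i + 3 + length ?l" "addr (2 * Suc k) = addr ?j + 3 + length ?r"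
      using addr_Suc[OF i(1)] addr_Suc[OF i(2)] by auto
    have BT: "addr (2 * Suc k) \<le> TE" using addr_mono[of "2 * Suc k" "length ws"] kn ws(1) by simp
    have Ti: "T \<le> addr ?i" by (rule T_le_addr)
    have in_l: "m (?A ?i) = Num (length ?l)" "word_at m (?A ?i + 1) ?l"
      and in_r: "m (?A ?j) = Num (length ?r)" "word_at m (?A ?j + 1) ?r"
      using inp(1) i unfolding input_words_def by blast+
    have low_l: "m0 (?A ?i) = Num (length ?l) \<and> word_at m0 (?A ?i + 1) ?l"
      if "\<forall>x<T. m0 x = m x" for m0 :: "'a regs"
      using in_l that A AT by (simp add: word_at_def)
    have low_r: "m0 (?A ?j) = Num (length ?r) \<and> word_at m0 (?A ?j + 1) ?r"
      if "\<forall>x<T. m0 x = m x" for m0 :: "'a regs"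
      using in_r that A AT by (simp add: word_at_def)
    let ?g1 = "g'(18 := Num (length ?l), 29 := Num (addr ?j))"
    have c1: "consts_ok ?g1" using c' by simp
    have mT: "\<forall>x<T. m' x = m x" using k(7) by blast
    have "runs (record_prog 28 29) ?g1 m' (\<lambda>s g2 m2. s \<le> 10 * length ?l + 30 \<and>
      (\<forall>r<60. r \<noteq> 16 \<longrightarrow> r \<noteq> 18 \<longrightarrow> r \<noteq> 30 \<longrightarrow> g2 r = ?g1 r) \<and>
      g2 16 = Num (?A ?i + 1 + length ?l) \<and> g2 18 = Num (length ?l) \<and>
      m2 (addr ?i) = Num (addr ?j) \<and> m2 (addr ?i + 1) = Num 0 \<and>
      m2 (addr ?i + 2) = Num (length ?l) \<and> word_at m2 (addr ?i + 3) ?l \<and>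
      (\<forall>x. x < addr ?i \<or> addr ?i + 3 + length ?l \<le> x \<longrightarrow> m2 x = m' x))"
      by (rule record_prog[OF c1])
        (use k low_l[OF mT] A AT Ti in simp_all)
    then have "runs (record_prog 28 29) ?g1 m' (\<lambda>s1 g2 m2. runs (record_prog 29 28) g2 m2
        (\<lambda>s2 g3 m3. runs (Ins (Add 28 29 3) ;; Ins (Add 28 28 18) ;; Ins (Sub 17 17 1)) g3 m3
        (\<lambda>s3 g4 m4. \<exists>n'. I n' g4 m4 \<and> 3 + (s1 + (s2 + s3)) + 2 + n' \<le> b)))"
    proof (rule runs_mono, goal_cases)
      case (1 s1 g2 m2)
      then have s1: "s1 \<le> 10 * length ?l + 30"
        and fr2: "\<forall>r<60. r \<noteq> 16 \<longrightarrow> r \<noteq> 18 \<longrightarrow> r \<noteq> 30 \<longrightarrow> g2 r = ?g1 r"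
        and g16: "g2 16 = Num (?A ?j)"
        and new: "m2 (addr ?i) = Num (addr ?j)" "m2 (addr ?i + 1) = Num 0"
          "m2 (addr ?i + 2) = Num (length ?l)" "word_at m2 (addr ?i + 3) ?l"
        and old: "\<forall>x. x < addr ?i \<or> addr ?j \<le> x \<longrightarrow> m2 x = m' x"
        using A B by auto
      have c2: "consts_ok g2" using fr2 c1 by (simp add: consts_ok_def)
      have mT2: "\<forall>x<T. m2 x = m x" using old mT Ti by simp
      have "runs (record_prog 29 28) g2 m2 (\<lambda>s g3 m3. s \<le> 10 * length ?r + 30 \<and>
        (\<forall>r<60. r \<noteq> 16 \<longrightarrow> r \<noteq> 18 \<longrightarrow> r \<noteq> 30 \<longrightarrow> g3 r = g2 r) \<and>
        g3 16 = Num (?A ?j + 1 + length ?r) \<and> g3 18 = Num (length ?r) \<and>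
        m3 (addr ?j) = Num (addr ?i) \<and> m3 (addr ?j + 1) = Num 0 \<and>
        m3 (addr ?j + 2) = Num (length ?r) \<and> word_at m3 (addr ?j + 3) ?r \<and>
        (\<forall>x. x < addr ?j \<or> addr ?j + 3 + length ?r \<le> x \<longrightarrow> m3 x = m2 x))"
        by (rule record_prog[OF c2])
          (use fr2 k g16 low_r[OF mT2] A AT Ti B in simp_all)
      then show ?case
      proof (rule runs_mono, goal_cases)
        case (1 s2 g3 m3)
        then have s2: "s2 \<le> 10 * length ?r + 30"
          and fr3: "\<forall>r<60. r \<noteq> 16 \<longrightarrow> r \<noteq> 18 \<longrightarrow> r \<noteq> 30 \<longrightarrow> g3 r = g2 r"
          and g3: "g3 16 = Num (?A (2 * Suc k))" "g3 18 = Num (length ?r)"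
          and new3: "m3 (addr ?j) = Num (addr ?i)" "m3 (addr ?j + 1) = Num 0"
            "m3 (addr ?j + 2) = Num (length ?r)" "word_at m3 (addr ?j + 3) ?r"
          and old3: "\<forall>x. x < addr ?j \<or> addr (2 * Suc k) \<le> x \<longrightarrow> m3 x = m2 x"
          using A B by auto
        have gs: "g3 29 = Num (addr ?j)" "g3 17 = Num (n - k)" "g3 3 = Num 3" "g3 1 = Num 1"
          "g3 (Suc 0) = Num 1"
          using fr3 fr2 k consts_okD[OF c'] by auto
        have agree: "m3 x = m' x" if "x < addr ?i" for x using that old old3 B by simp
        have "recorded (2 * Suc k) m3"
          unfolding recorded_def
        proof (intro allI impI)
          fix l assume l: "l < 2 * Suc k"
          then have "l < ?i \<or> l = ?i \<or> l = ?j" by (auto simp: less_Suc_eq)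
          then consider "l < ?i" | "l = ?i" | "l = ?j" by blast
          then show "m3 (addr l) = Num (addr (pidx l)) \<and> m3 (addr l + 1) = Num 0 \<and>
            m3 (addr l + 2) = Num (length (ws ! l)) \<and> word_at m3 (addr l + 3) (ws ! l)"
          proof cases
            case 1
            then have "addr (Suc l) \<le> addr ?i" by (intro addr_mono) simp
            then have "addr l + 3 + length (ws ! l) \<le> addr ?i" using addr_Suc[of l] 1 i by simp
            then show ?thesis using k(6) 1 agree unfolding recorded_def word_at_def by simp
          next
            case 2
            have "word_at m3 (addr ?i + 3) ?l" using new(4) old3 B by (simp add: word_at_def)
            then show ?thesis using 2 new old3 B ws(2)[OF i(1)] by simp
          next
            case 3
            then show ?thesis using new3 ws(2)[OF i(2)] by simp
          qed
        qed
        moreover have "\<forall>x. x < T \<or> addr (2 * Suc k) \<le> x \<longrightarrow> m3 x = m x"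
          using old old3 k(7) B Ti by simp
        moreover have "\<forall>r<28. r \<notin> {16, 17, 18} \<longrightarrow> g3 r = g r" using fr3 fr2 fr by auto
        moreover have "addr ?j + 3 + length ?r = addr (2 * Suc k)" using B by simp
        ultimately have "I (20 * (TE - addr (2 * Suc k)))
            (g3(28 := Num (addr ?j + 3 + length ?r), 17 := Num (n - Suc k))) m3"
          unfolding I_def using kn g3 by (intro conjI exI[of _ "Suc k"]) auto
        moreover have "3 + (s1 + (s2 + 3)) + 2 + 20 * (TE - addr (2 * Suc k)) \<le> b"
          using s1 s2 k(5) B BT by simp
        ultimately have "\<exists>n'. I n' (g3(28 := Num (addr ?j + 3 + length ?r), 17 := Num (n - Suc k))) m3 \<and>
          3 + (s1 + (s2 + 3)) + 2 + n' \<le> b" by blast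
        then show ?case using gs g3 by (auto simp: add.commute add.left_commute)
      qed
    qed
    then show ?thesis using k(2,4) low_l[OF mT] B consts_okD[OF c'] by (auto elim!: runs_mono)
  qed
  let ?g = "g(16 := Num P, 28 := Num T, 17 := Num n)"
  have "I (20 * (TE - T)) ?g m"
    unfolding I_def using g
    by (intro conjI exI[of _ 0]) (auto simp: recorded_def input_addr_def addr_0)
  then have "runs (While 17 0 table_body) ?g m
      (\<lambda>t g' m'. g' 17 = g' 0 \<and> (\<exists>n'. I n' g' m' \<and> t + n' \<le> 20 * (TE - T) + 1))"
    by (rule runs_While[where I = I, OF _ body])
  then have "runs (While 17 0 table_body) ?g m
      (\<lambda>t g' m'. (\<forall>r<28. r \<notin> {16, 17, 18} \<longrightarrow> g' r = g r) \<and> g' 28 = Num TE \<and>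
        records (\<lambda>_. 0) m' \<and> (\<forall>x. x < T \<or> TE \<le> x \<longrightarrow> m' x = m x) \<and> t \<le> 20 * (TE - T) + 1)"
  proof (rule runs_mono, goal_cases)
    case (1 t g' m')
    then obtain n' k where k: "\<forall>r<28. r \<notin> {16, 17, 18} \<longrightarrow> g' r = g r" "k \<le> n"
      "g' 17 = Num (n - k)" "g' 28 = Num (addr (2 * k))" "recorded (2 * k) m'"
      "\<forall>x. x < T \<or> addr (2 * k) \<le> x \<longrightarrow> m' x = m x" "t + n' \<le> 20 * (TE - T) + 1"
      by (auto simp: I_def)
    have "g' 0 = Num 0" using k(1) consts_okD(1)[OF c] by simp
    then have kn: "2 * k = length ws" using 1 k(2,3) ws(1) by auto
    have "is_num (m' TE)" using TE0 k(6) kn by simp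
    then show ?case using k unfolding kn records_def recorded_def by simp
  qed
  then show ?thesis unfolding table_prog_def using g by (auto elim!: runs_mono)
qed

end

section \<open>The complete program\<close>

text \<open>The size \<open>TE - T\<close> of the table is a bound for the length of a relation word
  that is already at hand. The space set aside for the shorter word, \<open>TE - T + N\<close>
  cells, thus suffices for that word and one tail.\<close>

definition finish_prog :: com where
  "finish_prog =
    Ins (Sub 28 5 4) ;; Ins (Add 29 28 27) ;; Ins (Add 6 29 1) ;; Ins (Add 8 5 1) ;;
    Ins (Add 8 8 29) ;; Ins (Copy 7 8) ;; Ins (Add 30 26 27) ;; Ins (Copy 31 27) ;;
    prepend_prog ;; Ins (Copy 11 1) ;; While 11 0 step_prog"

context main_machine
begin

lemma finish_prog:
  fixes g m :: "'a regs"
  assumes g: "consts_ok g" "g 4 = Num T" "g 5 = Num TE" "g 9 = Num y" "g 10 = Num ve"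
    "g 26 = Num a" "g 27 = Num N"
    and rec: "records zlen m" and free: "\<And>x. S \<le> x \<Longrightarrow> m x = Num 0" and end0: "is_num (m ve)"
    and s: "word_at m a s" "length s = N" "a + N \<le> S"
    and w: "word_at m y w" "y + length w = ve" "L \<le> y"
    and dims: "S = TE + 1" "ue = S + (TE - T) + N" "M \<le> TE - T"
  shows "runs finish_prog g m (\<lambda>t g' m'.
    t \<le> N * (100 * (TE - T) + 30) + step_cost * N + 100 \<and> (g' 2 = g' 1 \<longleftrightarrow> E s w))"
proof -
  have Fe: "F = TE - T + N + 1" using F dims(2) by simp
  \<comment> \<open>Untouched memory is a valid state for the empty word: the 0 at \<open>ue\<close>
    ends it, and the zeros behind are its flags.\<close>
  have stack0: "stack_at m ue []"
    using free F room not_act_Nil unfolding stack_at_def text_at_def flags_def flag_def by simp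
  let ?g1 = "g(28 := Num (TE - T), 29 := Num (TE - T + N), 6 := Num F, 8 := Num ue, 7 := Num ue,
    30 := Num (a + N), 31 := Num N)"
  have c1: "consts_ok ?g1" using g(1) by simp
  have "runs prepend_prog ?g1 m (\<lambda>t g' m'. (\<forall>y<S. m' y = m y) \<and> records zlen m' \<and>
    (\<forall>r<30. r \<noteq> 7 \<longrightarrow> g' r = ?g1 r) \<and> g' 7 = Num (ue - length s) \<and>
    stack_at m' (ue - length s) (s @ []) \<and> t \<le> length s * (100 * (TE - T) + 30) + 10)"
    by (rule prepend_prog[OF c1 _ _ _ _ _ _ rec stack0 s(1)]) (use g s dims in simp_all)
  then have main: "runs prepend_prog ?g1 m (\<lambda>t1 g1 m1. runs (Ins (Copy 11 1) ;; While 11 0 step_prog)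
    g1 m1 (\<lambda>t2 g' m'. 8 + (t1 + t2) \<le> N * (100 * (TE - T) + 30) + step_cost * N + 100 \<and>
      (g' 2 = g' 1 \<longleftrightarrow> E s w)))"
  proof (rule runs_mono, goal_cases)
    case (1 t1 g1 m1)
    then have low: "\<forall>y<S. m1 y = m y" and rec1: "records zlen m1"
      and fr: "\<forall>r<30. r \<noteq> 7 \<longrightarrow> g1 r = ?g1 r" and g7: "g1 7 = Num (ue - N)"
      and st: "stack_at m1 (ue - N) ([] @ s)" and t1: "t1 \<le> N * (100 * (TE - T) + 30) + 10"
      using s(2) by auto
    have c2: "consts_ok g1" using fr g(1) by (simp add: consts_ok_def)
    let ?g2 = "g1(11 := Num 1)"
    have veS: "ve < S" by (rule ve_less_S)
    have "regs_ok ?g2" using fr g c2 by (simp add: regs_ok_def)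
    moreover have "mem_ok m1" using rec1 low veS end0 by (simp add: mem_ok_def)
    moreover have "word_at m1 y ([] @ w)"
      using w(1,2) low veS by (simp add: word_at_def)
    moreover have "?g2 7 = Num (ue - N)" "?g2 9 = Num y" "?g2 11 = Num 1" using g7 fr g by auto
    ultimately have "live (step_cost * N + 40) (E s w) ?g2 m1"
      by (intro liveI[where q = "[]" and q' = "[]" and z = s and z' = w, OF _ _ _ _ st])
        (use s w in simp_all)
    from main_loop[OF this] show ?case
      unfolding runs_Seq runs_basic consts_okD(2)[OF c2]
      by (rule runs_mono) (use t1 in auto)
  qed
  have e: "TE + 1 + (TE - T + N) = ue" using dims by simp
  show ?thesis unfolding finish_prog_def
    using main g e Fe consts_okD[OF g(1)] by (auto elim!: runs_mono)
qed

end

definition word_problem_prog :: com where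
  "word_problem_prog = parse_prog ;; table_prog ;; tail_prog ;; finish_prog"

section \<open>The encoded instance in memory\<close>

definition memory_of :: "'a cell list \<Rightarrow> 'a regs" where
  "memory_of xs = (\<lambda>i. if i < length xs then xs ! i else Num 0)"

lemma memory_of_nth: "xs = pre @ x # post \<Longrightarrow> length pre = a \<Longrightarrow> memory_of xs a = x"
  by (auto simp: memory_of_def)

lemma memory_of_word: "xs = pre @ map Gen w @ post \<Longrightarrow> length pre = a \<Longrightarrow> word_at (memory_of xs) a w"
  by (auto simp: memory_of_def word_at_def nth_append)

lemma memory_of_free: "length xs \<le> a \<Longrightarrow> memory_of xs a = Num 0"
  by (simp add: memory_of_def)

lemma length_encode_words:
  "length (concat (map encode_word ws)) = sum_list (map (\<lambda>w. length w + 1) ws)"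
  by (induction ws) (auto simp: encode_word_def)

lemma input_words_memory:
  assumes "xs = pre @ concat (map encode_word ws) @ post" "length pre = P"
  shows "input_words (memory_of xs) P ws"
  unfolding input_words_def
proof (intro allI impI)
  fix i assume i: "i < length ws"
  define pre' where "pre' = pre @ concat (map encode_word (take i ws))"
  have "ws = take i ws @ ws ! i # drop (Suc i) ws" using i by (rule id_take_nth_drop)
  then have "concat (map encode_word ws) =
      concat (map encode_word (take i ws)) @ encode_word (ws ! i) @
      concat (map encode_word (drop (Suc i) ws))"
    by (metis concat.simps(2) concat_append list.simps(9) map_append)
  then have xs: "xs = pre' @ Num (length (ws ! i)) # map Gen (ws ! i) @
      concat (map encode_word (drop (Suc i) ws)) @ post"
    using assms(1) by (simp add: pre'_def encode_word_def)
  have len: "length pre' = input_addr P ws i"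
    using assms(2) by (simp add: pre'_def input_addr_def length_encode_words)
  have "xs = (pre' @ [Num (length (ws ! i))]) @ map Gen (ws ! i) @
      concat (map encode_word (drop (Suc i) ws)) @ post" using xs by simp
  then have "word_at (memory_of xs) (input_addr P ws i + 1) (ws ! i)"
    by (rule memory_of_word) (simp add: len)
  then show "memory_of xs (input_addr P ws i) = Num (length (ws ! i)) \<and>
      word_at (memory_of xs) (input_addr P ws i + 1) (ws ! i)"
    using memory_of_nth[OF xs len] by simp
qed

lemma sum_list_length_add: "sum_list (map (\<lambda>w. length w + k) ws) = sum_list (map length ws) + k * length ws"
  by (induction ws) auto

definition relation_word_list :: "('a list \<times> 'a list) list \<Rightarrow> 'a list list" where
  "relation_word_list rs = concat (map (\<lambda>(l, r). [l, r]) rs)"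

lemma length_relation_word_list: "length (relation_word_list rs) = 2 * length rs"
  by (induction rs) (auto simp: relation_word_list_def)

lemma set_relation_word_list: "set (relation_word_list rs) = relation_words (set rs)"
  by (induction rs) (auto simp: relation_word_list_def relation_words_def)

lemma encode_relations_words:
  "encode_relations rs = Num (length rs) # concat (map encode_word (relation_word_list rs))"
proof -
  have "concat (map (\<lambda>(l, r). encode_word l @ encode_word r) rs) =
      concat (map encode_word (relation_word_list rs))"
    by (induction rs) (auto simp: relation_word_list_def)
  then show ?thesis by (simp add: encode_relations_def)
qed

lemma relation_word_list_nth:
  "i < 2 * length rs \<Longrightarrow>
    relation_word_list rs ! i = (if even i then fst (rs ! (i div 2)) else snd (rs ! (i div 2)))"
proof (induction rs arbitrary: i)
  case (Cons e rs)
  have unf: "relation_word_list (e # rs) = fst e # snd e # relation_word_list rs"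
    by (simp add: relation_word_list_def case_prod_beta)
  consider "i = 0" | "i = 1" | j where "i = Suc (Suc j)" by (metis One_nat_def not0_implies_Suc)
  then show ?case
  proof cases
    case (3 j)
    then show ?thesis using Cons unf by simp
  qed (simp_all add: unf)
qed simp

lemma sum_list_relation_words:
  assumes "distinct rs"
  shows "sum_list (map length (relation_word_list rs)) = relations_size (set rs)"
proof -
  have "sum_list (map length (relation_word_list rs)) =
      sum_list (map (\<lambda>(l, r). length l + length r) rs)"
    by (induction rs) (auto simp: relation_word_list_def)
  then show ?thesis unfolding relations_size_def using assms
    by (simp add: sum.distinct_set_conv_list)
qed

text \<open>A repeated word would be a side of two relations, hence a piece, or both sides of one
  relation, which \<open>partner_ne\<close> excludes.\<close>

lemma (in c4_relations) distinct_relation_word_list: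
  assumes "R = set rs" "distinct rs"
  shows "distinct (relation_word_list rs)"
  unfolding distinct_conv_nth
proof (intro allI impI)
  fix i j
  assume i: "i < length (relation_word_list rs)" and j: "j < length (relation_word_list rs)"
    and ij: "i \<noteq> j"
  have side: "factor_of_side (relation_word_list rs ! k) (rs ! (k div 2))"
      "rs ! (k div 2) \<in> R" "k div 2 < length rs"
    if "k < length (relation_word_list rs)" for k
    using that assms(1) relation_word_list_nth[of k rs]
    by (auto simp: factor_of_side_def length_relation_word_list)
  show "relation_word_list rs ! i \<noteq> relation_word_list rs ! j"
  proof (cases "i div 2 = j div 2")
    case True
    let ?e = "rs ! (i div 2)"
    have "fst ?e \<noteq> snd ?e"
      using side(2)[OF i] partner_ne[of "fst ?e" "snd ?e"] by (simp add: partner_def)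
    moreover have "even i \<noteq> even j" using True ij
      by (metis dvd_div_mult_self even_two_times_div_two odd_two_times_div_two_succ)
    ultimately show ?thesis
      using i j True relation_word_list_nth[of i rs] relation_word_list_nth[of j rs]
      by (auto simp: length_relation_word_list)
  next
    case False
    then have ne: "rs ! (i div 2) \<noteq> rs ! (j div 2)"
      using assms(2) side(3)[OF i] side(3)[OF j] by (simp add: nth_eq_iff_index_eq)
    show ?thesis
    proof
      assume eq: "relation_word_list rs ! i = relation_word_list rs ! j"
      have "piece R (relation_word_list rs ! i)"
        by (rule factor_two_relations_piece[OF side(2)[OF i] side(2)[OF j] ne side(1)[OF i]])
          (use eq side(1)[OF j] in simp)
      moreover have "relation_word_list rs ! i \<in> W"
        using i set_relation_word_list assms(1) nth_mem by metis
      ultimately show False using not_piece by blast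
    qed
  qed
qed

lemma word_problem_prog:
  fixes as :: "'a list"
  assumes inst: "word_problem_instance as rs u v" and so: "small_overlap 4 (set rs)"
    and s: "M = relations_size (set rs)" "N = min (length u) (length v)"
  shows "runs word_problem_prog (\<lambda>_. Num 0) (memory_of (encode_instance as rs u v))
    (\<lambda>t g m. (g 2 = g 1 \<longleftrightarrow> (rewr (set rs))\<^sup>*\<^sup>* u v) \<and>
      t \<le> 10 * M + 30 + (20 * (4 * M) + 10) + (4 * M * (40 * (4 * M + 1) + 40) + 10) +
        (N * (100 * (4 * M) + 30) + (M + 1) * (100 * (4 * M) + 300) * N + 100))"
proof -
  interpret c4_relations "set rs" using so by unfold_locales
  let ?xs = "encode_instance as rs u v"
  let ?m = "memory_of ?xs"
  define ws where "ws = relation_word_list rs"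
  define n where "n = length rs"
  define P where "P = length as + 2"
  define U where "U = input_addr P ws (2 * n)"
  have lws: "length ws = 2 * n" by (simp add: ws_def n_def length_relation_word_list)
  have dist: "distinct rs" using inst by (simp add: word_problem_instance_def)
  have sumM: "sum_list (map length ws) = M"
    using sum_list_relation_words[OF dist] s by (simp add: ws_def)
  have setW: "set ws = relation_words (set rs)" by (simp add: ws_def set_relation_word_list)
  have U_eq: "U = P + M + 2 * n"
    using lws sumM unfolding U_def input_addr_def sum_list_length_add by simp
  \<comment> \<open>C(4) forbids empty relation words. Hence the three header cells of all records
    amount to at most \<open>3 * M\<close>, and the table has at most \<open>4 * M\<close>
    cells.\<close>
  have nM: "2 * n \<le> M"
  proof -
    have "sum_list (map (\<lambda>_. 1) ws) \<le> sum_list (map length ws)"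
      using setW relation_word_not_Nil by (intro sum_list_mono) (simp add: Suc_le_eq)
    then show ?thesis using lws sumM by (simp add: sum_list_triv)
  qed
  define D where "D = M + 3 * (2 * n)"
  have sumD: "sum_list (map (\<lambda>w. length w + 3) ws) = D"
    using lws sumM unfolding sum_list_length_add by (simp add: D_def)
  have D4: "D \<le> 4 * M" using nM by (simp add: D_def)
  have MD: "M \<le> D" by (simp add: D_def)
  let ?lu = "length u" and ?lv = "length v"
  define T where "T = U + 2 + ?lu + ?lv + 1"
  \<comment> \<open>The two sides of a relation are neighbours in \<open>ws\<close>, so parity
    determines the partner.\<close>
  define pidx where "pidx = (\<lambda>i::nat. if even i then i + 1 else i - 1)"
  define S where "S = T + D + 1"
  define F where "F = D + N + 1"
  define ue where "ue = S + D + N"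
  have pidx: "pidx i < length ws \<and> partner (set rs) (ws ! i) (ws ! pidx i)" if i: "i < length ws" for i
  proof (cases "even i")
    case True
    then have i1: "i + 1 < 2 * n" using i lws by presburger
    then have "rs ! (i div 2) \<in> set rs" using n_def by simp
    moreover have "ws ! i = fst (rs ! (i div 2))" "ws ! (i + 1) = snd (rs ! (i div 2))"
      using True i1 relation_word_list_nth[of i rs] relation_word_list_nth[of "i + 1" rs]
      by (auto simp: ws_def n_def)
    ultimately show ?thesis using True i1 lws by (simp add: pidx_def partner_def)
  next
    case False
    then have i1: "i - 1 < 2 * n" "(i - 1) div 2 = i div 2" "even (i - 1)" "i < 2 * n"
      using i lws by (auto elim: oddE)
    then have "rs ! (i div 2) \<in> set rs" using n_def by simp
    moreover have "ws ! i = snd (rs ! (i div 2))" "ws ! (i - 1) = fst (rs ! (i div 2))"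
      using False i1 relation_word_list_nth[of i rs] relation_word_list_nth[of "i - 1" rs]
      by (auto simp: ws_def n_def)
    ultimately show ?thesis using False i1 lws by (simp add: pidx_def partner_def)
  qed
  interpret word_machine "set rs" ws pidx T S ue F
  proof
    show "set ws = relation_words (set rs)" by (rule setW)
    show "distinct ws" unfolding ws_def using distinct_relation_word_list dist by simp
    show "pidx i < length ws \<and> partner (set rs) (ws ! i) (ws ! pidx i)" if "i < length ws" for i
      using pidx[OF that] .
    show "0 < T" by (simp add: T_def)
    show "T + sum_list (map (\<lambda>w. length w + 3) ws) < S" using sumD by (simp add: S_def)
    show "S + F = ue + 1" by (simp add: F_def ue_def)
  qed
  have TE: "addr (length ws) = T + D" using sumD by (simp add: addr_def)
  have xs: "?xs = (Num (length as) # map Gen as @ [Num n]) @ concat (map encode_word ws) @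
      Num ?lu # map Gen u @ Num ?lv # map Gen v"
    by (simp add: encode_instance_def encode_word_def encode_relations_words n_def ws_def)
  have lpre: "length (Num (length as) # map Gen as @ [Num n]) = P" by (simp add: P_def)
  have lmid: "length (concat (map encode_word ws)) = U - P"
    using lws by (simp add: length_encode_words U_def input_addr_def)
  have PU: "P \<le> U" by (simp add: U_eq)
  have lxs: "length ?xs = U + 2 + ?lu + ?lv"
    unfolding xs using lpre lmid PU by simp
  have m0: "?m 0 = Num (length as)" by (rule memory_of_nth[where pre = "[]"]) (simp_all add: xs)
  have mn: "?m (length as + 1) = Num n"
    by (rule memory_of_nth[where pre = "Num (length as) # map Gen as"]) (simp_all add: xs)
  have inp: "input_words ?m P ws" by (rule input_words_memory[OF xs lpre])
  let ?pu = "(Num (length as) # map Gen as @ [Num n]) @ concat (map encode_word ws)"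
  have lpu: "length ?pu = U" using lpre lmid PU by simp
  have mU: "?m U = Num ?lu"
    by (rule memory_of_nth[where pre = ?pu, OF _ lpu]) (simp add: xs)
  have mu: "word_at ?m (U + 1) u"
    by (rule memory_of_word[where pre = "?pu @ [Num ?lu]"]) (use lpu in \<open>simp_all add: xs\<close>)
  have mV: "?m (U + 1 + ?lu) = Num ?lv"
    by (rule memory_of_nth[where pre = "?pu @ Num ?lu # map Gen u"]) (use lpu in \<open>simp_all add: xs\<close>)
  have mv: "word_at ?m (U + 2 + ?lu) v"
    by (rule memory_of_word[where pre = "?pu @ Num ?lu # map Gen u @ [Num ?lv]" and post = "[]"])
      (use lpu in \<open>simp_all add: xs\<close>)
  have free: "?m x = Num 0" if "U + 2 + ?lu + ?lv \<le> x" for x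
    using memory_of_free lxs that by metis
  define a where "a = (if ?lu \<le> ?lv then U + 1 else U + 2 + ?lu)"
  define y where "y = (if ?lu \<le> ?lv then U + 2 + ?lu else U + 1)"
  define short where "short = (if ?lu \<le> ?lv then u else v)"
  define long where "long = (if ?lu \<le> ?lv then v else u)"
  define ve where "ve = y + length long"
  have layout: "word_at ?m a short" "length short = N" "a + N < T" "word_at ?m y long" "M \<le> y" "ve < T"
    "E short long \<longleftrightarrow> E u v" "is_num (?m ve)"
    using mu mv mV free[of "U + 2 + ?lu + ?lv"] U_eq s(2) E_sym
    by (auto simp: a_def y_def short_def long_def ve_def T_def)
  \<comment> \<open>\<open>M\<close> itself can serve as \<open>L\<close>: the encoded relations
    precede both input words and leave that much room to the left of the longer one.\<close>
  interpret main_machine "set rs" ws pidx T S ue F N M M ve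
  proof
    show "length w \<le> M" if "w \<in> set ws" for w
      using that sumM member_le_sum_list[of "length w" "map length ws"] by auto
    show "M \<le> M" by simp
    show "S + M + N \<le> ue" using MD by (simp add: ue_def)
    show "ve < T" by (rule layout)
  qed
  have parse: "runs parse_prog (\<lambda>_. Num 0) ?m (\<lambda>t g m. m = ?m \<and> t \<le> 10 * n + 30 \<and> consts_ok g \<and>
    g 14 = Num n \<and> g 15 = Num P \<and> g 4 = Num T \<and> g 26 = Num a \<and> g 27 = Num N \<and> g 9 = Num y \<and>
    g 10 = Num ve)"
  proof -
    have eqs: "length as + 2 = P" "U = input_addr (length as + 2) ws (2 * n)"
      by (simp_all add: P_def U_def)
    have "runs parse_prog (\<lambda>_. Num 0) ?m (\<lambda>t g' m'. m' = ?m \<and> t \<le> 10 * n + 30 \<and> consts_ok g' \<and>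
      g' 14 = Num n \<and> g' 15 = Num (length as + 2) \<and> g' 4 = Num (U + 2 + ?lu + ?lv + 1) \<and>
      (if ?lu \<le> ?lv
       then g' 26 = Num (U + 1) \<and> g' 27 = Num ?lu \<and> g' 9 = Num (U + 2 + ?lu) \<and>
         g' 10 = Num (U + 2 + ?lu + ?lv)
       else g' 26 = Num (U + 2 + ?lu) \<and> g' 27 = Num ?lv \<and> g' 9 = Num (U + 1) \<and>
         g' 10 = Num (U + 1 + ?lu)))"
      by (rule parse_prog[OF m0 mn _ lws eqs(2) mU mV]) (use inp P_def in simp)
    then show ?thesis
    proof (rule runs_mono, goal_cases)
      case (1 t g' m')
      then show ?case using s(2)
        by (auto simp: P_def T_def a_def y_def ve_def long_def split: if_splits)
    qed
  qed
  let ?B = "10 * n + 30 + (20 * D + 10) + (D * (40 * (D + 1) + 40) + 10) +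
    (N * (100 * D + 30) + step_cost * N + 100)"
  have "runs (parse_prog ;; table_prog ;; tail_prog ;; finish_prog) (\<lambda>_. Num 0) ?m
    (\<lambda>t g m. t \<le> ?B \<and> (g 2 = g 1 \<longleftrightarrow> E u v))"
    unfolding runs_Seq using parse
  proof (rule runs_mono, goal_cases)
    case (1 t1 g1 m1)
    have inpT: "input_addr P ws (2 * n) \<le> T" using U_def by (simp add: T_def)
    have TE0: "is_num (?m (addr (length ws)))" using free[of "T + D"] TE by (simp add: T_def)
    have pi: "pidx i = (if even i then i + 1 else i - 1)" if "i < length ws" for i
      by (simp add: pidx_def)
    have "runs table_prog g1 ?m (\<lambda>t g' m'. (\<forall>r<28. r \<noteq> 5 \<longrightarrow> r \<notin> {16, 17, 18} \<longrightarrow> g' r = g1 r) \<and>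
      g' 5 = Num (addr (length ws)) \<and> records (\<lambda>_. 0) m' \<and>
      (\<forall>x. x < T \<or> addr (length ws) \<le> x \<longrightarrow> m' x = ?m x) \<and>
      t \<le> 20 * (addr (length ws) - T) + 10)"
      by (rule table_prog[OF _ _ _ _ lws pi inp inpT TE0]) (use 1 in simp_all)
    then have "runs table_prog g1 ?m (\<lambda>t2 g2 m2. runs tail_prog g2 m2 (\<lambda>t3 g3 m3.
      runs finish_prog g3 m3 (\<lambda>t4 g m. t1 + (t2 + (t3 + t4)) \<le> ?B \<and> (g 2 = g 1 \<longleftrightarrow> E u v))))"
    proof (rule runs_mono, goal_cases)
      case 2: (1 t2 g2 m2)
      then have fr2: "\<forall>r<28. r \<noteq> 5 \<longrightarrow> r \<notin> {16, 17, 18} \<longrightarrow> g2 r = g1 r"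
        and g25: "g2 5 = Num (addr (length ws))" and rec2: "records (\<lambda>_. 0) m2"
        and old2: "\<forall>x. x < T \<or> T + D \<le> x \<longrightarrow> m2 x = ?m x" and t2: "t2 \<le> 20 * D + 10"
        using TE by auto
      have c2: "consts_ok g2" using fr2 1 by (simp add: consts_ok_def)
      have T1: "is_num (m2 (T - 1))" using old2 free[of "T - 1"] by (simp add: T_def)
      have "runs tail_prog g2 m2 (\<lambda>t g' m'. same_below 16 g2 g' \<and>
        (\<forall>r. 24 \<le> r \<longrightarrow> r < 60 \<longrightarrow> g' r = g2 r) \<and> records zlen m' \<and>
        (\<forall>x. x < T \<or> addr (length ws) \<le> x \<longrightarrow> m' x = m2 x) \<and>
        t \<le> (addr (length ws) - T) * (40 * (addr (length ws) + 1 - T) + 40) + 10)"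
        by (rule tail_prog[OF c2 _ g25 rec2 T1]) (use fr2 1 in simp)
      then show ?case
      proof (rule runs_mono, goal_cases)
        case 3: (1 t3 g3 m3)
        then have sb3: "same_below 16 g2 g3"
          and fr3: "\<forall>r. 24 \<le> r \<longrightarrow> r < 60 \<longrightarrow> g3 r = g2 r" and rec3: "records zlen m3"
          and old3: "\<forall>x. x < T \<or> T + D \<le> x \<longrightarrow> m3 x = m2 x"
          and t3: "t3 \<le> D * (40 * (D + 1) + 40) + 10"
          using TE by auto
        note sd3 = same_belowD[OF sb3]
        have c3: "consts_ok g3" using same_below_consts[OF sb3] c2 by simp
        have old: "m3 x = ?m x" if "x < T \<or> T + D \<le> x" for x
          using old2[rule_format, OF that] old3[rule_format, OF that] by simp
        have keep: "word_at m3 b w = word_at ?m b w" if "b + length w \<le> T" for b w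
          using old that by (intro word_at_cong) simp
        have gs: "g3 4 = Num T" "g3 5 = Num (addr (length ws))" "g3 9 = Num y" "g3 10 = Num ve"
          "g3 26 = Num a" "g3 27 = Num N"
          using sd3 fr3 fr2 g25 1 by simp_all
        have "runs finish_prog g3 m3 (\<lambda>t g' m'.
          t \<le> N * (100 * (addr (length ws) - T) + 30) + step_cost * N + 100 \<and>
          (g' 2 = g' 1 \<longleftrightarrow> E short long))"
        proof (rule finish_prog[OF c3 gs rec3])
          show "m3 x = Num 0" if "S \<le> x" for x
            using old free that by (simp add: S_def T_def)
          show "is_num (m3 ve)" using old layout(6,8) by simp
          show "word_at m3 a short" using layout(1-3) keep by simp
          show "length short = N" by (rule layout)
          show "a + N \<le> S" using layout(3) by (simp add: S_def)
          show "word_at m3 y long" using layout(4,6) keep by (simp add: ve_def)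
          show "y + length long = ve" by (simp add: ve_def)
          show "M \<le> y" by (rule layout)
          show "S = addr (length ws) + 1" using TE by (simp add: S_def)
          show "ue = S + (addr (length ws) - T) + N" using TE by (simp add: ue_def)
          show "M \<le> addr (length ws) - T" using TE MD by simp
        qed
        then show ?case
        proof (rule runs_mono, goal_cases)
          case (1 t4 g4 m4)
          then show ?case using \<open>m1 = ?m \<and> t1 \<le> 10 * n + 30 \<and> _\<close> t2 t3 layout(7) TE by auto
        qed
      qed
    qed
    then show ?case using 1 by simp
  qed
  then have "runs word_problem_prog (\<lambda>_. Num 0) ?m (\<lambda>t g m. t \<le> ?B \<and> (g 2 = g 1 \<longleftrightarrow> E u v))"
    unfolding word_problem_prog_def .
  then show ?thesis
  proof (rule runs_mono, goal_cases)
    case (1 t g m)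
    have sc: "step_cost = (M + 1) * (100 * D + 300)" using TE by (simp add: step_cost_def)
    have "D * (40 * (D + 1) + 40) \<le> 4 * M * (40 * (4 * M + 1) + 40)"
      using D4 by (intro mult_le_mono) auto
    moreover have "N * (100 * D + 30) \<le> N * (100 * (4 * M) + 30)"
      using D4 by (intro mult_le_mono) auto
    moreover have "step_cost * N \<le> (M + 1) * (100 * (4 * M) + 300) * N"
      unfolding sc using D4 by (intro mult_le_mono) auto
    ultimately have "?B \<le> 10 * M + 30 + (20 * (4 * M) + 10) + (4 * M * (40 * (4 * M + 1) + 40) + 10) +
        (N * (100 * (4 * M) + 30) + (M + 1) * (100 * (4 * M) + 300) * N + 100)"
      using D4 nM by linarith
    then show ?case using 1 by linarith
  qed
qed

theorem theorem2:
  shows "\<exists>(P :: program) (C :: nat).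
    \<forall>(as :: 'a list) (rs :: ('a list \<times> 'a list) list) (u :: 'a list) (v :: 'a list).
      word_problem_instance as rs u v \<and> small_overlap 4 (set rs) \<longrightarrow>
      answers_within P (encode_instance as rs u v)
        (element_of (set as) (set rs) u = element_of (set as) (set rs) v)
        (C * time_scale (set rs) u v)"
proof (intro exI allI impI)
  fix as :: "'a list" and rs :: "('a list \<times> 'a list) list" and u v :: "'a list"
  assume asm: "word_problem_instance as rs u v \<and> small_overlap 4 (set rs)"
  define M where "M = relations_size (set rs)"
  define N where "N = min (length u) (length v)"
  let ?t = "10 * M + 30 + (20 * (4 * M) + 10) + (4 * M * (40 * (4 * M + 1) + 40) + 10) +
    (N * (100 * (4 * M) + 30) + (M + 1) * (100 * (4 * M) + 300) * N + 100)"
  have pres: "finite_presentation (set as) (set rs)" "u \<in> lists (set as)" "v \<in> lists (set as)"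
    using asm by (auto simp: word_problem_instance_def)
  have ans: "element_of (set as) (set rs) u = element_of (set as) (set rs) v \<longleftrightarrow>
      (rewr (set rs))\<^sup>*\<^sup>* u v" by (rule element_of_eq_iff[OF pres])
  have "runs word_problem_prog (\<lambda>_. Num 0)
      (\<lambda>i. if i < length (encode_instance as rs u v) then encode_instance as rs u v ! i else Num 0)
      (\<lambda>t g m. t \<le> ?t \<and> (g 2 = g 1 \<longleftrightarrow> element_of (set as) (set rs) u = element_of (set as) (set rs) v))"
    using word_problem_prog[OF _ _ M_def N_def, of as] asm
    unfolding ans memory_of_def by (auto elim!: runs_mono)
  from decision_program_answers[OF this]
  have "answers_within (decision_program word_problem_prog) (encode_instance as rs u v)
      (element_of (set as) (set rs) u = element_of (set as) (set rs) v) (?t + 1)" .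
  moreover have "?t + 1 \<le> 6000 * time_scale (set rs) u v"
  proof -
    \<comment> \<open>Raising both quantities to at least 1 lets \<open>s * s * k\<close> dominate
      every summand, also for an empty presentation or an empty word.\<close>
    define s where "s = max 1 M"
    define k where "k = max 1 N"
    have sk: "1 \<le> s" "1 \<le> k" "M \<le> s" "N \<le> k" by (auto simp: s_def k_def)
    let ?X = "s * s * k"
    have X: "s \<le> s * s" "s * s \<le> ?X" "s * k \<le> ?X" using sk by simp_all
    \<comment> \<open>Besides the three products, the coefficients of \<open>M\<close> and the
      constants add up to 241; the total is 3031, so 6000 is generous.\<close>
    have total: "10 * M + 30 + (20 * (4 * M) + 10) + (a + 10) + (b + c + 100) + 1 \<le> 6000 * x"
      if "a \<le> 960 * x" "b \<le> 430 * x" "c \<le> 1400 * x" "M \<le> x" "1 \<le> x" for a b c x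
      using that by linarith
    have a: "4 * M * (40 * (4 * M + 1) + 40) \<le> (4 * s) * (240 * s)"
      using sk by (intro mult_le_mono) auto
    have b: "N * (100 * (4 * M) + 30) \<le> k * (430 * s)" using sk by (intro mult_le_mono) auto
    have c: "(M + 1) * (100 * (4 * M) + 300) * N \<le> (2 * s) * (700 * s) * k"
      using sk by (intro mult_le_mono) auto
    have eqs: "(4 * s) * (240 * s) = 960 * (s * s)" "k * (430 * s) = 430 * (s * k)"
      "(2 * s) * (700 * s) * k = 1400 * ?X" by simp_all
    have "?t + 1 \<le> 6000 * ?X"
    proof (rule total)
      show "4 * M * (40 * (4 * M + 1) + 40) \<le> 960 * ?X" using a X unfolding eqs by linarith
      show "N * (100 * (4 * M) + 30) \<le> 430 * ?X" using b X unfolding eqs by linarith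
      show "(M + 1) * (100 * (4 * M) + 300) * N \<le> 1400 * ?X" using c unfolding eqs .
      show "M \<le> ?X" "1 \<le> ?X" using X sk by linarith+
    qed
    moreover have "time_scale (set rs) u v = s * s * k"
      by (simp add: time_scale_def s_def k_def M_def N_def power2_eq_square)
    ultimately show ?thesis by simp
  qed
  ultimately show "answers_within (decision_program word_problem_prog) (encode_instance as rs u v)
      (element_of (set as) (set rs) u = element_of (set as) (set rs) v)
      (6000 * time_scale (set rs) u v)"
    unfolding answers_within_def by (meson le_trans)
qed

end
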